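(* Let $\Gamma=(\mathscr{C},\mathscr{X},I,H,\eta,\epsilon,\mathcal{E},\mathcal{F})$ be a Galois structure. Assume that $I\colon\mathscr{C}\to\mathscr{X}$ preserves every pullback square $$\begin{array}{ccc} D & \to & A\\ \downarrow & & \downarrow{\scriptstyle f}\\ C & \xrightarrow{\;g\;} & B\end{array}$$ in $\mathscr{C}$ for which $f$ is a split epimorphism and both $f$ and $g$ are in $\mathcal{E}$. Then, for any $f\colon A\to B$ in $\mathcal{E}$, the following are equivalent: (1) $f$ is a normal extension; (2) there exists a monadic extension $p\colon E\to B$ such that $p^*(f)$ is both a trivial extension and a split epimorphism.
   Context: A Galois structure $\Gamma=(\mathscr{C},\mathscr{X},I,H,\eta,\epsilon,\mathcal{E},\mathcal{F})$ consists of categories $\mathscr{C}$, $\mathscr{X}$, an adjunction $I\dashv H$ with left adjoint $I\colon\mathscr{C}\to\mathscr{X}$, right adjoint $H\colon\mathscr{X}\to\mathscr{C}$, unit $\eta\colon 1_{\mathscr{C}}\Rightarrow HI$ and counit $\epsilon\colon IH\Rightarrow 1_{\mathscr{X}}$, and classes $\mathcal{E}$, $\mathcal{F}$ of morphisms of $\mathscr{C}$, $\mathscr{X}$ respectively. Each class contains all isomorphisms, is closed under composition, and is closed under pullback (pullbacks of its members along arbitrary morphisms exist and are again in the class). Moreover $I(\mathcal{E})\subseteq\mathcal{F}$ and $H(\mathcal{F})\subseteq\mathcal{E}$. Morphisms in $\mathcal{E}$ are called extensions (a morphism $f\colon A\to B$ in $\mathcal{E}$ is an extension of $B$). $(\mathscr{C}\downarrow_{\mathcal{E}}B)$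 is the full subcategory of the comma (slice) category $(\mathscr{C}\downarrow B)$ on the extensions of $B$. For an extension $p\colon E\to B$, $p^*\colon(\mathscr{C}\downarrow_{\mathcal{E}}B)\to(\mathscr{C}\downarrow_{\mathcal{E}}E)$ is the change-of-base (pullback along $p$) functor; for an extension $f\colon A\to B$, $p^*(f)\colon E\times_BA\to E$ is the pullback of $f$ along $p$. An extension $f\colon A\to B$ is: - trivial if the naturality square $HI(f)\circ\eta_A=\eta_B\circ f$ is a pullback; - monadic if $f^*\colon(\mathscr{C}\downarrow_{\mathcal{E}}B)\to(\mathscr{C}\downarrow_{\mathcal{E}}A)$ is a monadic functor; - normal if it is monadic and $f^*(f)$ (the first kernel pair projection $A\times_BA\to A$) is a trivial extension. *)

theory Defs
  imports Main
begin

section \<open>Categories\<close>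

record ('o, 'a) cat =
  Obj :: "'o set"
  Arr :: "'a set"
  Dom :: "'a \<Rightarrow> 'o"
  Cod :: "'a \<Rightarrow> 'o"
  Ident :: "'o \<Rightarrow> 'a"
  Comp :: "'a \<Rightarrow> 'a \<Rightarrow> 'a"  (infixr \<open>\<cdot>\<index>\<close> 70)

definition Hom :: "('o, 'a) cat \<Rightarrow> 'o \<Rightarrow> 'o \<Rightarrow> 'a set" where
  "Hom C A B = {f \<in> Arr C. Dom C f = A \<and> Cod C f = B}"

locale category =
  fixes C :: "('o, 'a) cat" (structure)
  assumes Dom_Obj: "f \<in> Arr C \<Longrightarrow> Dom C f \<in> Obj C"
    and Cod_Obj: "f \<in> Arr C \<Longrightarrow> Cod C f \<in> Obj C"
    and Ident_Hom: "A \<in> Obj C \<Longrightarrow> Ident C A \<in> Hom C A A"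
    and Comp_Hom: "\<lbrakk>f \<in> Hom C A B; g \<in> Hom C B D\<rbrakk> \<Longrightarrow> g \<cdot> f \<in> Hom C A D"
    and Comp_Ident: "f \<in> Hom C A B \<Longrightarrow> f \<cdot> Ident C A = f"
    and Ident_Comp: "f \<in> Hom C A B \<Longrightarrow> Ident C B \<cdot> f = f"
    and Comp_assoc:
      "\<lbrakk>f \<in> Hom C A B; g \<in> Hom C B D; h \<in> Hom C D D'\<rbrakk> \<Longrightarrow> (h \<cdot> g) \<cdot> f = h \<cdot> (g \<cdot> f)"

definition is_iso :: "('o, 'a) cat \<Rightarrow> 'a \<Rightarrow> bool" where
  "is_iso C f \<longleftrightarrow> f \<in> Arr C \<and>
     (\<exists>g \<in> Hom C (Cod C f) (Dom C f).
        g \<cdot>\<^bsub>C\<^esub> f = Ident C (Dom C f) \<and> f \<cdot>\<^bsub>C\<^esub> g = Ident C (Cod C f))"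

definition split_epi :: "('o, 'a) cat \<Rightarrow> 'a \<Rightarrow> bool" where
  "split_epi C f \<longleftrightarrow> f \<in> Arr C \<and>
     (\<exists>s \<in> Hom C (Cod C f) (Dom C f). f \<cdot>\<^bsub>C\<^esub> s = Ident C (Cod C f))"

text \<open>\<open>is_pullback C f g a c\<close>: the square with edges \<open>a : D \<rightarrow> A\<close> (top), \<open>c : D \<rightarrow> C'\<close> (left),
  \<open>f : A \<rightarrow> B\<close> (right) and \<open>g : C' \<rightarrow> B\<close> (bottom) is a pullback, so that \<open>c\<close> is the
  pullback of \<open>f\<close> along \<open>g\<close>.\<close>

definition is_pullback :: "('o, 'a) cat \<Rightarrow> 'a \<Rightarrow> 'a \<Rightarrow> 'a \<Rightarrow> 'a \<Rightarrow> bool" where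
  "is_pullback C f g a c \<longleftrightarrow>
     f \<in> Arr C \<and> g \<in> Arr C \<and> Cod C f = Cod C g \<and>
     a \<in> Hom C (Dom C a) (Dom C f) \<and> c \<in> Hom C (Dom C a) (Dom C g) \<and>
     f \<cdot>\<^bsub>C\<^esub> a = g \<cdot>\<^bsub>C\<^esub> c \<and>
     (\<forall>Z x y. x \<in> Hom C Z (Dom C f) \<and> y \<in> Hom C Z (Dom C g) \<and> f \<cdot>\<^bsub>C\<^esub> x = g \<cdot>\<^bsub>C\<^esub> y \<longrightarrow>
        (\<exists>!h. h \<in> Hom C Z (Dom C a) \<and> a \<cdot>\<^bsub>C\<^esub> h = x \<and> c \<cdot>\<^bsub>C\<^esub> h = y))"


section \<open>Functors, natural transformations, adjunctions, equivalences\<close>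

record ('o, 'a, 'p, 'b) funct =
  FObj :: "'o \<Rightarrow> 'p"
  FArr :: "'a \<Rightarrow> 'b"

locale cat_functor = source: category C + target: category D
  for C :: "('o, 'a) cat" and D :: "('p, 'b) cat" and F :: "('o, 'a, 'p, 'b) funct" +
  assumes FObj_Obj: "A \<in> Obj C \<Longrightarrow> FObj F A \<in> Obj D"
    and FArr_Hom: "f \<in> Hom C A B \<Longrightarrow> FArr F f \<in> Hom D (FObj F A) (FObj F B)"
    and FArr_Ident: "A \<in> Obj C \<Longrightarrow> FArr F (Ident C A) = Ident D (FObj F A)"
    and FArr_Comp: "\<lbrakk>f \<in> Hom C A B; g \<in> Hom C B B'\<rbrakk> \<Longrightarrow>
      FArr F (g \<cdot>\<^bsub>C\<^esub> f) = FArr F g \<cdot>\<^bsub>D\<^esub> FArr F f"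

definition id_funct :: "('o, 'a, 'o, 'a) funct" where
  "id_funct = \<lparr>FObj = (\<lambda>A. A), FArr = (\<lambda>f. f)\<rparr>"

definition comp_funct ::
  "('p, 'b, 'q, 'c) funct \<Rightarrow> ('o, 'a, 'p, 'b) funct \<Rightarrow> ('o, 'a, 'q, 'c) funct"
  (infixr \<open>\<circ>\<^sub>F\<close> 55) where
  "G \<circ>\<^sub>F F = \<lparr>FObj = (\<lambda>A. FObj G (FObj F A)), FArr = (\<lambda>f. FArr G (FArr F f))\<rparr>"

definition nat_trans ::
  "('o, 'a) cat \<Rightarrow> ('p, 'b) cat \<Rightarrow> ('o, 'a, 'p, 'b) funct \<Rightarrow> ('o, 'a, 'p, 'b) funct \<Rightarrow>
   ('o \<Rightarrow> 'b) \<Rightarrow> bool" where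
  "nat_trans C D F G \<tau> \<longleftrightarrow>
     cat_functor C D F \<and> cat_functor C D G \<and>
     (\<forall>A \<in> Obj C. \<tau> A \<in> Hom D (FObj F A) (FObj G A)) \<and>
     (\<forall>A B. \<forall>f \<in> Hom C A B. FArr G f \<cdot>\<^bsub>D\<^esub> \<tau> A = \<tau> B \<cdot>\<^bsub>D\<^esub> FArr F f)"

definition nat_iso ::
  "('o, 'a) cat \<Rightarrow> ('p, 'b) cat \<Rightarrow> ('o, 'a, 'p, 'b) funct \<Rightarrow> ('o, 'a, 'p, 'b) funct \<Rightarrow>
   ('o \<Rightarrow> 'b) \<Rightarrow> bool" where
  "nat_iso C D F G \<tau> \<longleftrightarrow> nat_trans C D F G \<tau> \<and> (\<forall>A \<in> Obj C. is_iso D (\<tau> A))"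

definition adjunction ::
  "('o, 'a) cat \<Rightarrow> ('p, 'b) cat \<Rightarrow> ('o, 'a, 'p, 'b) funct \<Rightarrow> ('p, 'b, 'o, 'a) funct \<Rightarrow>
   ('o \<Rightarrow> 'a) \<Rightarrow> ('p \<Rightarrow> 'b) \<Rightarrow> bool" where
  "adjunction C X I H \<eta> \<epsilon> \<longleftrightarrow>
     cat_functor C X I \<and> cat_functor X C H \<and>
     nat_trans C C id_funct (H \<circ>\<^sub>F I) \<eta> \<and> nat_trans X X (I \<circ>\<^sub>F H) id_funct \<epsilon> \<and>
     (\<forall>A \<in> Obj C. \<epsilon> (FObj I A) \<cdot>\<^bsub>X\<^esub> FArr I (\<eta> A) = Ident X (FObj I A)) \<and>
     (\<forall>Y \<in> Obj X. FArr H (\<epsilon> Y) \<cdot>\<^bsub>C\<^esub> \<eta> (FObj H Y) = Ident C (FObj H Y))"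

definition equivalence ::
  "('o, 'a) cat \<Rightarrow> ('p, 'b) cat \<Rightarrow> ('o, 'a, 'p, 'b) funct \<Rightarrow> bool" where
  "equivalence C D F \<longleftrightarrow>
     cat_functor C D F \<and>
     (\<exists>G \<alpha> \<beta>. cat_functor D C G \<and>
        nat_iso C C id_funct (G \<circ>\<^sub>F F) \<alpha> \<and> nat_iso D D (F \<circ>\<^sub>F G) id_funct \<beta>)"


section \<open>Monadic functors\<close>

definition em_algebras ::
  "('o, 'a) cat \<Rightarrow> ('o, 'a, 'o, 'a) funct \<Rightarrow> ('o \<Rightarrow> 'a) \<Rightarrow> ('o \<Rightarrow> 'a) \<Rightarrow> ('o \<times> 'a) set" where
  "em_algebras C T \<eta> \<mu> =
     {(A, a). A \<in> Obj C \<and> a \<in> Hom C (FObj T A) A \<and>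
        a \<cdot>\<^bsub>C\<^esub> \<eta> A = Ident C A \<and> a \<cdot>\<^bsub>C\<^esub> FArr T a = a \<cdot>\<^bsub>C\<^esub> \<mu> A}"

text \<open>The Eilenberg--Moore category of the monad \<open>(T, \<eta>, \<mu>)\<close>. Here and in \<open>slice\<close> an arrow is a
  triple that records its domain and codomain along with the underlying arrow.\<close>

definition em_cat ::
  "('o, 'a) cat \<Rightarrow> ('o, 'a, 'o, 'a) funct \<Rightarrow> ('o \<Rightarrow> 'a) \<Rightarrow> ('o \<Rightarrow> 'a) \<Rightarrow>
   ('o \<times> 'a, ('o \<times> 'a) \<times> 'a \<times> ('o \<times> 'a)) cat" where
  "em_cat C T \<eta> \<mu> =
     \<lparr>Obj = em_algebras C T \<eta> \<mu>,
      Arr = {(x, h, y). x \<in> em_algebras C T \<eta> \<mu> \<and> y \<in> em_algebras C T \<eta> \<mu> \<and>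
               h \<in> Hom C (fst x) (fst y) \<and> h \<cdot>\<^bsub>C\<^esub> snd x = snd y \<cdot>\<^bsub>C\<^esub> FArr T h},
      Dom = (\<lambda>(x, h, y). x),
      Cod = (\<lambda>(x, h, y). y),
      Ident = (\<lambda>x. (x, Ident C (fst x), x)),
      Comp = (\<lambda>(y, k, z) (x, h, y'). (x, k \<cdot>\<^bsub>C\<^esub> h, z))\<rparr>"

definition em_comparison ::
  "('p, 'b) cat \<Rightarrow> ('p, 'b, 'o, 'a) funct \<Rightarrow> ('p \<Rightarrow> 'b) \<Rightarrow>
   ('p, 'b, 'o \<times> 'a, ('o \<times> 'a) \<times> 'a \<times> ('o \<times> 'a)) funct" where
  "em_comparison D U \<epsilon> =
     (let K = (\<lambda>Y. (FObj U Y, FArr U (\<epsilon> Y)))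
      in \<lparr>FObj = K, FArr = (\<lambda>h. (K (Dom D h), FArr U h, K (Cod D h)))\<rparr>)"

text \<open>\<open>U : D \<rightarrow> C\<close> is monadic if it has a left adjoint and the comparison functor into the
  algebras of the induced monad is an equivalence (not necessarily an isomorphism) of
  categories.\<close>

definition monadic ::
  "('p, 'b) cat \<Rightarrow> ('o, 'a) cat \<Rightarrow> ('p, 'b, 'o, 'a) funct \<Rightarrow> bool" where
  "monadic D C U \<longleftrightarrow>
     (\<exists>L \<eta> \<epsilon>. adjunction C D L U \<eta> \<epsilon> \<and>
        equivalence D (em_cat C (U \<circ>\<^sub>F L) \<eta> (\<lambda>A. FArr U (\<epsilon> (FObj L A)))) (em_comparison D U \<epsilon>))"


section \<open>Slice categories and change of base\<close>

definition slice :: "('o, 'a) cat \<Rightarrow> 'o \<Rightarrow> ('a, 'a \<times> 'a \<times> 'a) cat" where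
  "slice C B =
     \<lparr>Obj = {f \<in> Arr C. Cod C f = B},
      Arr = {(f, h, g). f \<in> Arr C \<and> Cod C f = B \<and> g \<in> Arr C \<and> Cod C g = B \<and>
               h \<in> Hom C (Dom C f) (Dom C g) \<and> g \<cdot>\<^bsub>C\<^esub> h = f},
      Dom = (\<lambda>(f, h, g). f),
      Cod = (\<lambda>(f, h, g). g),
      Ident = (\<lambda>f. (f, Ident C (Dom C f), f)),
      Comp = (\<lambda>(g, k, l) (f, h, g'). (f, k \<cdot>\<^bsub>C\<^esub> h, l))\<rparr>"

definition full_subcat :: "('o, 'a) cat \<Rightarrow> 'o set \<Rightarrow> ('o, 'a) cat" where
  "full_subcat C S =
     C\<lparr>Obj := Obj C \<inter> S, Arr := {f \<in> Arr C. Dom C f \<in> S \<and> Cod C f \<in> S}\<rparr>"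

text \<open>A choice of the pullback of \<open>f\<close> along \<open>p\<close>; \<open>pb_along C p f\<close> is the morphism \<open>p\<^sup>*(f)\<close> with
  codomain \<open>Dom C p\<close>, and \<open>pb_top C p f\<close> is the projection to \<open>Dom C f\<close>.\<close>

definition pb_cone :: "('o, 'a) cat \<Rightarrow> 'a \<Rightarrow> 'a \<Rightarrow> 'a \<times> 'a" where
  "pb_cone C p f = (SOME q. is_pullback C f p (fst q) (snd q))"

definition pb_top :: "('o, 'a) cat \<Rightarrow> 'a \<Rightarrow> 'a \<Rightarrow> 'a" where
  "pb_top C p f = fst (pb_cone C p f)"

definition pb_along :: "('o, 'a) cat \<Rightarrow> 'a \<Rightarrow> 'a \<Rightarrow> 'a" where
  "pb_along C p f = snd (pb_cone C p f)"

definition change_of_base ::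
  "('o, 'a) cat \<Rightarrow> 'a \<Rightarrow> ('a, 'a \<times> 'a \<times> 'a, 'a, 'a \<times> 'a \<times> 'a) funct" where
  "change_of_base C p =
     \<lparr>FObj = pb_along C p,
      FArr = (\<lambda>(f, h, g).
        (pb_along C p f,
         (THE k. k \<in> Hom C (Dom C (pb_along C p f)) (Dom C (pb_along C p g)) \<and>
            pb_top C p g \<cdot>\<^bsub>C\<^esub> k = h \<cdot>\<^bsub>C\<^esub> pb_top C p f \<and>
            pb_along C p g \<cdot>\<^bsub>C\<^esub> k = pb_along C p f),
         pb_along C p g))\<rparr>"


section \<open>Galois structures\<close>

definition admissible_class :: "('o, 'a) cat \<Rightarrow> 'a set \<Rightarrow> bool" where
  "admissible_class C E \<longleftrightarrow>
     E \<subseteq> Arr C \<and>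
     (\<forall>f. is_iso C f \<longrightarrow> f \<in> E) \<and>
     (\<forall>f \<in> E. \<forall>g \<in> E. Dom C g = Cod C f \<longrightarrow> g \<cdot>\<^bsub>C\<^esub> f \<in> E) \<and>
     (\<forall>f \<in> E. \<forall>g \<in> Arr C. Cod C g = Cod C f \<longrightarrow>
        (\<exists>a c. is_pullback C f g a c) \<and> (\<forall>a c. is_pullback C f g a c \<longrightarrow> c \<in> E))"

record ('oc, 'ac, 'ox, 'ax) galois =
  gal_C :: "('oc, 'ac) cat"
  gal_X :: "('ox, 'ax) cat"
  gal_I :: "('oc, 'ac, 'ox, 'ax) funct"
  gal_H :: "('ox, 'ax, 'oc, 'ac) funct"
  gal_eta :: "'oc \<Rightarrow> 'ac"
  gal_eps :: "'ox \<Rightarrow> 'ax"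
  gal_E :: "'ac set"
  gal_F :: "'ax set"

definition galois_structure :: "('oc, 'ac, 'ox, 'ax) galois \<Rightarrow> bool" where
  "galois_structure \<Gamma> \<longleftrightarrow>
     category (gal_C \<Gamma>) \<and> category (gal_X \<Gamma>) \<and>
     adjunction (gal_C \<Gamma>) (gal_X \<Gamma>) (gal_I \<Gamma>) (gal_H \<Gamma>) (gal_eta \<Gamma>) (gal_eps \<Gamma>) \<and>
     admissible_class (gal_C \<Gamma>) (gal_E \<Gamma>) \<and> admissible_class (gal_X \<Gamma>) (gal_F \<Gamma>) \<and>
     FArr (gal_I \<Gamma>) ` gal_E \<Gamma> \<subseteq> gal_F \<Gamma> \<and> FArr (gal_H \<Gamma>) ` gal_F \<Gamma> \<subseteq> gal_E \<Gamma>"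

definition ext_slice ::
  "('oc, 'ac, 'ox, 'ax) galois \<Rightarrow> 'oc \<Rightarrow> ('ac, 'ac \<times> 'ac \<times> 'ac) cat" where
  "ext_slice \<Gamma> B = full_subcat (slice (gal_C \<Gamma>) B) (gal_E \<Gamma>)"

definition trivial_extension :: "('oc, 'ac, 'ox, 'ax) galois \<Rightarrow> 'ac \<Rightarrow> bool" where
  "trivial_extension \<Gamma> f \<longleftrightarrow>
     f \<in> gal_E \<Gamma> \<and>
     is_pullback (gal_C \<Gamma>) (FArr (gal_H \<Gamma> \<circ>\<^sub>F gal_I \<Gamma>) f) (gal_eta \<Gamma> (Cod (gal_C \<Gamma>) f))
       (gal_eta \<Gamma> (Dom (gal_C \<Gamma>) f)) f"

definition monadic_extension :: "('oc, 'ac, 'ox, 'ax) galois \<Rightarrow> 'ac \<Rightarrow> bool" where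
  "monadic_extension \<Gamma> f \<longleftrightarrow>
     f \<in> gal_E \<Gamma> \<and>
     monadic (ext_slice \<Gamma> (Cod (gal_C \<Gamma>) f)) (ext_slice \<Gamma> (Dom (gal_C \<Gamma>) f))
       (change_of_base (gal_C \<Gamma>) f)"

definition normal_extension :: "('oc, 'ac, 'ox, 'ax) galois \<Rightarrow> 'ac \<Rightarrow> bool" where
  "normal_extension \<Gamma> f \<longleftrightarrow>
     monadic_extension \<Gamma> f \<and> trivial_extension \<Gamma> (pb_along (gal_C \<Gamma>) f f)"

end

theory Submission
  imports Defs
begin

text \<open>For the implication from normality take \<open>p = f\<close>: the kernel pair projection of \<open>f\<close> is split by the
diagonal. The converse has two independent parts. Let \<open>b = p\<^sup>*(f)\<close>, let \<open>g\<close> be the other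
projection of that pullback, to the domain of \<open>f\<close>, and let \<open>s\<close> be a section of \<open>b\<close>.

\<^emph>\<open>Monadicity of \<open>f\<close>.\<close> Since \<open>f \<cdot> (g \<cdot> s) = p\<close>, the monadic extension \<open>p\<close> factors through the extension
\<open>f\<close>, and this alone makes \<open>f\<close> monadic (\<open>monadic_change_of_base_factor\<close>). The proof uses Beck's theorem
in both directions. With \<open>t = g \<cdot> s\<close> the functor \<open>p\<^sup>*\<close> is isomorphic to \<open>t\<^sup>* f\<^sup>*\<close>, so \<open>f\<^sup>*\<close> reflects
isomorphisms, and every \<open>f\<^sup>*\<close>-split pair is \<open>p\<^sup>*\<close>-split and hence has a coequalizer \<open>e\<close>. That \<open>f\<^sup>*\<close>
preserves \<open>e\<close> is not visible through \<open>t\<^sup>*\<close>, which need not reflect isomorphisms. Instead one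
composes with \<open>f\<close> and applies \<open>p\<^sup>*\<close>: the composite \<open>p\<^sup>* f\<^sub>! f\<^sup>*\<close> is isomorphic to \<open>b\<^sub>! b\<^sup>* p\<^sup>*\<close>, and the latter
carries \<open>e\<close> to a split coequalizer because \<open>p\<^sup>*(e)\<close> already is one.

\<^emph>\<open>Triviality of the kernel pair projection \<open>k\<close> of \<open>f\<close>.\<close> The pullback of \<open>k\<close> along \<open>g\<close> is also the pullback
of \<open>b\<close> along itself, because \<open>f \<cdot> g = p \<cdot> b\<close>. It is trivial since \<open>b\<close> is trivial and \<open>I\<close> preserves this
square (\<open>trivial_extension_pullback\<close>). Now \<open>I\<close> also preserves the pullback of \<open>k\<close> along \<open>g\<close>, as \<open>k\<close> is
a split epimorphism, and \<open>g\<close> is a pullback of the monadic extension \<open>p\<close>; so triviality descends from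
the pullback to \<open>k\<close> (\<open>trivial_extension_descends\<close>).\<close>

section \<open>Arrows, functors and isomorphisms\<close>

context category
begin

lemma comp_arr [simp]:
  assumes "f \<in> Arr C" "g \<in> Arr C" "Cod C f = Dom C g"
  shows "g \<cdot> f \<in> Arr C" "Dom C (g \<cdot> f) = Dom C f" "Cod C (g \<cdot> f) = Cod C g"
  using Comp_Hom[of f "Dom C f" "Cod C f" g "Cod C g"] assms by (auto simp: Hom_def)

lemma ident_arr [simp]:
  assumes "A \<in> Obj C"
  shows "Ident C A \<in> Arr C" "Dom C (Ident C A) = A" "Cod C (Ident C A) = A"
  using Ident_Hom[OF assms] by (auto simp: Hom_def)

lemma comp_ident [simp]: "f \<in> Arr C \<Longrightarrow> Dom C f = A \<Longrightarrow> f \<cdot> Ident C A = f"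
  using Comp_Ident by (auto simp: Hom_def)

lemma ident_comp [simp]: "f \<in> Arr C \<Longrightarrow> Cod C f = A \<Longrightarrow> Ident C A \<cdot> f = f"
  using Ident_Comp by (auto simp: Hom_def)

lemma assoc [simp]:
  assumes "f \<in> Arr C" "g \<in> Arr C" "h \<in> Arr C" "Cod C f = Dom C g" "Cod C g = Dom C h"
  shows "(h \<cdot> g) \<cdot> f = h \<cdot> (g \<cdot> f)"
  using Comp_assoc[of f _ _ g _ h] assms by (auto simp: Hom_def)

declare Dom_Obj [simp] Cod_Obj [simp]

text \<open>Composites are normalized by nesting to the right, which hides a subterm \<open>g \<cdot> f\<close> whenever something is
composed on its right. This rule turns an equation for \<open>g \<cdot> f\<close> into one that applies there.\<close>

lemma reassoc:
  assumes "g \<cdot> f = k" "f \<in> Arr C" "g \<in> Arr C" "Cod C f = Dom C g" "x \<in> Arr C" "Cod C x = Dom C f"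
  shows "g \<cdot> (f \<cdot> x) = k \<cdot> x"
  using assms assoc by metis

lemma is_isoE:
  assumes "is_iso C f"
  obtains g where "g \<in> Arr C" "Dom C g = Cod C f" "Cod C g = Dom C f"
    "g \<cdot> f = Ident C (Dom C f)" "f \<cdot> g = Ident C (Cod C f)"
  using assms by (auto simp: is_iso_def Hom_def)

definition inverse_arr :: "'a \<Rightarrow> 'a" where
  "inverse_arr f = (SOME g. g \<in> Arr C \<and> Dom C g = Cod C f \<and> Cod C g = Dom C f \<and>
     g \<cdot> f = Ident C (Dom C f) \<and> f \<cdot> g = Ident C (Cod C f))"

lemma iso_arr: "is_iso C f \<Longrightarrow> f \<in> Arr C"
  by (simp add: is_iso_def)

lemma inverse_arr:
  assumes "is_iso C f"
  shows "inverse_arr f \<in> Arr C" "Dom C (inverse_arr f) = Cod C f" "Cod C (inverse_arr f) = Dom C f"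
    "inverse_arr f \<cdot> f = Ident C (Dom C f)" "f \<cdot> inverse_arr f = Ident C (Cod C f)"
proof -
  have "\<exists>g. g \<in> Arr C \<and> Dom C g = Cod C f \<and> Cod C g = Dom C f \<and>
     g \<cdot> f = Ident C (Dom C f) \<and> f \<cdot> g = Ident C (Cod C f)"
    using assms by (auto simp: is_iso_def Hom_def)
  from someI_ex[OF this]
  show "inverse_arr f \<in> Arr C" "Dom C (inverse_arr f) = Cod C f" "Cod C (inverse_arr f) = Dom C f"
    "inverse_arr f \<cdot> f = Ident C (Dom C f)" "f \<cdot> inverse_arr f = Ident C (Cod C f)"
    by (simp_all add: inverse_arr_def)
qed

lemma is_isoI:
  assumes "f \<in> Arr C" "g \<in> Arr C" "Dom C g = Cod C f" "Cod C g = Dom C f"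
    "g \<cdot> f = Ident C (Dom C f)" "f \<cdot> g = Ident C (Cod C f)"
  shows "is_iso C f"
  using assms by (auto simp: is_iso_def Hom_def)

lemma iso_inverse_arr: "is_iso C f \<Longrightarrow> is_iso C (inverse_arr f)"
  by (rule is_isoI[where g = f]) (auto simp: inverse_arr iso_arr)

lemma iso_comp:
  assumes "is_iso C f" "is_iso C g" "Cod C f = Dom C g"
  shows "is_iso C (g \<cdot> f)"
  by (rule is_isoI[where g = "inverse_arr f \<cdot> inverse_arr g"])
    (use assms inverse_arr[of f] inverse_arr[of g] iso_arr[of f] iso_arr[of g]
      inverse_arr(4)[of g, THEN reassoc] inverse_arr(5)[of f, THEN reassoc] in simp_all)

lemma iso_cancel_left:
  assumes "is_iso C i" "x \<in> Arr C" "y \<in> Arr C" "Cod C x = Dom C i" "Cod C y = Dom C i" "i \<cdot> x = i \<cdot> y"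
  shows "x = y"
proof -
  obtain j where j: "j \<in> Arr C" "Dom C j = Cod C i" "Cod C j = Dom C i" "j \<cdot> i = Ident C (Dom C i)"
    using assms(1) by (elim is_isoE)
  have i: "i \<in> Arr C" using assms(1) by (simp add: is_iso_def)
  have "j \<cdot> (i \<cdot> x) = j \<cdot> (i \<cdot> y)" using assms by simp
  then show ?thesis using assms(2-5) j i by (simp flip: assoc)
qed

lemma split_epi_cancel:
  assumes "q \<cdot> s = Ident C (Cod C q)" "q \<in> Arr C" "s \<in> Arr C" "Cod C s = Dom C q"
    "x \<in> Arr C" "y \<in> Arr C" "Dom C x = Cod C q" "Dom C y = Cod C q" "x \<cdot> q = y \<cdot> q"
  shows "x = y"
proof -
  have "(x \<cdot> q) \<cdot> s = (y \<cdot> q) \<cdot> s" using assms by simp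
  then show ?thesis using assms(1-8) by simp
qed

lemma iso_cancel_right:
  assumes "is_iso C i" "x \<in> Arr C" "y \<in> Arr C" "Dom C x = Cod C i" "Dom C y = Cod C i" "x \<cdot> i = y \<cdot> i"
  shows "x = y"
  using assms(1)
proof (rule is_isoE)
  fix j assume "j \<in> Arr C" "Dom C j = Cod C i" "Cod C j = Dom C i" "i \<cdot> j = Ident C (Cod C i)"
  moreover have "i \<in> Arr C" using assms(1) by (simp add: is_iso_def)
  ultimately show ?thesis using split_epi_cancel[of i j x y] assms by simp
qed

lemma iso_comp_cancel:
  assumes "is_iso C i" "is_iso C (g \<cdot> i)" "g \<in> Arr C" "Dom C g = Cod C i"
  shows "is_iso C g"
proof -
  have "is_iso C ((g \<cdot> i) \<cdot> inverse_arr i)"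
    by (rule iso_comp) (use assms inverse_arr[of i] iso_arr[of i] iso_inverse_arr in simp_all)
  then show ?thesis
    using inverse_arr[of i] assms iso_arr[of i] by simp
qed

end

lemma comp_funct_simps [simp]:
  "FObj (G \<circ>\<^sub>F F) A = FObj G (FObj F A)" "FArr (G \<circ>\<^sub>F F) f = FArr G (FArr F f)"
  by (simp_all add: comp_funct_def)

lemma id_funct_simps [simp]: "FObj id_funct A = A" "FArr id_funct f = f"
  by (simp_all add: id_funct_def)

context cat_functor
begin

lemma F_arr [simp]:
  assumes "f \<in> Arr C"
  shows "FArr F f \<in> Arr D" "Dom D (FArr F f) = FObj F (Dom C f)" "Cod D (FArr F f) = FObj F (Cod C f)"
  using FArr_Hom[of f "Dom C f" "Cod C f"] assms by (auto simp: Hom_def)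

lemma F_comp:
  assumes "f \<in> Arr C" "g \<in> Arr C" "Cod C f = Dom C g"
  shows "FArr F (g \<cdot>\<^bsub>C\<^esub> f) = FArr F g \<cdot>\<^bsub>D\<^esub> FArr F f"
  using FArr_Comp[of f _ _ g] assms by (auto simp: Hom_def)

declare FObj_Obj [simp] FArr_Ident [simp]

lemma F_iso: "is_iso C f \<Longrightarrow> is_iso D (FArr F f)"
  by (rule target.is_isoI[where g = "FArr F (source.inverse_arr f)"])
    (simp_all add: source.inverse_arr source.iso_arr flip: F_comp)

end

lemma cat_functor_comp:
  assumes "cat_functor C D F" "cat_functor D E G"
  shows "cat_functor C E (G \<circ>\<^sub>F F)"
proof -
  interpret F: cat_functor C D F by fact
  interpret G: cat_functor D E G by fact
  show ?thesis
    by unfold_locales (auto simp: Hom_def F.F_comp G.F_comp)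
qed

lemma cat_functor_id: "category C \<Longrightarrow> cat_functor C C id_funct"
  by (simp add: cat_functor_def cat_functor_axioms_def)

lemma nat_transD:
  assumes "nat_trans C D F G \<tau>"
  shows "A \<in> Obj C \<Longrightarrow> \<tau> A \<in> Arr D" "A \<in> Obj C \<Longrightarrow> Dom D (\<tau> A) = FObj F A"
    "A \<in> Obj C \<Longrightarrow> Cod D (\<tau> A) = FObj G A"
    "f \<in> Arr C \<Longrightarrow> FArr G f \<cdot>\<^bsub>D\<^esub> \<tau> (Dom C f) = \<tau> (Cod C f) \<cdot>\<^bsub>D\<^esub> FArr F f"
  using assms by (auto simp: nat_trans_def Hom_def)

lemma nat_transI:
  assumes "cat_functor C D F" "cat_functor C D G"
    "\<And>A. A \<in> Obj C \<Longrightarrow> \<tau> A \<in> Hom D (FObj F A) (FObj G A)"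
    "\<And>f. f \<in> Arr C \<Longrightarrow> FArr G f \<cdot>\<^bsub>D\<^esub> \<tau> (Dom C f) = \<tau> (Cod C f) \<cdot>\<^bsub>D\<^esub> FArr F f"
  shows "nat_trans C D F G \<tau>"
  using assms by (auto simp: nat_trans_def Hom_def)

lemma nat_iso_transports_iso:
  assumes "nat_iso C D F G \<tau>" "f \<in> Arr C" "is_iso D (FArr F f)"
  shows "is_iso D (FArr G f)"
proof -
  have nt: "nat_trans C D F G \<tau>" and iso: "\<And>A. A \<in> Obj C \<Longrightarrow> is_iso D (\<tau> A)"
    using assms(1) by (auto simp: nat_iso_def)
  interpret F: cat_functor C D F using nt by (simp add: nat_trans_def)
  interpret G: cat_functor C D G using nt by (simp add: nat_trans_def)
  have "is_iso D (\<tau> (Cod C f) \<cdot>\<^bsub>D\<^esub> FArr F f)"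
    by (rule F.target.iso_comp) (use assms iso nat_transD[OF nt] in simp_all)
  then have "is_iso D (FArr G f \<cdot>\<^bsub>D\<^esub> \<tau> (Dom C f))"
    using nat_transD(4)[OF nt assms(2)] by simp
  then show ?thesis
    by (rule F.target.iso_comp_cancel[OF iso, rotated]) (use nat_transD[OF nt] assms(2) in simp_all)
qed

text \<open>The inverse components are natural because naturality of \<open>\<tau>\<close> may be cancelled against them.\<close>

lemma nat_iso_inverse:
  assumes "nat_iso C D F G \<tau>"
  obtains \<sigma> where "nat_iso C D G F \<sigma>"
    "\<And>A. A \<in> Obj C \<Longrightarrow> \<sigma> A \<cdot>\<^bsub>D\<^esub> \<tau> A = Ident D (FObj F A)"
    "\<And>A. A \<in> Obj C \<Longrightarrow> \<tau> A \<cdot>\<^bsub>D\<^esub> \<sigma> A = Ident D (FObj G A)"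
proof -
  have nt: "nat_trans C D F G \<tau>" and iso: "\<And>A. A \<in> Obj C \<Longrightarrow> is_iso D (\<tau> A)"
    using assms(1) by (auto simp: nat_iso_def)
  interpret F: cat_functor C D F using nt by (simp add: nat_trans_def)
  interpret G: cat_functor C D G using nt by (simp add: nat_trans_def)
  note \<tau> = nat_transD[OF nt]
  define \<sigma> where "\<sigma> = (\<lambda>A. F.target.inverse_arr (\<tau> A))"
  have \<sigma>: "\<And>A. A \<in> Obj C \<Longrightarrow> \<sigma> A \<in> Arr D" "\<And>A. A \<in> Obj C \<Longrightarrow> Dom D (\<sigma> A) = FObj G A"
     "\<And>A. A \<in> Obj C \<Longrightarrow> Cod D (\<sigma> A) = FObj F A"
    "\<And>A. A \<in> Obj C \<Longrightarrow> \<sigma> A \<cdot>\<^bsub>D\<^esub> \<tau> A = Ident D (FObj F A)"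
    "\<And>A. A \<in> Obj C \<Longrightarrow> \<tau> A \<cdot>\<^bsub>D\<^esub> \<sigma> A = Ident D (FObj G A)"
    by (simp_all add: \<sigma>_def F.target.inverse_arr iso \<tau>(1-3))
  have "nat_trans C D G F \<sigma>"
  proof (rule nat_transI)
    fix f assume f: "f \<in> Arr C"
    show "FArr F f \<cdot>\<^bsub>D\<^esub> \<sigma> (Dom C f) = \<sigma> (Cod C f) \<cdot>\<^bsub>D\<^esub> FArr G f"
    proof (rule F.target.iso_cancel_right[OF iso[of "Dom C f"]])
      have "(\<sigma> (Cod C f) \<cdot>\<^bsub>D\<^esub> FArr G f) \<cdot>\<^bsub>D\<^esub> \<tau> (Dom C f) = FArr F f"
        using f \<sigma> \<tau> \<sigma>(4)[THEN F.target.reassoc] by simp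
      then show "(FArr F f \<cdot>\<^bsub>D\<^esub> \<sigma> (Dom C f)) \<cdot>\<^bsub>D\<^esub> \<tau> (Dom C f) =
          (\<sigma> (Cod C f) \<cdot>\<^bsub>D\<^esub> FArr G f) \<cdot>\<^bsub>D\<^esub> \<tau> (Dom C f)"
        using f \<sigma> \<tau> by simp
    qed (use f \<sigma> \<tau> in simp_all)
  qed (use \<sigma> in \<open>auto simp: Hom_def intro: F.cat_functor_axioms G.cat_functor_axioms\<close>)
  moreover have "is_iso D (\<sigma> A)" if "A \<in> Obj C" for A
    by (rule F.target.is_isoI[where g = "\<tau> A"]) (use that \<sigma> \<tau> in simp_all)
  ultimately show thesis
    using that[of \<sigma>] \<sigma> by (simp add: nat_iso_def)
qed

section \<open>Equivalences of categories\<close>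

lemma equivalence_faithful:
  assumes "equivalence C D F" "h \<in> Hom C A B" "k \<in> Hom C A B" "FArr F h = FArr F k"
  shows "h = k"
proof -
  obtain G \<alpha> where a: "nat_iso C C id_funct (G \<circ>\<^sub>F F) \<alpha>"
    using assms(1) by (auto simp: equivalence_def)
  interpret F: cat_functor C D F using assms(1) by (simp add: equivalence_def)
  have nt: "nat_trans C C id_funct (G \<circ>\<^sub>F F) \<alpha>" using a by (simp add: nat_iso_def)
  have "\<alpha> B \<cdot>\<^bsub>C\<^esub> h = \<alpha> B \<cdot>\<^bsub>C\<^esub> k"
    using nat_transD(4)[OF nt, of h] nat_transD(4)[OF nt, of k] assms(2-4) by (auto simp: Hom_def)
  moreover have "B \<in> Obj C" using assms(2) by (auto simp: Hom_def)
  ultimately show ?thesis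
    using F.source.iso_cancel_left[of "\<alpha> B" h k] a assms(2,3) nat_transD[OF nt]
    by (auto simp: Hom_def nat_iso_def)
qed

text \<open>Conjugating by \<open>\<beta>\<close> recovers an arrow from its image under \<open>G\<close>.\<close>

lemma equivalence_inverse_faithful:
  assumes "cat_functor D C G" "nat_iso D D (F \<circ>\<^sub>F G) id_funct \<beta>"
    "h \<in> Hom D A B" "k \<in> Hom D A B" "FArr G h = FArr G k"
  shows "h = k"
proof -
  interpret G: cat_functor D C G by fact
  have nt: "nat_trans D D (F \<circ>\<^sub>F G) id_funct \<beta>" using assms by (simp add: nat_iso_def)
  have "h \<cdot>\<^bsub>D\<^esub> \<beta> A = k \<cdot>\<^bsub>D\<^esub> \<beta> A"
    using nat_transD(4)[OF nt, of h] nat_transD(4)[OF nt, of k] assms(3-5) by (auto simp: Hom_def)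
  moreover have "A \<in> Obj D" using assms(3) by (auto simp: Hom_def)
  ultimately show ?thesis
    using G.source.iso_cancel_right[of "\<beta> A" h k] assms(2-4) nat_transD[OF nt]
    by (auto simp: Hom_def nat_iso_def)
qed

text \<open>The candidate preimage is \<open>G g\<close> conjugated by the unit. Its image under \<open>F\<close> agrees with \<open>g\<close> after
applying \<open>G\<close>, which is faithful.\<close>

lemma equivalence_full:
  assumes "equivalence C D F" "A \<in> Obj C" "B \<in> Obj C" "g \<in> Hom D (FObj F A) (FObj F B)"
  obtains h where "h \<in> Hom C A B" "FArr F h = g"
proof -
  obtain G \<alpha> \<beta> where G: "cat_functor D C G" and a: "nat_iso C C id_funct (G \<circ>\<^sub>F F) \<alpha>"
    and b: "nat_iso D D (F \<circ>\<^sub>F G) id_funct \<beta>"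
    using assms(1) by (auto simp: equivalence_def)
  interpret F: cat_functor C D F using assms(1) by (simp add: equivalence_def)
  interpret G: cat_functor D C G by fact
  have nt: "nat_trans C C id_funct (G \<circ>\<^sub>F F) \<alpha>" using a by (simp add: nat_iso_def)
  note \<alpha> = nat_transD[OF nt]
  define i where "i = F.source.inverse_arr (\<alpha> B)"
  have i: "i \<in> Arr C" "Dom C i = FObj G (FObj F B)" "Cod C i = B"
    "\<alpha> B \<cdot>\<^bsub>C\<^esub> i = Ident C (FObj G (FObj F B))"
    using F.source.inverse_arr[of "\<alpha> B"] a assms(3) \<alpha>(1-3) by (simp_all add: nat_iso_def i_def)
  have g: "g \<in> Arr D" "Dom D g = FObj F A" "Cod D g = FObj F B" using assms(4) by (auto simp: Hom_def)
  define h where "h = i \<cdot>\<^bsub>C\<^esub> (FArr G g \<cdot>\<^bsub>C\<^esub> \<alpha> A)"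
  have h: "h \<in> Hom C A B" using i g \<alpha> assms(2,3) by (simp add: h_def Hom_def)
  then have h': "h \<in> Arr C" "Dom C h = A" "Cod C h = B" by (auto simp: Hom_def)
  have "\<alpha> B \<cdot>\<^bsub>C\<^esub> h = FArr G g \<cdot>\<^bsub>C\<^esub> \<alpha> A"
    unfolding h_def using i(4)[THEN F.source.reassoc] i g \<alpha> assms(2,3) by simp
  then have "FArr G (FArr F h) \<cdot>\<^bsub>C\<^esub> \<alpha> A = FArr G g \<cdot>\<^bsub>C\<^esub> \<alpha> A"
    using \<alpha>(4)[of h] h' by simp
  then have "FArr G (FArr F h) = FArr G g"
    using F.source.iso_cancel_right[of "\<alpha> A" "FArr G (FArr F h)" "FArr G g"] a assms(2) \<alpha> g h'
    by (simp add: nat_iso_def)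
  then have "FArr F h = g"
    using equivalence_inverse_faithful[OF G b, of "FArr F h" "FObj F A" "FObj F B" g] g h' assms(4)
    by (simp add: Hom_def)
  with h show thesis by (rule that)
qed

lemma equivalence_ess_surj:
  assumes "equivalence C D F" "Y \<in> Obj D"
  obtains A i where "A \<in> Obj C" "i \<in> Hom D (FObj F A) Y" "is_iso D i"
proof -
  obtain G \<beta> where G: "cat_functor D C G"
    and b: "nat_iso D D (F \<circ>\<^sub>F G) id_funct \<beta>"
    using assms(1) by (auto simp: equivalence_def)
  interpret G: cat_functor D C G by fact
  show thesis
    using that[of "FObj G Y" "\<beta> Y"] assms(2) b by (auto simp: nat_iso_def nat_trans_def)
qed

text \<open>A quasi-inverse is chosen by picking, for each object \<open>Y\<close>, some \<open>G0 Y\<close> with an isomorphism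
\<open>i Y : F (G0 Y) \<rightarrow> Y\<close>; its action on arrows, the unit and functoriality then all come from full
faithfulness.\<close>

lemma equivalenceI:
  assumes F: "cat_functor C D F"
    and faithful: "\<And>A B h k. h \<in> Hom C A B \<Longrightarrow> k \<in> Hom C A B \<Longrightarrow> FArr F h = FArr F k \<Longrightarrow> h = k"
    and full: "\<And>A B g. A \<in> Obj C \<Longrightarrow> B \<in> Obj C \<Longrightarrow> g \<in> Hom D (FObj F A) (FObj F B) \<Longrightarrow>
      \<exists>h\<in>Hom C A B. FArr F h = g"
    and surj: "\<And>Y. Y \<in> Obj D \<Longrightarrow> \<exists>A\<in>Obj C. \<exists>i\<in>Hom D (FObj F A) Y. is_iso D i"
  shows "equivalence C D F"
proof -
  interpret F: cat_functor C D F by fact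
  have "\<exists>G0. \<forall>Y\<in>Obj D. G0 Y \<in> Obj C \<and> (\<exists>i\<in>Hom D (FObj F (G0 Y)) Y. is_iso D i)"
    by (rule bchoice) (use surj in blast)
  then obtain G0 where G0': "\<forall>Y\<in>Obj D. G0 Y \<in> Obj C \<and> (\<exists>i\<in>Hom D (FObj F (G0 Y)) Y. is_iso D i)" ..
  then have "\<exists>i. \<forall>Y\<in>Obj D. i Y \<in> Hom D (FObj F (G0 Y)) Y \<and> is_iso D (i Y)"
    by (intro bchoice) blast
  then obtain i where i': "\<forall>Y\<in>Obj D. i Y \<in> Hom D (FObj F (G0 Y)) Y \<and> is_iso D (i Y)" ..
  define j where "j = (\<lambda>Y. F.target.inverse_arr (i Y))"
  have G0 [simp]: "\<And>Y. Y \<in> Obj D \<Longrightarrow> G0 Y \<in> Obj C"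
    and i [simp]: "\<And>Y. Y \<in> Obj D \<Longrightarrow> i Y \<in> Arr D" "\<And>Y. Y \<in> Obj D \<Longrightarrow> Dom D (i Y) = FObj F (G0 Y)"
      "\<And>Y. Y \<in> Obj D \<Longrightarrow> Cod D (i Y) = Y"
    and j [simp]: "\<And>Y. Y \<in> Obj D \<Longrightarrow> j Y \<in> Arr D" "\<And>Y. Y \<in> Obj D \<Longrightarrow> Cod D (j Y) = FObj F (G0 Y)"
      "\<And>Y. Y \<in> Obj D \<Longrightarrow> Dom D (j Y) = Y"
    and ij [simp]: "\<And>Y. Y \<in> Obj D \<Longrightarrow> i Y \<cdot>\<^bsub>D\<^esub> j Y = Ident D Y"
    and ji [simp]: "\<And>Y. Y \<in> Obj D \<Longrightarrow> j Y \<cdot>\<^bsub>D\<^esub> i Y = Ident D (FObj F (G0 Y))"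
    using G0' i' F.target.inverse_arr[of "i _"] by (auto simp: Hom_def j_def)
  note ij' [simp] = ij[THEN F.target.reassoc] and ji' [simp] = ji[THEN F.target.reassoc]
  have "\<exists>G1. \<forall>h\<in>Arr D. G1 h \<in> Hom C (G0 (Dom D h)) (G0 (Cod D h)) \<and>
      FArr F (G1 h) = j (Cod D h) \<cdot>\<^bsub>D\<^esub> (h \<cdot>\<^bsub>D\<^esub> i (Dom D h))"
  proof (rule bchoice, rule ballI)
    fix h assume h: "h \<in> Arr D"
    then have "\<exists>k\<in>Hom C (G0 (Dom D h)) (G0 (Cod D h)).
        FArr F k = j (Cod D h) \<cdot>\<^bsub>D\<^esub> (h \<cdot>\<^bsub>D\<^esub> i (Dom D h))"
      by (intro full) (auto simp: Hom_def)
    then show "\<exists>y. y \<in> Hom C (G0 (Dom D h)) (G0 (Cod D h)) \<and>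
        FArr F y = j (Cod D h) \<cdot>\<^bsub>D\<^esub> (h \<cdot>\<^bsub>D\<^esub> i (Dom D h))" by blast
  qed
  then obtain G1 where "\<forall>h\<in>Arr D. G1 h \<in> Hom C (G0 (Dom D h)) (G0 (Cod D h)) \<and>
      FArr F (G1 h) = j (Cod D h) \<cdot>\<^bsub>D\<^esub> (h \<cdot>\<^bsub>D\<^esub> i (Dom D h))" ..
  then have G1 [simp]: "\<And>h. h \<in> Arr D \<Longrightarrow> G1 h \<in> Arr C"
    "\<And>h. h \<in> Arr D \<Longrightarrow> Dom C (G1 h) = G0 (Dom D h)"
    "\<And>h. h \<in> Arr D \<Longrightarrow> Cod C (G1 h) = G0 (Cod D h)"
    "\<And>h. h \<in> Arr D \<Longrightarrow> FArr F (G1 h) = j (Cod D h) \<cdot>\<^bsub>D\<^esub> (h \<cdot>\<^bsub>D\<^esub> i (Dom D h))"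
    by (auto simp: Hom_def)
  define G where "G = \<lparr>FObj = G0, FArr = G1\<rparr>"
  have G: "cat_functor D C G"
  proof unfold_locales
    fix A assume A: "A \<in> Obj D"
    show "FArr G (Ident D A) = Ident C (FObj G A)"
      by (rule faithful[of _ "G0 A" "G0 A"]) (use A in \<open>auto simp: G_def Hom_def\<close>)
  next
    fix f A B g B'
    assume fg: "f \<in> Hom D A B" "g \<in> Hom D B B'"
    show "FArr G (g \<cdot>\<^bsub>D\<^esub> f) = FArr G g \<cdot>\<^bsub>C\<^esub> FArr G f"
      by (rule faithful[of _ "G0 A" "G0 B'"]) (use fg in \<open>auto simp: G_def Hom_def F.F_comp\<close>)
  qed (auto simp: G_def Hom_def)
  have "\<exists>\<alpha>. \<forall>A\<in>Obj C. \<alpha> A \<in> Hom C A (G0 (FObj F A)) \<and> FArr F (\<alpha> A) = j (FObj F A)"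
  proof (rule bchoice, rule ballI)
    fix A assume A: "A \<in> Obj C"
    then have "\<exists>k\<in>Hom C A (G0 (FObj F A)). FArr F k = j (FObj F A)"
      by (intro full) (auto simp: Hom_def)
    then show "\<exists>k. k \<in> Hom C A (G0 (FObj F A)) \<and> FArr F k = j (FObj F A)" by blast
  qed
  then obtain \<alpha> where "\<forall>A\<in>Obj C. \<alpha> A \<in> Hom C A (G0 (FObj F A)) \<and> FArr F (\<alpha> A) = j (FObj F A)" ..
  then have \<alpha> [simp]: "\<And>A. A \<in> Obj C \<Longrightarrow> \<alpha> A \<in> Arr C" "\<And>A. A \<in> Obj C \<Longrightarrow> Dom C (\<alpha> A) = A"
    "\<And>A. A \<in> Obj C \<Longrightarrow> Cod C (\<alpha> A) = G0 (FObj F A)" "\<And>A. A \<in> Obj C \<Longrightarrow> FArr F (\<alpha> A) = j (FObj F A)"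
    by (auto simp: Hom_def)
  have "nat_iso C C id_funct (G \<circ>\<^sub>F F) \<alpha>"
    unfolding nat_iso_def
  proof (intro conjI ballI nat_transI)
    fix f assume f: "f \<in> Arr C"
    show "FArr (G \<circ>\<^sub>F F) f \<cdot>\<^bsub>C\<^esub> \<alpha> (Dom C f) = \<alpha> (Cod C f) \<cdot>\<^bsub>C\<^esub> FArr id_funct f"
      by (rule faithful[of _ "Dom C f" "G0 (FObj F (Cod C f))"])
        (use f in \<open>auto simp: Hom_def F.F_comp G_def\<close>)
  next
    fix A assume A: "A \<in> Obj C"
    then obtain k where k: "k \<in> Hom C (G0 (FObj F A)) A" "FArr F k = i (FObj F A)"
      using full[of "G0 (FObj F A)" A "i (FObj F A)"] by (auto simp: Hom_def)
    have "k \<cdot>\<^bsub>C\<^esub> \<alpha> A = Ident C A"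
      by (rule faithful[of _ A A]) (use k A in \<open>auto simp: Hom_def F.F_comp\<close>)
    moreover have "\<alpha> A \<cdot>\<^bsub>C\<^esub> k = Ident C (G0 (FObj F A))"
      by (rule faithful[of _ "G0 (FObj F A)" "G0 (FObj F A)"])
        (use k A in \<open>auto simp: Hom_def F.F_comp\<close>)
    ultimately show "is_iso C (\<alpha> A)"
      by (intro F.source.is_isoI[of _ k]) (use k A in \<open>auto simp: Hom_def\<close>)
  qed (use F G cat_functor_comp cat_functor_id[OF F.source.category_axioms] in \<open>auto simp: Hom_def G_def\<close>)
  moreover have "nat_iso D D (F \<circ>\<^sub>F G) id_funct i"
    unfolding nat_iso_def
    by (intro conjI ballI nat_transI)
      (use F G cat_functor_comp[OF G F] cat_functor_id[OF F.target.category_axioms]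
        i' in \<open>auto simp: Hom_def G_def\<close>)
  ultimately show ?thesis
    unfolding equivalence_def using F G by blast
qed

section \<open>Coequalizers and split forks\<close>

definition is_coequalizer :: "('o, 'a) cat \<Rightarrow> 'a \<Rightarrow> 'a \<Rightarrow> 'a \<Rightarrow> bool" where
  "is_coequalizer C u v q \<longleftrightarrow>
     u \<in> Arr C \<and> v \<in> Arr C \<and> Dom C u = Dom C v \<and> Cod C u = Cod C v \<and>
     q \<in> Arr C \<and> Dom C q = Cod C u \<and> q \<cdot>\<^bsub>C\<^esub> u = q \<cdot>\<^bsub>C\<^esub> v \<and>
     (\<forall>w \<in> Arr C. Dom C w = Cod C u \<and> w \<cdot>\<^bsub>C\<^esub> u = w \<cdot>\<^bsub>C\<^esub> v \<longrightarrow>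
        (\<exists>!k. k \<in> Hom C (Cod C q) (Cod C w) \<and> k \<cdot>\<^bsub>C\<^esub> q = w))"

text \<open>The splitting is part of the data: the notion is then purely equational, and every functor
preserves it.\<close>

definition split_fork :: "('o, 'a) cat \<Rightarrow> 'a \<Rightarrow> 'a \<Rightarrow> 'a \<Rightarrow> 'a \<Rightarrow> 'a \<Rightarrow> bool" where
  "split_fork C u v q s t \<longleftrightarrow>
     u \<in> Arr C \<and> v \<in> Arr C \<and> Dom C u = Dom C v \<and> Cod C u = Cod C v \<and>
     q \<in> Arr C \<and> Dom C q = Cod C u \<and> s \<in> Hom C (Cod C q) (Dom C q) \<and> t \<in> Hom C (Cod C u) (Dom C u) \<and>
     q \<cdot>\<^bsub>C\<^esub> u = q \<cdot>\<^bsub>C\<^esub> v \<and> q \<cdot>\<^bsub>C\<^esub> s = Ident C (Cod C q) \<and>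
     u \<cdot>\<^bsub>C\<^esub> t = Ident C (Cod C u) \<and> v \<cdot>\<^bsub>C\<^esub> t = s \<cdot>\<^bsub>C\<^esub> q"

lemma split_forkD:
  assumes "split_fork C u v q s t"
  shows "u \<in> Arr C" "v \<in> Arr C" "Dom C v = Dom C u" "Cod C v = Cod C u"
    "q \<in> Arr C" "Dom C q = Cod C u" "s \<in> Arr C" "Dom C s = Cod C q" "Cod C s = Cod C u"
    "t \<in> Arr C" "Dom C t = Cod C u" "Cod C t = Dom C u"
    "q \<cdot>\<^bsub>C\<^esub> u = q \<cdot>\<^bsub>C\<^esub> v" "q \<cdot>\<^bsub>C\<^esub> s = Ident C (Cod C q)"
    "u \<cdot>\<^bsub>C\<^esub> t = Ident C (Cod C u)" "v \<cdot>\<^bsub>C\<^esub> t = s \<cdot>\<^bsub>C\<^esub> q"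
  using assms by (auto simp: split_fork_def Hom_def)

lemma is_coequalizerD:
  assumes "is_coequalizer C u v q"
  shows "u \<in> Arr C" "v \<in> Arr C" "Dom C v = Dom C u" "Cod C v = Cod C u"
    "q \<in> Arr C" "Dom C q = Cod C u" "q \<cdot>\<^bsub>C\<^esub> u = q \<cdot>\<^bsub>C\<^esub> v"
  using assms by (auto simp: is_coequalizer_def)

lemma coequalizer_factor:
  assumes "is_coequalizer C u v q" "w \<in> Arr C" "Dom C w = Cod C u" "w \<cdot>\<^bsub>C\<^esub> u = w \<cdot>\<^bsub>C\<^esub> v"
  obtains k where "k \<in> Arr C" "Dom C k = Cod C q" "Cod C k = Cod C w" "k \<cdot>\<^bsub>C\<^esub> q = w"
proof -
  have "\<forall>w \<in> Arr C. Dom C w = Cod C u \<and> w \<cdot>\<^bsub>C\<^esub> u = w \<cdot>\<^bsub>C\<^esub> v \<longrightarrow>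
      (\<exists>!k. k \<in> Hom C (Cod C q) (Cod C w) \<and> k \<cdot>\<^bsub>C\<^esub> q = w)"
    using assms(1) unfolding is_coequalizer_def by (elim conjE)
  then have "\<exists>!k. k \<in> Hom C (Cod C q) (Cod C w) \<and> k \<cdot>\<^bsub>C\<^esub> q = w"
    using assms(2-4) by simp
  then show thesis using that by (auto simp: Hom_def)
qed

context category
begin

lemma coequalizer_epi:
  assumes "is_coequalizer C u v q" "x \<in> Arr C" "y \<in> Arr C" "Dom C x = Cod C q" "Dom C y = Cod C q"
    "x \<cdot> q = y \<cdot> q"
  shows "x = y"
proof -
  note q = is_coequalizerD[OF assms(1)]
  have eq: "Cod C x = Cod C y"
    using comp_arr(3)[of q x] comp_arr(3)[of q y] assms q by metis
  have yq: "y \<cdot> q \<in> Arr C" "Dom C (y \<cdot> q) = Cod C u" "(y \<cdot> q) \<cdot> u = (y \<cdot> q) \<cdot> v"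
    and cod: "Cod C (y \<cdot> q) = Cod C y"
    using q assms(2-5) by simp_all
  have all: "\<forall>w \<in> Arr C. Dom C w = Cod C u \<and> w \<cdot> u = w \<cdot> v \<longrightarrow>
      (\<exists>!k. k \<in> Hom C (Cod C q) (Cod C w) \<and> k \<cdot> q = w)"
    using assms(1) unfolding is_coequalizer_def by (elim conjE)
  have "\<exists>!k. k \<in> Hom C (Cod C q) (Cod C y) \<and> k \<cdot> q = y \<cdot> q"
    by (rule mp[OF bspec[OF all yq(1), unfolded cod]]) (use yq in blast)
  moreover have "x \<in> Hom C (Cod C q) (Cod C y) \<and> x \<cdot> q = y \<cdot> q"
    "y \<in> Hom C (Cod C q) (Cod C y) \<and> y \<cdot> q = y \<cdot> q"
    using assms(2-6) eq by (simp_all add: Hom_def)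
  ultimately show ?thesis by metis
qed

lemma coequalizerI:
  assumes "u \<in> Arr C" "v \<in> Arr C" "Dom C v = Dom C u" "Cod C v = Cod C u"
    "q \<in> Arr C" "Dom C q = Cod C u" "q \<cdot> u = q \<cdot> v"
    and factor: "\<And>w. w \<in> Arr C \<Longrightarrow> Dom C w = Cod C u \<Longrightarrow> w \<cdot> u = w \<cdot> v \<Longrightarrow>
      \<exists>k. k \<in> Arr C \<and> Dom C k = Cod C q \<and> Cod C k = Cod C w \<and> k \<cdot> q = w"
    and epi: "\<And>x y. x \<in> Arr C \<Longrightarrow> y \<in> Arr C \<Longrightarrow> Dom C x = Cod C q \<Longrightarrow> Dom C y = Cod C q \<Longrightarrow>
      Cod C x = Cod C y \<Longrightarrow> x \<cdot> q = y \<cdot> q \<Longrightarrow> x = y"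
  shows "is_coequalizer C u v q"
  unfolding is_coequalizer_def
proof (intro conjI ballI impI)
  fix w assume w: "w \<in> Arr C" "Dom C w = Cod C u \<and> w \<cdot> u = w \<cdot> v"
  then obtain k where "k \<in> Arr C" "Dom C k = Cod C q" "Cod C k = Cod C w" "k \<cdot> q = w"
    using factor by blast
  then show "\<exists>!k. k \<in> Hom C (Cod C q) (Cod C w) \<and> k \<cdot> q = w"
    by (intro ex1I[of _ k]) (auto simp: Hom_def intro: epi)
qed (use assms in simp_all)

text \<open>An arrow \<open>w\<close> equalizing \<open>u\<close> and \<open>v\<close> factors as \<open>w = w \<cdot> u \<cdot> t = w \<cdot> v \<cdot> t = (w \<cdot> s) \<cdot> q\<close>.\<close>

lemma split_fork_coequalizer:
  assumes "split_fork C u v q s t"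
  shows "is_coequalizer C u v q"
proof -
  note q = split_forkD[OF assms]
  show ?thesis
  proof (rule coequalizerI)
    fix w assume w: "w \<in> Arr C" "Dom C w = Cod C u" "w \<cdot> u = w \<cdot> v"
    have "w = w \<cdot> (u \<cdot> t)" using w q by simp
    also have "\<dots> = (w \<cdot> s) \<cdot> q" using w(3)[THEN reassoc, of t] w q by simp
    finally show "\<exists>k. k \<in> Arr C \<and> Dom C k = Cod C q \<and> Cod C k = Cod C w \<and> k \<cdot> q = w"
      using w q by (intro exI[of _ "w \<cdot> s"]) simp
  qed (use q split_epi_cancel[of q s] in auto)
qed

lemma coequalizer_comparison_iso:
  assumes q: "is_coequalizer C u v q" and q': "is_coequalizer C u v q'"
    and k: "k \<in> Arr C" "Dom C k = Cod C q" "k \<cdot> q = q'"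
  shows "is_iso C k"
proof -
  note qD = is_coequalizerD[OF q] and qD' = is_coequalizerD[OF q']
  have ck: "Cod C k = Cod C q'" using k qD by auto
  obtain l where l: "l \<in> Arr C" "Dom C l = Cod C q'" "Cod C l = Cod C q" "l \<cdot> q' = q"
    using coequalizer_factor[OF q', of q] qD by metis
  have "l \<cdot> k = Ident C (Dom C k)"
    by (rule coequalizer_epi[OF q]) (use l k ck qD in simp_all)
  moreover have "k \<cdot> l = Ident C (Cod C k)"
    by (rule coequalizer_epi[OF q']) (use l k ck qD qD' in simp_all)
  ultimately show ?thesis using is_isoI[of k l] l k ck by simp
qed

lemma coequalizer_comp_iso:
  assumes q: "is_coequalizer C u v q" and k: "is_iso C k" "Dom C k = Cod C q"
  shows "is_coequalizer C u v (k \<cdot> q)"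
proof -
  note qD = is_coequalizerD[OF q]
  define l where "l = inverse_arr k"
  have l: "l \<in> Arr C" "Dom C l = Cod C k" "Cod C l = Cod C q" "l \<cdot> k = Ident C (Cod C q)"
    "k \<cdot> l = Ident C (Cod C k)" and ka: "k \<in> Arr C"
    using inverse_arr[OF k(1)] iso_arr[OF k(1)] k by (simp_all add: l_def)
  show ?thesis
  proof (rule coequalizerI)
    fix w assume w: "w \<in> Arr C" "Dom C w = Cod C u" "w \<cdot> u = w \<cdot> v"
    then obtain h where h: "h \<in> Arr C" "Dom C h = Cod C q" "Cod C h = Cod C w" "h \<cdot> q = w"
      using coequalizer_factor[OF q] by blast
    then show "\<exists>h. h \<in> Arr C \<and> Dom C h = Cod C (k \<cdot> q) \<and> Cod C h = Cod C w \<and> h \<cdot> (k \<cdot> q) = w"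
      using l ka k qD l(4)[THEN reassoc, of q] by (intro exI[of _ "h \<cdot> l"]) simp
  next
    fix x y assume xy: "x \<in> Arr C" "y \<in> Arr C" "Dom C x = Cod C (k \<cdot> q)" "Dom C y = Cod C (k \<cdot> q)"
      "x \<cdot> (k \<cdot> q) = y \<cdot> (k \<cdot> q)"
    have "x \<cdot> k = y \<cdot> k"
      by (rule coequalizer_epi[OF q]) (use xy ka k qD in simp_all)
    then show "x = y"
      using iso_cancel_right[OF k(1), of x y] xy qD ka k by simp
  qed (use qD ka k in simp_all)
qed

text \<open>Splitness depends on the pair \<open>u, v\<close> only: a splitting transfers along the comparison of two
coequalizers, keeping \<open>t\<close>.\<close>

lemma coequalizer_of_split_fork:
  assumes "split_fork C u v q s t" "is_coequalizer C u v q'"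
  obtains s' where "split_fork C u v q' s' t"
proof -
  note q = split_forkD[OF assms(1)] and q' = is_coequalizerD[OF assms(2)]
  obtain k where k: "k \<in> Arr C" "Dom C k = Cod C q" "Cod C k = Cod C q'" "k \<cdot> q = q'"
    using coequalizer_factor[OF split_fork_coequalizer[OF assms(1)], of q'] q q' by metis
  obtain l where l: "l \<in> Arr C" "Dom C l = Cod C q'" "Cod C l = Cod C q" "l \<cdot> q' = q"
    using coequalizer_factor[OF assms(2), of q] q q' by metis
  have "q' \<cdot> (s \<cdot> q) = k \<cdot> (q \<cdot> (s \<cdot> q))"
    using k(4)[THEN reassoc, of "s \<cdot> q"] k q by simp
  also have "\<dots> = q'"
    using q(14)[THEN reassoc, of q] q k by simp
  finally have "(q' \<cdot> (s \<cdot> l)) \<cdot> q' = q'"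
    using l q q' by simp
  then have "q' \<cdot> (s \<cdot> l) = Ident C (Cod C q')"
    using coequalizer_epi[OF assms(2), of "q' \<cdot> (s \<cdot> l)" "Ident C (Cod C q')"] q q' l by simp
  then show thesis
    using that[of "s \<cdot> l"] q q' l by (simp add: split_fork_def Hom_def)
qed

end

lemma (in cat_functor) F_split_fork:
  assumes "split_fork C u v q s t"
  shows "split_fork D (FArr F u) (FArr F v) (FArr F q) (FArr F s) (FArr F t)"
  using split_forkD[OF assms] by (simp add: split_fork_def Hom_def flip: F_comp)

text \<open>The fork is conjugated by \<open>\<tau>\<close>. The equation relating \<open>q'\<close> to \<open>q\<close> serves to recognize images of known
arrows as coequalizers of the transported pair.\<close>

lemma nat_iso_split_fork:
  assumes "nat_iso C D F G \<tau>" "u \<in> Arr C" "v \<in> Arr C"  "Dom C u = Dom C v" "Cod C u = Cod C v"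
    and "split_fork D (FArr F u) (FArr F v) q s t"
  obtains q' s' t' where "split_fork D (FArr G u) (FArr G v) q' s' t'"
    "q' \<cdot>\<^bsub>D\<^esub> \<tau> (Cod C u) = q"
proof -
  obtain \<sigma> where \<sigma>: "nat_iso C D G F \<sigma>"
    "\<And>A. A \<in> Obj C \<Longrightarrow> \<sigma> A \<cdot>\<^bsub>D\<^esub> \<tau> A = Ident D (FObj F A)"
    "\<And>A. A \<in> Obj C \<Longrightarrow> \<tau> A \<cdot>\<^bsub>D\<^esub> \<sigma> A = Ident D (FObj G A)"
    using nat_iso_inverse[OF assms(1)] by blast
  have nt: "nat_trans C D F G \<tau>" and ns: "nat_trans C D G F \<sigma>"
    using assms(1) \<sigma> by (auto simp: nat_iso_def)
  interpret F: cat_functor C D F using nt by (simp add: nat_trans_def)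
  interpret G: cat_functor C D G using nt by (simp add: nat_trans_def)
  note q = split_forkD[OF assms(6)] and \<tau> = nat_transD[OF nt] and \<sigma>' = nat_transD[OF ns]
  define X Y where "X = Dom C u" and "Y = Cod C u"
  have XY: "X \<in> Obj C" "Y \<in> Obj C" "Dom C u = X" "Cod C u = Y" "Dom C v = X" "Cod C v = Y"
    using assms(2-5) by (auto simp: X_def Y_def)
  note uv = \<tau>(4)[OF assms(2)] \<tau>(4)[OF assms(3)] \<sigma>'(4)[OF assms(2)] \<sigma>'(4)[OF assms(3)]
  note uv = uv[unfolded XY]
  note a = q(1-12)[unfolded XY F.F_arr(2,3)[OF assms(2)]] assms(2,3) \<tau>(1-3) \<sigma>'(1-3) XY
  have "split_fork D (FArr G u) (FArr G v) (q \<cdot>\<^bsub>D\<^esub> \<sigma> Y) (\<tau> Y \<cdot>\<^bsub>D\<^esub> s) (\<tau> X \<cdot>\<^bsub>D\<^esub> (t \<cdot>\<^bsub>D\<^esub> \<sigma> Y))"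
    unfolding split_fork_def
  proof (intro conjI)
    show "(q \<cdot>\<^bsub>D\<^esub> \<sigma> Y) \<cdot>\<^bsub>D\<^esub> FArr G u = (q \<cdot>\<^bsub>D\<^esub> \<sigma> Y) \<cdot>\<^bsub>D\<^esub> FArr G v"
      using a uv(3,4)[symmetric] q(13)[THEN F.target.reassoc, of "\<sigma> X"] by simp
    show "(q \<cdot>\<^bsub>D\<^esub> \<sigma> Y) \<cdot>\<^bsub>D\<^esub> (\<tau> Y \<cdot>\<^bsub>D\<^esub> s) = Ident D (Cod D (q \<cdot>\<^bsub>D\<^esub> \<sigma> Y))"
      using a q(14) \<sigma>(2)[of Y, THEN F.target.reassoc, of s] by simp
    show "FArr G u \<cdot>\<^bsub>D\<^esub> (\<tau> X \<cdot>\<^bsub>D\<^esub> (t \<cdot>\<^bsub>D\<^esub> \<sigma> Y)) = Ident D (Cod D (FArr G u))"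
      using a uv(1)[THEN F.target.reassoc, of "t \<cdot>\<^bsub>D\<^esub> \<sigma> Y"] q(15)[THEN F.target.reassoc, of "\<sigma> Y"] \<sigma>(3)[of Y] by simp
    show "FArr G v \<cdot>\<^bsub>D\<^esub> (\<tau> X \<cdot>\<^bsub>D\<^esub> (t \<cdot>\<^bsub>D\<^esub> \<sigma> Y)) = (\<tau> Y \<cdot>\<^bsub>D\<^esub> s) \<cdot>\<^bsub>D\<^esub> (q \<cdot>\<^bsub>D\<^esub> \<sigma> Y)"
      using a uv(2)[THEN F.target.reassoc, of "t \<cdot>\<^bsub>D\<^esub> \<sigma> Y"] q(16)[THEN F.target.reassoc, of "\<sigma> Y"] by simp
  qed (use a in \<open>auto simp: Hom_def\<close>)
  moreover have "(q \<cdot>\<^bsub>D\<^esub> \<sigma> Y) \<cdot>\<^bsub>D\<^esub> \<tau> Y = q"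
    using a \<sigma>(2)[of Y] by simp
  ultimately show thesis using that XY by blast
qed

section \<open>Beck's monadicity theorem\<close>

locale adjoint_functors =
  fixes C :: "('o, 'a) cat" and D :: "('p, 'b) cat"
    and L :: "('o, 'a, 'p, 'b) funct" and U :: "('p, 'b, 'o, 'a) funct"
    and \<eta> :: "'o \<Rightarrow> 'a" and \<epsilon> :: "'p \<Rightarrow> 'b"
  assumes adjunction: "adjunction C D L U \<eta> \<epsilon>"
begin

sublocale L: cat_functor C D L
  using adjunction by (simp add: adjunction_def)

sublocale U: cat_functor D C U
  using adjunction by (simp add: adjunction_def)

lemma unit [simp]:
  assumes "A \<in> Obj C"
  shows "\<eta> A \<in> Arr C" "Dom C (\<eta> A) = A" "Cod C (\<eta> A) = FObj U (FObj L A)"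
proof -
  have "nat_trans C C id_funct (U \<circ>\<^sub>F L) \<eta>" using adjunction by (simp add: adjunction_def)
  from nat_transD(1-3)[OF this assms]
  show "\<eta> A \<in> Arr C" "Dom C (\<eta> A) = A" "Cod C (\<eta> A) = FObj U (FObj L A)" by simp_all
qed

lemma counit [simp]:
  assumes "Y \<in> Obj D"
  shows "\<epsilon> Y \<in> Arr D" "Dom D (\<epsilon> Y) = FObj L (FObj U Y)" "Cod D (\<epsilon> Y) = Y"
proof -
  have "nat_trans D D (L \<circ>\<^sub>F U) id_funct \<epsilon>" using adjunction by (simp add: adjunction_def)
  from nat_transD(1-3)[OF this assms]
  show "\<epsilon> Y \<in> Arr D" "Dom D (\<epsilon> Y) = FObj L (FObj U Y)" "Cod D (\<epsilon> Y) = Y" by simp_all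
qed

lemma unit_natural: "f \<in> Arr C \<Longrightarrow> FArr U (FArr L f) \<cdot>\<^bsub>C\<^esub> \<eta> (Dom C f) = \<eta> (Cod C f) \<cdot>\<^bsub>C\<^esub> f"
  using nat_transD(4)[of C C id_funct "U \<circ>\<^sub>F L" \<eta> f] adjunction by (simp add: adjunction_def)

lemma counit_natural: "f \<in> Arr D \<Longrightarrow> f \<cdot>\<^bsub>D\<^esub> \<epsilon> (Dom D f) = \<epsilon> (Cod D f) \<cdot>\<^bsub>D\<^esub> FArr L (FArr U f)"
  using nat_transD(4)[of D D "L \<circ>\<^sub>F U" id_funct \<epsilon> f] adjunction by (simp add: adjunction_def)

lemma triangle_left [simp]: "A \<in> Obj C \<Longrightarrow> \<epsilon> (FObj L A) \<cdot>\<^bsub>D\<^esub> FArr L (\<eta> A) = Ident D (FObj L A)"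
  using adjunction by (simp add: adjunction_def)

lemma triangle_right [simp]: "Y \<in> Obj D \<Longrightarrow> FArr U (\<epsilon> Y) \<cdot>\<^bsub>C\<^esub> \<eta> (FObj U Y) = Ident C (FObj U Y)"
  using adjunction by (simp add: adjunction_def)

abbreviation "EM \<equiv> em_cat C (U \<circ>\<^sub>F L) \<eta> (\<lambda>A. FArr U (\<epsilon> (FObj L A)))"
abbreviation "K \<equiv> em_comparison D U \<epsilon>"

lemma EM_Obj: "x \<in> Obj EM \<longleftrightarrow> fst x \<in> Obj C \<and> snd x \<in> Arr C \<and>
    Dom C (snd x) = FObj U (FObj L (fst x)) \<and> Cod C (snd x) = fst x \<and>
    snd x \<cdot>\<^bsub>C\<^esub> \<eta> (fst x) = Ident C (fst x) \<and>
    snd x \<cdot>\<^bsub>C\<^esub> FArr U (FArr L (snd x)) = snd x \<cdot>\<^bsub>C\<^esub> FArr U (\<epsilon> (FObj L (fst x)))"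
  by (auto simp: em_cat_def em_algebras_def Hom_def)

lemma EM_Arr: "(x, h, y) \<in> Arr EM \<longleftrightarrow> x \<in> Obj EM \<and> y \<in> Obj EM \<and> h \<in> Arr C \<and>
    Dom C h = fst x \<and> Cod C h = fst y \<and> h \<cdot>\<^bsub>C\<^esub> snd x = snd y \<cdot>\<^bsub>C\<^esub> FArr U (FArr L h)"
  by (auto simp: em_cat_def Hom_def)

lemma EM_simps [simp]:
  "Dom EM (x, h, y) = x" "Cod EM (x, h, y) = y" "Ident EM x = (x, Ident C (fst x), x)"
  "(y', k, z) \<cdot>\<^bsub>EM\<^esub> (x, h, y) = (x, k \<cdot>\<^bsub>C\<^esub> h, z)"
  by (auto simp: em_cat_def)

lemma EM_Hom: "m \<in> Hom EM x y \<longleftrightarrow> (\<exists>h. m = (x, h, y) \<and> (x, h, y) \<in> Arr EM)"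
  by (cases m) (auto simp: Hom_def)

lemma EM_category: "category EM"
proof unfold_locales
  fix f x y z g assume "f \<in> Hom EM x y" "g \<in> Hom EM y z"
  then obtain h k where hk: "f = (x, h, y)" "g = (y, k, z)" "(x, h, y) \<in> Arr EM" "(y, k, z) \<in> Arr EM"
    by (auto simp: EM_Hom)
  then have o: "h \<in> Arr C" "Dom C h = fst x" "Cod C h = fst y" "k \<in> Arr C" "Dom C k = fst y" "Cod C k = fst z"
    "h \<cdot>\<^bsub>C\<^esub> snd x = snd y \<cdot>\<^bsub>C\<^esub> FArr U (FArr L h)" "k \<cdot>\<^bsub>C\<^esub> snd y = snd z \<cdot>\<^bsub>C\<^esub> FArr U (FArr L k)"
    "x \<in> Obj EM" "y \<in> Obj EM" "z \<in> Obj EM"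
    by (simp_all add: EM_Arr)
  have "k \<cdot>\<^bsub>C\<^esub> (h \<cdot>\<^bsub>C\<^esub> snd x) = snd z \<cdot>\<^bsub>C\<^esub> (FArr U (FArr L k) \<cdot>\<^bsub>C\<^esub> FArr U (FArr L h))"
    using o o(8)[THEN L.source.reassoc, of "FArr U (FArr L h)"] by (simp add: EM_Obj)
  then show "g \<cdot>\<^bsub>EM\<^esub> f \<in> Hom EM x z"
    using hk o by (simp add: EM_Hom) (simp add: EM_Arr EM_Obj L.F_comp U.F_comp)
next
  fix f x y
  assume "f \<in> Arr EM" then show "Dom EM f \<in> Obj EM" "Cod EM f \<in> Obj EM"
    by (cases f; auto simp: EM_Arr)+
next
  fix x assume "x \<in> Obj EM" then show "Ident EM x \<in> Hom EM x x"
    by (simp add: EM_Hom) (simp add: EM_Arr EM_Obj)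
next
  fix f x y assume "f \<in> Hom EM x y"
  then show "f \<cdot>\<^bsub>EM\<^esub> Ident EM x = f" "Ident EM y \<cdot>\<^bsub>EM\<^esub> f = f"
    by (auto simp: EM_Hom EM_Arr)
next
  fix f x y g z h w assume "f \<in> Hom EM x y" "g \<in> Hom EM y z" "h \<in> Hom EM z w"
  then show "(h \<cdot>\<^bsub>EM\<^esub> g) \<cdot>\<^bsub>EM\<^esub> f = h \<cdot>\<^bsub>EM\<^esub> (g \<cdot>\<^bsub>EM\<^esub> f)"
    by (auto simp: EM_Hom EM_Arr)
qed

sublocale EM: category EM
  by (rule EM_category)

text \<open>The inverse of an algebra homomorphism is again one, so isomorphisms of algebras are detected on
underlying arrows.\<close>

lemma EM_iso:
  assumes "(x, h, y) \<in> Arr EM"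
  shows "is_iso EM (x, h, y) \<longleftrightarrow> is_iso C h"
proof
  assume "is_iso EM (x, h, y)"
  then obtain g where g: "g \<in> Hom EM y x" "g \<cdot>\<^bsub>EM\<^esub> (x, h, y) = Ident EM x" "(x, h, y) \<cdot>\<^bsub>EM\<^esub> g = Ident EM y"
    by (auto simp: is_iso_def)
  then obtain k where "g = (y, k, x)" "(y, k, x) \<in> Arr EM" by (auto simp: EM_Hom)
  then show "is_iso C h"
    using g assms L.source.is_isoI[of h k] by (simp add: EM_Arr)
next
  assume h: "is_iso C h"
  define k where "k = L.source.inverse_arr h"
  note a = assms[unfolded EM_Arr]
  have k: "k \<in> Arr C" "Dom C k = fst y" "Cod C k = fst x" "k \<cdot>\<^bsub>C\<^esub> h = Ident C (fst x)" "h \<cdot>\<^bsub>C\<^esub> k = Ident C (fst y)"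
    using L.source.inverse_arr[OF h] a by (simp_all add: k_def)
  have "h \<cdot>\<^bsub>C\<^esub> (k \<cdot>\<^bsub>C\<^esub> snd y) = h \<cdot>\<^bsub>C\<^esub> (snd x \<cdot>\<^bsub>C\<^esub> FArr U (FArr L k))"
  proof -
    have "FArr U (FArr L h) \<cdot>\<^bsub>C\<^esub> FArr U (FArr L k) = Ident C (FObj U (FObj L (fst y)))"
      using a k by (simp add: EM_Obj flip: L.F_comp U.F_comp)
    moreover have "h \<cdot>\<^bsub>C\<^esub> (snd x \<cdot>\<^bsub>C\<^esub> FArr U (FArr L k)) = (snd y \<cdot>\<^bsub>C\<^esub> FArr U (FArr L h)) \<cdot>\<^bsub>C\<^esub> FArr U (FArr L k)"
      by (rule L.source.reassoc) (use a k in \<open>auto simp: EM_Obj\<close>)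
    moreover have "h \<cdot>\<^bsub>C\<^esub> (k \<cdot>\<^bsub>C\<^esub> snd y) = snd y"
      using k(5)[THEN L.source.reassoc, of "snd y"] a k by (simp add: EM_Obj)
    ultimately show ?thesis using a k by (simp add: EM_Obj)
  qed
  then have "k \<cdot>\<^bsub>C\<^esub> snd y = snd x \<cdot>\<^bsub>C\<^esub> FArr U (FArr L k)"
    by (rule L.source.iso_cancel_left[OF h, rotated -1]) (use a k in \<open>auto simp: EM_Obj\<close>)
  then have "(y, k, x) \<in> Arr EM" using a k by (simp add: EM_Arr)
  then show "is_iso EM (x, h, y)"
    using assms a k by (intro EM.is_isoI[of _ "(y, k, x)"]) simp_all
qed

lemma K_simps [simp]:
  "FObj K Y = (FObj U Y, FArr U (\<epsilon> Y))"
  "FArr K h = ((FObj U (Dom D h), FArr U (\<epsilon> (Dom D h))), FArr U h, (FObj U (Cod D h), FArr U (\<epsilon> (Cod D h))))"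
  by (simp_all add: em_comparison_def Let_def)

lemma K_functor: "cat_functor D EM K"
proof unfold_locales
  fix Y assume Y: "Y \<in> Obj D"
  show "FObj K Y \<in> Obj EM"
    using Y counit_natural[of "\<epsilon> Y"] by (simp add: EM_Obj flip: U.F_comp)
  show "FArr K (Ident D Y) = Ident EM (FObj K Y)"
    using Y by simp
next
  fix h A B assume h: "h \<in> Hom D A B"
  have o: "FObj K Y \<in> Obj EM" if "Y \<in> Obj D" for Y
    using that counit_natural[of "\<epsilon> Y"] by (simp add: EM_Obj flip: U.F_comp)
  have "h \<in> Arr D" "Dom D h = A" "Cod D h = B" using h by (auto simp: Hom_def)
  then show "FArr K h \<in> Hom EM (FObj K A) (FObj K B)"
    using o[of A] o[of B] counit_natural[of h] by (auto simp: EM_Hom EM_Arr simp flip: U.F_comp)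
next
  fix h A B k B' assume "h \<in> Hom D A B" "k \<in> Hom D B B'"
  then show "FArr K (k \<cdot>\<^bsub>D\<^esub> h) = FArr K k \<cdot>\<^bsub>EM\<^esub> FArr K h"
    by (auto simp: Hom_def U.F_comp)
qed

sublocale K: cat_functor D EM K
  by (rule K_functor)

text \<open>The canonical presentation of an algebra \<open>x = (A, a)\<close> by free algebras. The pair
\<open>\<epsilon> (L A), L a\<close> in \<open>D\<close> is therefore \<open>U\<close>-split, and the structure map \<open>a\<close> is a coequalizer of its
image in \<open>C\<close>.\<close>

lemma algebra_split_fork:
  assumes "x \<in> Obj EM"
  shows "split_fork C (FArr U (\<epsilon> (FObj L (fst x)))) (FArr U (FArr L (snd x))) (snd x)
    (\<eta> (fst x)) (\<eta> (FObj U (FObj L (fst x))))"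
  using assms unit_natural[of "snd x"] by (simp add: EM_Obj split_fork_def Hom_def)

end

text \<open>The hypotheses of Beck's theorem on a right adjoint \<open>U\<close>. Coequalizers being unique up to isomorphism, it suffices to
ask that some coequalizer of each \<open>U\<close>-split pair be preserved.\<close>

definition beck_condition ::
  "('p, 'b) cat \<Rightarrow> ('o, 'a) cat \<Rightarrow> ('p, 'b, 'o, 'a) funct \<Rightarrow> bool" where
  "beck_condition D C U \<longleftrightarrow>
     (\<forall>h \<in> Arr D. is_iso C (FArr U h) \<longrightarrow> is_iso D h) \<and>
     (\<forall>u v q s t. u \<in> Arr D \<and> v \<in> Arr D \<and> Dom D v = Dom D u \<and> Cod D v = Cod D u \<and>
        split_fork C (FArr U u) (FArr U v) q s t \<longrightarrow>
        (\<exists>e. is_coequalizer D u v e \<and> is_coequalizer C (FArr U u) (FArr U v) (FArr U e)))"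

context adjoint_functors
begin

text \<open>The codomain of the coequalizer found here is the object of \<open>D\<close> that will represent the algebra \<open>x\<close>.\<close>

lemma beck_algebra_coequalizer:
  assumes beck: "beck_condition D C U" and x: "x \<in> Obj EM"
  obtains e where "is_coequalizer D (\<epsilon> (FObj L (fst x))) (FArr L (snd x)) e"
    "is_coequalizer C (FArr U (\<epsilon> (FObj L (fst x)))) (FArr U (FArr L (snd x))) (FArr U e)"
proof -
  have "\<exists>e. is_coequalizer D (\<epsilon> (FObj L (fst x))) (FArr L (snd x)) e \<and>
    is_coequalizer C (FArr U (\<epsilon> (FObj L (fst x)))) (FArr U (FArr L (snd x))) (FArr U e)"
    using beck algebra_split_fork[OF x] x unfolding beck_condition_def
    by (elim conjE) (erule allE, erule allE, erule allE, erule allE, erule allE, erule mp, simp add: EM_Obj)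
  then show thesis using that by blast
qed

text \<open>The pair presenting the algebra of \<open>Y\<close> has a coequalizer \<open>e\<close> that \<open>U\<close> preserves, and \<open>\<epsilon> Y\<close> factors
through \<open>e\<close> by some \<open>k\<close>. Both \<open>U e\<close> and \<open>U (\<epsilon> Y)\<close> are coequalizers of the same pair, so \<open>U k\<close> and hence
\<open>k\<close> is an isomorphism. An arrow out of \<open>Y\<close> is thus the same as an arrow out of \<open>L (U Y)\<close> equalizing the
pair, which is what makes the comparison functor fully faithful.\<close>

lemma counit_coequalizer:
  assumes beck: "beck_condition D C U" and Y: "Y \<in> Obj D"
  shows "is_coequalizer D (\<epsilon> (FObj L (FObj U Y))) (FArr L (FArr U (\<epsilon> Y))) (\<epsilon> Y)"
proof -
  let ?u = "\<epsilon> (FObj L (FObj U Y))" and ?v = "FArr L (FArr U (\<epsilon> Y))"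
  have x: "FObj K Y \<in> Obj EM" using Y by (rule K.FObj_Obj)
  obtain e where e: "is_coequalizer D ?u ?v e" "is_coequalizer C (FArr U ?u) (FArr U ?v) (FArr U e)"
    using beck_algebra_coequalizer[OF beck x] by auto
  have "\<epsilon> Y \<cdot>\<^bsub>D\<^esub> ?u = \<epsilon> Y \<cdot>\<^bsub>D\<^esub> ?v" using counit_natural[of "\<epsilon> Y"] Y by simp
  then obtain k where k: "k \<in> Arr D" "Dom D k = Cod D e" "Cod D k = Y" "k \<cdot>\<^bsub>D\<^esub> e = \<epsilon> Y"
    using coequalizer_factor[OF e(1), of "\<epsilon> Y"] Y by auto
  have "FArr U k \<cdot>\<^bsub>C\<^esub> FArr U e = FArr U (\<epsilon> Y)"
    using k is_coequalizerD[OF e(1)] by (simp flip: U.F_comp)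
  then have "is_iso C (FArr U k)"
    using L.source.coequalizer_comparison_iso[OF e(2), of "FArr U (\<epsilon> Y)" "FArr U k"]
      L.source.split_fork_coequalizer[OF algebra_split_fork[OF x]] k is_coequalizerD[OF e(1)]
    by simp
  then have "is_iso D k" using beck k by (simp add: beck_condition_def)
  then show ?thesis
    using L.target.coequalizer_comp_iso[OF e(1), of k] k by simp
qed

text \<open>The comparison functor is fully faithful by \<open>counit_coequalizer\<close>. It is essentially surjective:
for an algebra \<open>x\<close>, the object representing it is the codomain of the coequalizer \<open>e\<close> from
\<open>beck_algebra_coequalizer\<close>, as \<open>U e\<close> and the structure map of \<open>x\<close> are coequalizers of the same pair.\<close>

theorem beck_sufficient:
  assumes beck: "beck_condition D C U"
  shows "monadic D C U"
proof -
  have "equivalence D EM K"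
  proof (rule equivalenceI[OF K_functor])
    fix A B h k assume h: "h \<in> Hom D A B" and k: "k \<in> Hom D A B" and eq: "FArr K h = FArr K k"
    have "h \<cdot>\<^bsub>D\<^esub> \<epsilon> A = k \<cdot>\<^bsub>D\<^esub> \<epsilon> A"
      using h k eq counit_natural[of h] counit_natural[of k] by (auto simp: Hom_def)
    moreover have "A \<in> Obj D" using h by (auto simp: Hom_def)
    ultimately show "h = k"
      using L.target.coequalizer_epi[OF counit_coequalizer[OF beck, of A], of h k] h k
      by (auto simp: Hom_def)
  next
    fix A B m assume A: "A \<in> Obj D" and B: "B \<in> Obj D" and m: "m \<in> Hom EM (FObj K A) (FObj K B)"
    then obtain g where g: "m = (FObj K A, g, FObj K B)" "g \<in> Arr C" "Dom C g = FObj U A" "Cod C g = FObj U B"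
      "g \<cdot>\<^bsub>C\<^esub> FArr U (\<epsilon> A) = FArr U (\<epsilon> B) \<cdot>\<^bsub>C\<^esub> FArr U (FArr L g)"
      by (auto simp: EM_Hom EM_Arr)
    \<comment> \<open>An algebra homomorphism \<open>g\<close> is lifted through its transpose \<open>w\<close>.\<close>
    define w where "w = \<epsilon> B \<cdot>\<^bsub>D\<^esub> FArr L g"
    have w: "w \<in> Arr D" "Dom D w = FObj L (FObj U A)" "Cod D w = B"
      using g A B by (simp_all add: w_def)
    have Uw: "FArr U w = g \<cdot>\<^bsub>C\<^esub> FArr U (\<epsilon> A)"
      using g A B by (simp add: w_def U.F_comp)
    have "w \<cdot>\<^bsub>D\<^esub> \<epsilon> (FObj L (FObj U A)) = \<epsilon> B \<cdot>\<^bsub>D\<^esub> FArr L (FArr U w)"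
      using counit_natural[of w] w by simp
    also have "\<dots> = w \<cdot>\<^bsub>D\<^esub> FArr L (FArr U (\<epsilon> A))"
      using g(2-4) A B by (simp add: Uw L.F_comp) (simp add: w_def)
    finally obtain h where h: "h \<in> Arr D" "Dom D h = A" "Cod D h = B" "h \<cdot>\<^bsub>D\<^esub> \<epsilon> A = w"
      using coequalizer_factor[OF counit_coequalizer[OF beck A], of w] w A by auto
    have "FArr U h \<cdot>\<^bsub>C\<^esub> FArr U (\<epsilon> A) = g \<cdot>\<^bsub>C\<^esub> FArr U (\<epsilon> A)"
      using h A Uw by (simp flip: U.F_comp)
    then have "FArr U h = g"
      using L.source.split_epi_cancel[of "FArr U (\<epsilon> A)" "\<eta> (FObj U A)" "FArr U h" g] g h A by simp
    then show "\<exists>h\<in>Hom D A B. FArr K h = m"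
      using h g by (auto simp: Hom_def)
  next
    fix x assume x: "x \<in> Obj EM"
    note x' = x[unfolded EM_Obj]
    let ?u = "\<epsilon> (FObj L (fst x))" and ?v = "FArr L (snd x)"
    obtain e where e: "is_coequalizer D ?u ?v e" "is_coequalizer C (FArr U ?u) (FArr U ?v) (FArr U e)"
      using beck_algebra_coequalizer[OF beck x] by auto
    define Q where "Q = Cod D e"
    have eD: "e \<in> Arr D" "Dom D e = FObj L (fst x)" "Cod D e = Q" "Q \<in> Obj D"
      using is_coequalizerD[OF e(1)] x' by (auto simp: Q_def)
    note split = L.source.split_fork_coequalizer[OF algebra_split_fork[OF x]]
    obtain k where k: "k \<in> Arr C" "Dom C k = fst x" "Cod C k = FObj U Q" "k \<cdot>\<^bsub>C\<^esub> snd x = FArr U e"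
      using coequalizer_factor[OF split, of "FArr U e"] is_coequalizerD(5-7)[OF e(2)] x' eD
      by auto
    have iso: "is_iso C k"
      using L.source.coequalizer_comparison_iso[OF split e(2) _ _ k(4)] k x' by simp
    \<comment> \<open>That \<open>k\<close> respects the algebra structures is read off from this closed form.\<close>
    have "k = FArr U e \<cdot>\<^bsub>C\<^esub> \<eta> (fst x)"
      using k(4)[THEN L.source.reassoc, of "\<eta> (fst x)"] k x' by simp
    then have "FArr U (\<epsilon> Q) \<cdot>\<^bsub>C\<^esub> FArr U (FArr L k) =
        FArr U ((\<epsilon> Q \<cdot>\<^bsub>D\<^esub> FArr L (FArr U e)) \<cdot>\<^bsub>D\<^esub> FArr L (\<eta> (fst x)))"
      using eD x' by (simp add: U.F_comp L.F_comp)
    also have "\<dots> = FArr U (e \<cdot>\<^bsub>D\<^esub> (\<epsilon> (FObj L (fst x)) \<cdot>\<^bsub>D\<^esub> FArr L (\<eta> (fst x))))"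
      using counit_natural[of e, THEN L.target.reassoc, of "FArr L (\<eta> (fst x))"] eD x'
      by (simp del: triangle_left)
    also have "\<dots> = k \<cdot>\<^bsub>C\<^esub> snd x" using eD x' k by simp
    finally have "(x, k, FObj K Q) \<in> Arr EM"
      using k x eD K.FObj_Obj[of Q] by (simp add: EM_Arr)
    moreover from this have "is_iso EM (x, k, FObj K Q)" using EM_iso iso by blast
    ultimately show "\<exists>A\<in>Obj D. \<exists>i\<in>Hom EM (FObj K A) x. is_iso EM i"
      using EM.inverse_arr[of "(x, k, FObj K Q)"] EM.iso_inverse_arr[of "(x, k, FObj K Q)"] eD
      by (intro bexI[of _ Q] bexI[of _ "EM.inverse_arr (x, k, FObj K Q)"]) (simp_all add: Hom_def)
  qed
  then show ?thesis
    unfolding monadic_def using adjunction by blast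
qed

end

text \<open>A \<open>U\<close>-split pair has a coequalizer \<open>q\<close> in \<open>C\<close>. Because the fork stays split under the monad, its
codomain \<open>Z\<close> inherits an algebra structure \<open>z\<close> for which \<open>q\<close> is a homomorphism. The algebra
\<open>(Z, z)\<close> is represented by an object of \<open>D\<close>, and full faithfulness of the comparison functor lifts \<open>q\<close>
and its universal property.\<close>

theorem beck_necessary:
  assumes "monadic D C U"
  shows "beck_condition D C U"
proof -
  obtain L \<eta> \<epsilon> where adj: "adjunction C D L U \<eta> \<epsilon>"
    and eq: "equivalence D (em_cat C (U \<circ>\<^sub>F L) \<eta> (\<lambda>A. FArr U (\<epsilon> (FObj L A)))) (em_comparison D U \<epsilon>)"
    using assms by (auto simp: monadic_def)
  interpret adjoint_functors C D L U \<eta> \<epsilon>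
    using adj by unfold_locales
  have faithful: "h = k" if "h \<in> Arr D" "k \<in> Arr D" "Dom D h = Dom D k" "Cod D h = Cod D k" "FArr U h = FArr U k"
    for h k
    using equivalence_faithful[OF eq, of h "Dom D h" "Cod D h" k] that by (simp add: Hom_def)
  have full: "\<exists>h. h \<in> Arr D \<and> Dom D h = A \<and> Cod D h = B \<and> FArr U h = g"
    if "A \<in> Obj D" "B \<in> Obj D" "(FObj K A, g, FObj K B) \<in> Arr EM" for A B g
    using equivalence_full[OF eq that(1,2), of "(FObj K A, g, FObj K B)"] that(3)
    by (auto simp: Hom_def)
  show ?thesis
    unfolding beck_condition_def
  proof (intro conjI ballI allI impI; (elim conjE)?)
    fix h assume h: "h \<in> Arr D" "is_iso C (FArr U h)"
    let ?A = "Dom D h" and ?B = "Cod D h"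
    have Kh: "(FObj K ?A, FArr U h, FObj K ?B) \<in> Arr EM"
      using K.F_arr(1)[OF h(1)] by simp
    then have "is_iso EM (FObj K ?A, FArr U h, FObj K ?B)" using EM_iso h by blast
    from EM.inverse_arr[OF this]
    have g: "EM.inverse_arr (FObj K ?A, FArr U h, FObj K ?B) \<in> Hom EM (FObj K ?B) (FObj K ?A)"
      by (simp add: Hom_def)
    then obtain g0 where g0: "EM.inverse_arr (FObj K ?A, FArr U h, FObj K ?B) = (FObj K ?B, g0, FObj K ?A)"
      "(FObj K ?B, g0, FObj K ?A) \<in> Arr EM" by (auto simp: EM_Hom)
    obtain g where g: "g \<in> Arr D" "Dom D g = ?B" "Cod D g = ?A" "FArr U g = g0"
      using full[OF _ _ g0(2)] h by auto
    have "g0 \<cdot>\<^bsub>C\<^esub> FArr U h = Ident C (FObj U ?A)" "FArr U h \<cdot>\<^bsub>C\<^esub> g0 = Ident C (FObj U ?B)"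
      using EM.inverse_arr(4,5)[OF \<open>is_iso EM (FObj K ?A, FArr U h, FObj K ?B)\<close>] g0 by simp_all
    then have "g \<cdot>\<^bsub>D\<^esub> h = Ident D ?A" "h \<cdot>\<^bsub>D\<^esub> g = Ident D ?B"
      using g h by (auto intro!: faithful simp: U.F_comp)
    then show "is_iso D h" using L.target.is_isoI[of h g] g h by simp
  next
    fix u v q s t
    assume u: "u \<in> Arr D" and v: "v \<in> Arr D" "Dom D v = Dom D u" "Cod D v = Cod D u"
      and split: "split_fork C (FArr U u) (FArr U v) q s t"
    define Y where "Y = Cod D u"
    define X where "X = Dom D u"
    have XY: "X \<in> Obj D" "Y \<in> Obj D" "Dom D u = X" "Cod D u = Y" "Dom D v = X" "Cod D v = Y"
      using u v by (auto simp: X_def Y_def)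
    define Z where "Z = Cod C q"
    have q: "q \<in> Arr C" "Dom C q = FObj U Y" "Cod C q = Z" "Z \<in> Obj C"
      "s \<in> Arr C" "Dom C s = Z" "Cod C s = FObj U Y" "t \<in> Arr C" "Dom C t = FObj U Y" "Cod C t = FObj U X"
      "q \<cdot>\<^bsub>C\<^esub> s = Ident C Z"
      and qu: "q \<cdot>\<^bsub>C\<^esub> FArr U u = q \<cdot>\<^bsub>C\<^esub> FArr U v"
      and ut: "FArr U u \<cdot>\<^bsub>C\<^esub> t = Ident C (FObj U Y)" "FArr U v \<cdot>\<^bsub>C\<^esub> t = s \<cdot>\<^bsub>C\<^esub> q"
      using split_forkD[OF split] u v XY by (auto simp: Z_def)
    \<comment> \<open>The endofunctor of the monad, on arrows.\<close>
    define T where "T = (\<lambda>f. FArr U (FArr L f))"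
    have T: "T f \<in> Arr C" "Dom C (T f) = FObj U (FObj L (Dom C f))" "Cod C (T f) = FObj U (FObj L (Cod C f))"
      if "f \<in> Arr C" for f using that by (simp_all add: T_def)
    have T_comp: "T (g \<cdot>\<^bsub>C\<^esub> f) = T g \<cdot>\<^bsub>C\<^esub> T f" if "f \<in> Arr C" "g \<in> Arr C" "Cod C f = Dom C g" for f g
      using that by (simp add: T_def L.F_comp U.F_comp)
    have T_id: "T (Ident C A) = Ident C (FObj U (FObj L A))" if "A \<in> Obj C" for A
      using that by (simp add: T_def)
    have U_nat: "FArr U (\<epsilon> (Cod D f)) \<cdot>\<^bsub>C\<^esub> T (FArr U f) = FArr U f \<cdot>\<^bsub>C\<^esub> FArr U (\<epsilon> (Dom D f))" if "f \<in> Arr D" for f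
      using that counit_natural[of f] by (simp add: T_def flip: U.F_comp)
    \<comment> \<open>This is the structure that makes \<open>q\<close> a homomorphism, read off through the section \<open>s\<close> of \<open>q\<close>.\<close>
    define z where "z = q \<cdot>\<^bsub>C\<^esub> (FArr U (\<epsilon> Y) \<cdot>\<^bsub>C\<^esub> T s)"
    have z: "z \<in> Arr C" "Dom C z = FObj U (FObj L Z)" "Cod C z = Z"
      using q XY T[of s] by (simp_all add: z_def)
    have z_q: "z \<cdot>\<^bsub>C\<^esub> T q = q \<cdot>\<^bsub>C\<^esub> FArr U (\<epsilon> Y)"
    proof -
      have "z \<cdot>\<^bsub>C\<^esub> T q = q \<cdot>\<^bsub>C\<^esub> (FArr U (\<epsilon> Y) \<cdot>\<^bsub>C\<^esub> T (FArr U v \<cdot>\<^bsub>C\<^esub> t))"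
        using q XY T[of s] T[of q] ut by (simp add: z_def T_comp)
      also have "\<dots> = q \<cdot>\<^bsub>C\<^esub> (FArr U v \<cdot>\<^bsub>C\<^esub> (FArr U (\<epsilon> X) \<cdot>\<^bsub>C\<^esub> T t))"
        using q XY u v T[of t] T[of "FArr U v"] U_nat[OF v(1), unfolded XY, THEN L.source.reassoc, of "T t"]
        by (simp add: T_comp)
      also have "\<dots> = q \<cdot>\<^bsub>C\<^esub> (FArr U u \<cdot>\<^bsub>C\<^esub> (FArr U (\<epsilon> X) \<cdot>\<^bsub>C\<^esub> T t))"
        using qu[THEN L.source.reassoc, of "FArr U (\<epsilon> X) \<cdot>\<^bsub>C\<^esub> T t"] q XY u v T[of t] by simp
      also have "\<dots> = q \<cdot>\<^bsub>C\<^esub> (FArr U (\<epsilon> Y) \<cdot>\<^bsub>C\<^esub> T (FArr U u \<cdot>\<^bsub>C\<^esub> t))"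
        using q XY u v T[of t] T[of "FArr U u"] U_nat[OF u, unfolded XY, THEN L.source.reassoc, of "T t"]
        by (simp add: T_comp)
      finally show ?thesis using q XY ut by (simp add: T_id)
    qed
    have Tq: "T q \<cdot>\<^bsub>C\<^esub> T s = Ident C (Cod C (T q))"
      using q T[of q] T_comp[of s q] by (simp add: T_id)
    have algebra: "(Z, z) \<in> Obj EM"
    proof -
      have "z \<cdot>\<^bsub>C\<^esub> \<eta> Z = q \<cdot>\<^bsub>C\<^esub> (FArr U (\<epsilon> Y) \<cdot>\<^bsub>C\<^esub> (\<eta> (FObj U Y) \<cdot>\<^bsub>C\<^esub> s))"
        using q XY T[of s] unit_natural[of s] by (simp add: z_def T_def)
      also have "\<dots> = Ident C Z"
        using q XY triangle_right[of Y, THEN L.source.reassoc, of s] by simp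
      finally have unit_law: "z \<cdot>\<^bsub>C\<^esub> \<eta> Z = Ident C Z" .
      let ?e = "FArr U (\<epsilon> (FObj L Z))" and ?eY = "FArr U (\<epsilon> (FObj L (FObj U Y)))"
      \<comment> \<open>Associativity is checked after composition with the split epimorphism \<open>T (T q)\<close>.\<close>
      have TTq: "T (T q) \<cdot>\<^bsub>C\<^esub> T (T s) = Ident C (Cod C (T (T q)))"
        using q T[of q] T[of s] T[of "T q"] T_comp[of "T s" "T q"] Tq by (simp add: T_id)
      have "(z \<cdot>\<^bsub>C\<^esub> T z) \<cdot>\<^bsub>C\<^esub> T (T q) = z \<cdot>\<^bsub>C\<^esub> T (z \<cdot>\<^bsub>C\<^esub> T q)"
        using z q T[of q] T[of "T q"] T[of z] by (simp add: T_comp)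
      also have "\<dots> = (z \<cdot>\<^bsub>C\<^esub> T q) \<cdot>\<^bsub>C\<^esub> T (FArr U (\<epsilon> Y))"
        using z q XY T[of q] T[of "FArr U (\<epsilon> Y)"] z_q[THEN L.source.reassoc, of "T (FArr U (\<epsilon> Y))"]
        by (simp add: z_q T_comp)
      also have "\<dots> = q \<cdot>\<^bsub>C\<^esub> (FArr U (\<epsilon> Y) \<cdot>\<^bsub>C\<^esub> ?eY)"
        using q XY T[of "FArr U (\<epsilon> Y)"] U_nat[of "\<epsilon> Y"] by (simp add: z_q)
      also have "\<dots> = z \<cdot>\<^bsub>C\<^esub> (T q \<cdot>\<^bsub>C\<^esub> ?eY)"
        using z_q[THEN L.source.reassoc, of ?eY] q XY z T[of q] by simp
      also have "\<dots> = (z \<cdot>\<^bsub>C\<^esub> ?e) \<cdot>\<^bsub>C\<^esub> T (T q)"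
        using U_nat[of "FArr L q"] q z T[of q] T[of "T q"] by (simp add: T_def)
      finally have "z \<cdot>\<^bsub>C\<^esub> T z = z \<cdot>\<^bsub>C\<^esub> ?e"
        by (rule L.source.split_epi_cancel[OF TTq, rotated -1])
          (use q z T[of q] T[of s] T[of z] T[of "T q"] T[of "T s"] in simp_all)
      then show ?thesis using z q unit_law by (simp add: EM_Obj T_def)
    qed
    obtain Q i where Q: "Q \<in> Obj D" "i \<in> Hom EM (FObj K Q) (Z, z)" "is_iso EM i"
      using equivalence_ess_surj[OF eq algebra] by blast
    then obtain j where j: "i = (FObj K Q, j, (Z, z))" "(FObj K Q, j, (Z, z)) \<in> Arr EM"
      by (auto simp: EM_Hom)
    have q_EM: "(FObj K Y, q, (Z, z)) \<in> Arr EM"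
      using K.FObj_Obj[of Y] XY q algebra z_q by (simp add: EM_Arr T_def)
    have j_iso: "is_iso C j" using Q j EM_iso by blast
    have jD: "j \<in> Arr C" "Dom C j = FObj U Q" "Cod C j = Z"
      "j \<cdot>\<^bsub>C\<^esub> FArr U (\<epsilon> Q) = z \<cdot>\<^bsub>C\<^esub> T j"
      using j(2) by (simp_all add: EM_Arr T_def)
    have "is_iso EM (FObj K Q, j, (Z, z))" using Q j by simp
    from EM.inverse_arr[OF this] obtain l where l: "((Z, z), l, FObj K Q) \<in> Arr EM"
      "j \<cdot>\<^bsub>C\<^esub> l = Ident C Z" "l \<cdot>\<^bsub>C\<^esub> j = Ident C (FObj U Q)"
      by (cases "EM.inverse_arr (FObj K Q, j, (Z, z))") auto
    have lD: "l \<in> Arr C" "Dom C l = Z" "Cod C l = FObj U Q"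
      using l by (simp_all add: EM_Arr)
    have "(FObj K Y, l \<cdot>\<^bsub>C\<^esub> q, FObj K Q) \<in> Arr EM"
      using EM.comp_arr(1)[OF q_EM l(1)] by simp
    then obtain e where e: "e \<in> Arr D" "Dom D e = Y" "Cod D e = Q" "FArr U e = l \<cdot>\<^bsub>C\<^esub> q"
      using full[of Y Q "l \<cdot>\<^bsub>C\<^esub> q"] XY Q by auto
    have l_iso: "is_iso C l"
      using L.source.is_isoI[of l j] l lD jD by simp
    have q_coeq: "is_coequalizer C (FArr U u) (FArr U v) q"
      by (rule L.source.split_fork_coequalizer[OF split])
    have coeq_C: "is_coequalizer C (FArr U u) (FArr U v) (FArr U e)"
      using L.source.coequalizer_comp_iso[OF q_coeq l_iso] lD q e by simp
    have coeq_D: "is_coequalizer D u v e"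
    proof (rule L.target.coequalizerI)
      show "e \<cdot>\<^bsub>D\<^esub> u = e \<cdot>\<^bsub>D\<^esub> v"
        using e u v XY is_coequalizerD(7)[OF coeq_C] by (intro faithful) (simp_all add: U.F_comp)
    next
      fix w assume w: "w \<in> Arr D" "Dom D w = Cod D u" "w \<cdot>\<^bsub>D\<^esub> u = w \<cdot>\<^bsub>D\<^esub> v"
      define W where "W = Cod D w"
      have wD: "Dom D w = Y" "Cod D w = W" "W \<in> Obj D" using w XY by (auto simp: W_def)
      have "FArr U w \<cdot>\<^bsub>C\<^esub> FArr U u = FArr U w \<cdot>\<^bsub>C\<^esub> FArr U v"
        using w u v XY by (simp flip: U.F_comp)
      then obtain k where k: "k \<in> Arr C" "Dom C k = Z" "Cod C k = FObj U W" "k \<cdot>\<^bsub>C\<^esub> q = FArr U w"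
        using coequalizer_factor[OF q_coeq, of "FArr U w"] w wD u q XY by auto
      have Tw: "T (FArr U w) = T k \<cdot>\<^bsub>C\<^esub> T q"
        using T_comp[of q k] k(1,2) q(1,3) unfolding k(4) by simp
      have "(k \<cdot>\<^bsub>C\<^esub> z) \<cdot>\<^bsub>C\<^esub> T q = k \<cdot>\<^bsub>C\<^esub> (q \<cdot>\<^bsub>C\<^esub> FArr U (\<epsilon> Y))"
        using k z q T[of q] z_q by simp
      also have "\<dots> = FArr U w \<cdot>\<^bsub>C\<^esub> FArr U (\<epsilon> Y)"
        using k(4)[THEN L.source.reassoc, of "FArr U (\<epsilon> Y)"] k q XY by simp
      also have "\<dots> = FArr U (\<epsilon> W) \<cdot>\<^bsub>C\<^esub> T (k \<cdot>\<^bsub>C\<^esub> q)"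
        using U_nat[of w] w wD k by simp
      also have "\<dots> = (FArr U (\<epsilon> W) \<cdot>\<^bsub>C\<^esub> T k) \<cdot>\<^bsub>C\<^esub> T q"
        unfolding k(4) Tw
        by (rule L.source.assoc[symmetric]) (use wD k(1-3) q(1-3) T(1-3) in simp_all)
      finally have "k \<cdot>\<^bsub>C\<^esub> z = FArr U (\<epsilon> W) \<cdot>\<^bsub>C\<^esub> T k"
        by (rule L.source.split_epi_cancel[OF Tq, rotated -1])
          (use q z k wD T[of q] T[of s] T[of k] in simp_all)
      then have k_EM: "((Z, z), k, FObj K W) \<in> Arr EM"
        using k z algebra K.FObj_Obj[of W] wD by (simp add: EM_Arr T_def)
      have "(FObj K Q, k \<cdot>\<^bsub>C\<^esub> j, FObj K W) \<in> Arr EM"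
        using EM.comp_arr(1)[OF j(2) k_EM] by simp
      then obtain h where h: "h \<in> Arr D" "Dom D h = Q" "Cod D h = W" "FArr U h = k \<cdot>\<^bsub>C\<^esub> j"
        using full[of Q W "k \<cdot>\<^bsub>C\<^esub> j"] wD Q by auto
      have "h \<cdot>\<^bsub>D\<^esub> e = w"
        using h e w wD XY k jD lD q l(2)[THEN L.source.reassoc, of q]
        by (intro faithful) (simp_all add: U.F_comp)
      then show "\<exists>k. k \<in> Arr D \<and> Dom D k = Cod D e \<and> Cod D k = Cod D w \<and> k \<cdot>\<^bsub>D\<^esub> e = w"
        using h(1-3) e(3) wD(2) by (intro exI[of _ h]) simp
    next
      fix x y assume xy: "x \<in> Arr D" "y \<in> Arr D" "Dom D x = Cod D e" "Dom D y = Cod D e"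
        "Cod D x = Cod D y" "x \<cdot>\<^bsub>D\<^esub> e = y \<cdot>\<^bsub>D\<^esub> e"
      have "FArr U x \<cdot>\<^bsub>C\<^esub> FArr U e = FArr U y \<cdot>\<^bsub>C\<^esub> FArr U e"
        using xy e(1-3) by (simp flip: U.F_comp)
      then have "FArr U x = FArr U y"
        using L.source.coequalizer_epi[OF coeq_C, of "FArr U x" "FArr U y"] xy e(1-3) by simp
      then show "x = y" using xy by (intro faithful) simp_all
    qed (use u v e XY in simp_all)
    show "\<exists>e. is_coequalizer D u v e \<and> is_coequalizer C (FArr U u) (FArr U v) (FArr U e)"
      using coeq_C coeq_D by blast
  qed
qed

section \<open>Pullbacks\<close>

lemma pullbackD:
  assumes "is_pullback C f g a c"
  shows "f \<in> Arr C" "g \<in> Arr C" "Cod C g = Cod C f" "a \<in> Arr C" "c \<in> Arr C"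
    "Dom C c = Dom C a" "Cod C a = Dom C f" "Cod C c = Dom C g" "f \<cdot>\<^bsub>C\<^esub> a = g \<cdot>\<^bsub>C\<^esub> c"
  using assms by (auto simp: is_pullback_def Hom_def)

lemma pullback_lift:
  assumes "is_pullback C f g a c" "x \<in> Arr C" "y \<in> Arr C" "Dom C x = Dom C y"
    "Cod C x = Dom C f" "Cod C y = Dom C g" "f \<cdot>\<^bsub>C\<^esub> x = g \<cdot>\<^bsub>C\<^esub> y"
  obtains h where "h \<in> Arr C" "Dom C h = Dom C x" "Cod C h = Dom C a" "a \<cdot>\<^bsub>C\<^esub> h = x" "c \<cdot>\<^bsub>C\<^esub> h = y"
proof -
  have all: "\<forall>Z x y. x \<in> Hom C Z (Dom C f) \<and> y \<in> Hom C Z (Dom C g) \<and> f \<cdot>\<^bsub>C\<^esub> x = g \<cdot>\<^bsub>C\<^esub> y \<longrightarrow>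
        (\<exists>!h. h \<in> Hom C Z (Dom C a) \<and> a \<cdot>\<^bsub>C\<^esub> h = x \<and> c \<cdot>\<^bsub>C\<^esub> h = y)"
    using assms(1) unfolding is_pullback_def by (elim conjE)
  have "\<exists>!h. h \<in> Hom C (Dom C x) (Dom C a) \<and> a \<cdot>\<^bsub>C\<^esub> h = x \<and> c \<cdot>\<^bsub>C\<^esub> h = y"
    using assms(2-7) by (intro all[rule_format]) (simp add: Hom_def)
  then show thesis using that by (auto simp: Hom_def)
qed

context category
begin

lemma pullback_eqI:
  assumes "is_pullback C f g a c" "x \<in> Arr C" "y \<in> Arr C" "Dom C x = Dom C y"
    "Cod C x = Dom C a" "Cod C y = Dom C a" "a \<cdot> x = a \<cdot> y" "c \<cdot> x = c \<cdot> y"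
  shows "x = y"
proof -
  note p = pullbackD[OF assms(1)]
  have all: "\<forall>Z x y. x \<in> Hom C Z (Dom C f) \<and> y \<in> Hom C Z (Dom C g) \<and> f \<cdot> x = g \<cdot> y \<longrightarrow>
        (\<exists>!h. h \<in> Hom C Z (Dom C a) \<and> a \<cdot> h = x \<and> c \<cdot> h = y)"
    using assms(1) unfolding is_pullback_def by (elim conjE)
  have "\<exists>!h. h \<in> Hom C (Dom C x) (Dom C a) \<and> a \<cdot> h = a \<cdot> y \<and> c \<cdot> h = c \<cdot> y"
    using p assms(2-6) p(9)[THEN reassoc, of y] by (intro all[rule_format]) (simp add: Hom_def)
  moreover have "x \<in> Hom C (Dom C x) (Dom C a)" "y \<in> Hom C (Dom C x) (Dom C a)"
    using assms by (auto simp: Hom_def)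
  ultimately show ?thesis using assms(7,8) by metis
qed

lemma pullbackI:
  assumes "f \<in> Arr C" "g \<in> Arr C" "Cod C g = Cod C f" "a \<in> Arr C" "c \<in> Arr C"
    "Dom C c = Dom C a" "Cod C a = Dom C f" "Cod C c = Dom C g" "f \<cdot> a = g \<cdot> c"
    and lift: "\<And>x y. x \<in> Arr C \<Longrightarrow> y \<in> Arr C \<Longrightarrow> Dom C y = Dom C x \<Longrightarrow> Cod C x = Dom C f \<Longrightarrow>
      Cod C y = Dom C g \<Longrightarrow> f \<cdot> x = g \<cdot> y \<Longrightarrow>
      \<exists>h. h \<in> Arr C \<and> Dom C h = Dom C x \<and> Cod C h = Dom C a \<and> a \<cdot> h = x \<and> c \<cdot> h = y"
    and eq: "\<And>x y. x \<in> Arr C \<Longrightarrow> y \<in> Arr C \<Longrightarrow> Dom C y = Dom C x \<Longrightarrow> Cod C x = Dom C a \<Longrightarrow>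
      Cod C y = Dom C a \<Longrightarrow> a \<cdot> x = a \<cdot> y \<Longrightarrow> c \<cdot> x = c \<cdot> y \<Longrightarrow> x = y"
  shows "is_pullback C f g a c"
  unfolding is_pullback_def
proof (intro conjI allI impI)
  fix Z x y assume xy: "x \<in> Hom C Z (Dom C f) \<and> y \<in> Hom C Z (Dom C g) \<and> f \<cdot> x = g \<cdot> y"
  then have "\<exists>h. h \<in> Arr C \<and> Dom C h = Dom C x \<and> Cod C h = Dom C a \<and> a \<cdot> h = x \<and> c \<cdot> h = y"
    by (intro lift) (auto simp: Hom_def)
  then obtain h where "h \<in> Arr C \<and> Dom C h = Dom C x \<and> Cod C h = Dom C a \<and> a \<cdot> h = x \<and> c \<cdot> h = y" ..
  then show "\<exists>!h. h \<in> Hom C Z (Dom C a) \<and> a \<cdot> h = x \<and> c \<cdot> h = y"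
    using xy by (intro ex1I[of _ h]) (auto simp: Hom_def intro!: eq)
qed (use assms in \<open>simp_all add: Hom_def\<close>)

lemma pullback_sym:
  assumes "is_pullback C f g a c"
  shows "is_pullback C g f c a"
proof (rule pullbackI)
  note p = pullbackD[OF assms]
  show "f \<in> Arr C" "g \<in> Arr C" "Cod C f = Cod C g" "a \<in> Arr C" "c \<in> Arr C"
    "Dom C a = Dom C c" "Cod C a = Dom C f" "Cod C c = Dom C g" "g \<cdot> c = f \<cdot> a"
    using p by simp_all
  fix x y
  show "\<exists>h. h \<in> Arr C \<and> Dom C h = Dom C x \<and> Cod C h = Dom C c \<and> c \<cdot> h = x \<and> a \<cdot> h = y"
    if "x \<in> Arr C" "y \<in> Arr C" "Dom C y = Dom C x" "Cod C x = Dom C g"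
      "Cod C y = Dom C f" "g \<cdot> x = f \<cdot> y"
    using pullback_lift[OF assms, of y x] that p(6) by metis
  show "x = y" if "x \<in> Arr C" "y \<in> Arr C" "Dom C y = Dom C x" "Cod C x = Dom C c"
      "Cod C y = Dom C c" "c \<cdot> x = c \<cdot> y" "a \<cdot> x = a \<cdot> y"
    using pullback_eqI[OF assms, of x y] that p(6) by simp
qed

lemma pullback_paste:
  assumes outer: "is_pullback C f g a c" and inner: "is_pullback C c h b d"
  shows "is_pullback C f (g \<cdot> h) (a \<cdot> b) d"
proof (rule pullbackI)
  note p = pullbackD[OF outer] and q = pullbackD[OF inner]
  show "f \<in> Arr C" "g \<cdot> h \<in> Arr C" "Cod C (g \<cdot> h) = Cod C f" "a \<cdot> b \<in> Arr C" "d \<in> Arr C"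
    "Dom C d = Dom C (a \<cdot> b)" "Cod C (a \<cdot> b) = Dom C f" "Cod C d = Dom C (g \<cdot> h)"
    using p q by simp_all
  show "f \<cdot> (a \<cdot> b) = (g \<cdot> h) \<cdot> d"
    using p(9)[THEN reassoc, of b] p q by simp
  fix x y
  show "\<exists>k. k \<in> Arr C \<and> Dom C k = Dom C x \<and> Cod C k = Dom C (a \<cdot> b) \<and> (a \<cdot> b) \<cdot> k = x \<and> d \<cdot> k = y"
    if xy: "x \<in> Arr C" "y \<in> Arr C" "Dom C y = Dom C x" "Cod C x = Dom C f"
      "Cod C y = Dom C (g \<cdot> h)" "f \<cdot> x = (g \<cdot> h) \<cdot> y"
  proof -
    have y: "Cod C y = Dom C h" using xy p q by simp
    obtain k where k: "k \<in> Arr C" "Dom C k = Dom C x" "Cod C k = Dom C a" "a \<cdot> k = x" "c \<cdot> k = h \<cdot> y"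
      using pullback_lift[OF outer, of x "h \<cdot> y"] xy y p q by auto
    obtain l where "l \<in> Arr C" "Dom C l = Dom C k" "Cod C l = Dom C b" "b \<cdot> l = k" "d \<cdot> l = y"
      using pullback_lift[OF inner, of k y] k xy y p q by auto
    then show ?thesis using k p q by (intro exI[of _ l]) simp
  qed
  show "x = y" if xy: "x \<in> Arr C" "y \<in> Arr C" "Dom C y = Dom C x" "Cod C x = Dom C (a \<cdot> b)"
      "Cod C y = Dom C (a \<cdot> b)" "(a \<cdot> b) \<cdot> x = (a \<cdot> b) \<cdot> y" "d \<cdot> x = d \<cdot> y"
  proof -
    have c: "Cod C x = Dom C b" "Cod C y = Dom C b" using xy p q by simp_all
    have "h \<cdot> (d \<cdot> x) = h \<cdot> (d \<cdot> y)" using xy by simp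
    then have "c \<cdot> (b \<cdot> x) = c \<cdot> (b \<cdot> y)"
      using q(9)[THEN reassoc, of x] q(9)[THEN reassoc, of y] xy c q by simp
    then have "b \<cdot> x = b \<cdot> y"
      by (rule pullback_eqI[OF outer, rotated -1]) (use xy c p q in simp_all)
    then show ?thesis
      by (rule pullback_eqI[OF inner, rotated -2]) (use xy c p q in simp_all)
  qed
qed

text \<open>A cone on the inner square extends to one on the outer square. The lift obtained there has the
right component \<open>x\<close> because the projections of the adjacent pullback are jointly monic.\<close>

lemma pullback_cancel:
  assumes total: "is_pullback C f (g \<cdot> h) (a \<cdot> b) d" and outer: "is_pullback C f g a c"
    and b: "b \<in> Arr C" "Cod C b = Dom C a" and h: "h \<in> Arr C" "Cod C h = Dom C g"
    and comm: "c \<cdot> b = h \<cdot> d"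
  shows "is_pullback C c h b d"
proof (rule pullbackI)
  note p = pullbackD[OF outer] and q = pullbackD[OF total]
  have d: "d \<in> Arr C" "Dom C d = Dom C b" "Cod C d = Dom C h" using q p b h by simp_all
  show "c \<in> Arr C" "h \<in> Arr C" "Cod C h = Cod C c" "b \<in> Arr C" "d \<in> Arr C"
    "Dom C d = Dom C b" "Cod C b = Dom C c" "Cod C d = Dom C h" "c \<cdot> b = h \<cdot> d"
    using p d b h comm by simp_all
  fix x y
  show "\<exists>k. k \<in> Arr C \<and> Dom C k = Dom C x \<and> Cod C k = Dom C b \<and> b \<cdot> k = x \<and> d \<cdot> k = y"
    if xy: "x \<in> Arr C" "y \<in> Arr C" "Dom C y = Dom C x" "Cod C x = Dom C c"
      "Cod C y = Dom C h" "c \<cdot> x = h \<cdot> y"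
  proof -
    have "f \<cdot> (a \<cdot> x) = (g \<cdot> h) \<cdot> y"
      using p(9)[THEN reassoc, of x] xy p h by simp
    then obtain k where k: "k \<in> Arr C" "Dom C k = Dom C x" "Cod C k = Dom C b" "(a \<cdot> b) \<cdot> k = a \<cdot> x" "d \<cdot> k = y"
      using pullback_lift[OF total, of "a \<cdot> x" y] xy p h b by auto
    have "c \<cdot> (b \<cdot> k) = c \<cdot> x"
      using comm[THEN reassoc, of k] k xy p h b d by simp
    then have "b \<cdot> k = x"
      by (rule pullback_eqI[OF outer, rotated -1]) (use k xy p b in simp_all)
    then show ?thesis using k by (intro exI[of _ k]) simp
  qed
  show "x = y" if xy: "x \<in> Arr C" "y \<in> Arr C" "Dom C y = Dom C x" "Cod C x = Dom C b"
      "Cod C y = Dom C b" "b \<cdot> x = b \<cdot> y" "d \<cdot> x = d \<cdot> y"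
    by (rule pullback_eqI[OF total]) (use xy b p in simp_all)
qed

lemma pullback_comparison_iso:
  assumes p: "is_pullback C f g a c" and p': "is_pullback C f g a' c'"
    and k: "k \<in> Arr C" "Dom C k = Dom C a" "Cod C k = Dom C a'" "a' \<cdot> k = a" "c' \<cdot> k = c"
  shows "is_iso C k"
proof -
  note q = pullbackD[OF p] and q' = pullbackD[OF p']
  obtain l where l: "l \<in> Arr C" "Dom C l = Dom C a'" "Cod C l = Dom C a" "a \<cdot> l = a'" "c \<cdot> l = c'"
    using pullback_lift[OF p, of a' c'] q q' by auto
  have "l \<cdot> k = Ident C (Dom C k)"
    by (rule pullback_eqI[OF p])
      (use k l q q' l(4)[THEN reassoc, of k] l(5)[THEN reassoc, of k] in simp_all)
  moreover have "k \<cdot> l = Ident C (Cod C k)"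
    by (rule pullback_eqI[OF p'])
      (use k l q q' k(4)[THEN reassoc, of l] k(5)[THEN reassoc, of l] in simp_all)
  ultimately show ?thesis using is_isoI[of k l] k l by simp
qed

lemma pullback_comp_iso:
  assumes p: "is_pullback C f g a c" and k: "is_iso C k" "Cod C k = Dom C a"
  shows "is_pullback C f g (a \<cdot> k) (c \<cdot> k)"
proof (rule pullbackI)
  note q = pullbackD[OF p]
  define l where "l = inverse_arr k"
  have l: "l \<in> Arr C" "Dom C l = Dom C a" "Cod C l = Dom C k" "k \<cdot> l = Ident C (Dom C a)" and ka: "k \<in> Arr C"
    using inverse_arr[OF k(1)] iso_arr[OF k(1)] k by (simp_all add: l_def)
  show "f \<in> Arr C" "g \<in> Arr C" "Cod C g = Cod C f" "a \<cdot> k \<in> Arr C" "c \<cdot> k \<in> Arr C"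
    "Dom C (c \<cdot> k) = Dom C (a \<cdot> k)" "Cod C (a \<cdot> k) = Dom C f" "Cod C (c \<cdot> k) = Dom C g"
    "f \<cdot> (a \<cdot> k) = g \<cdot> (c \<cdot> k)"
    using q k ka q(9)[THEN reassoc, of k] by simp_all
  fix x y
  show "\<exists>h. h \<in> Arr C \<and> Dom C h = Dom C x \<and> Cod C h = Dom C (a \<cdot> k) \<and> (a \<cdot> k) \<cdot> h = x \<and> (c \<cdot> k) \<cdot> h = y"
    if xy: "x \<in> Arr C" "y \<in> Arr C" "Dom C y = Dom C x" "Cod C x = Dom C f"
      "Cod C y = Dom C g" "f \<cdot> x = g \<cdot> y"
  proof -
    obtain h where h: "h \<in> Arr C" "Dom C h = Dom C x" "Cod C h = Dom C a" "a \<cdot> h = x" "c \<cdot> h = y"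
      using pullback_lift[OF p, of x y] xy by auto
    then show ?thesis
      using l ka k q l(4)[THEN reassoc, of h] by (intro exI[of _ "l \<cdot> h"]) simp
  qed
  show "x = y" if xy: "x \<in> Arr C" "y \<in> Arr C" "Dom C y = Dom C x" "Cod C x = Dom C (a \<cdot> k)"
      "Cod C y = Dom C (a \<cdot> k)" "(a \<cdot> k) \<cdot> x = (a \<cdot> k) \<cdot> y" "(c \<cdot> k) \<cdot> x = (c \<cdot> k) \<cdot> y"
  proof -
    have "k \<cdot> x = k \<cdot> y"
      by (rule pullback_eqI[OF p]) (use xy ka k q in simp_all)
    then show ?thesis
      using iso_cancel_left[OF k(1), of x y] xy ka k q by simp
  qed
qed

end

text \<open>Cones over the image of the square correspond to cones over the square by transposition.\<close>

lemma (in adjoint_functors) right_adjoint_pullback: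
  assumes p: "is_pullback D f g a c"
  shows "is_pullback C (FArr U f) (FArr U g) (FArr U a) (FArr U c)"
proof (rule L.source.pullbackI)
  note q = pullbackD[OF p]
  show "FArr U f \<in> Arr C" "FArr U g \<in> Arr C" "Cod C (FArr U g) = Cod C (FArr U f)"
    "FArr U a \<in> Arr C" "FArr U c \<in> Arr C" "Dom C (FArr U c) = Dom C (FArr U a)"
    "Cod C (FArr U a) = Dom C (FArr U f)" "Cod C (FArr U c) = Dom C (FArr U g)"
    "FArr U f \<cdot>\<^bsub>C\<^esub> FArr U a = FArr U g \<cdot>\<^bsub>C\<^esub> FArr U c"
    using q by (simp_all flip: U.F_comp)
  have transpose: "FArr U (\<epsilon> Y \<cdot>\<^bsub>D\<^esub> FArr L x) \<cdot>\<^bsub>C\<^esub> \<eta> (Dom C x) = x"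
    if "x \<in> Arr C" "Y \<in> Obj D" "Cod C x = FObj U Y" for x Y
    using that unit_natural[of x] triangle_right[THEN L.source.reassoc, of Y x] by (simp add: U.F_comp)
  have transpose_comp: "m \<cdot>\<^bsub>D\<^esub> (\<epsilon> (Dom D m) \<cdot>\<^bsub>D\<^esub> FArr L x) = \<epsilon> (Cod D m) \<cdot>\<^bsub>D\<^esub> FArr L (FArr U m \<cdot>\<^bsub>C\<^esub> x)"
    if "x \<in> Arr C" "m \<in> Arr D" "Cod C x = FObj U (Dom D m)" for x m
    using that counit_natural[THEN L.target.reassoc, of m "FArr L x"] by (simp add: L.F_comp)
  fix x y
  show "\<exists>h. h \<in> Arr C \<and> Dom C h = Dom C x \<and> Cod C h = Dom C (FArr U a) \<and>
      FArr U a \<cdot>\<^bsub>C\<^esub> h = x \<and> FArr U c \<cdot>\<^bsub>C\<^esub> h = y"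
    if xy: "x \<in> Arr C" "y \<in> Arr C" "Dom C y = Dom C x" "Cod C x = Dom C (FArr U f)"
      "Cod C y = Dom C (FArr U g)" "FArr U f \<cdot>\<^bsub>C\<^esub> x = FArr U g \<cdot>\<^bsub>C\<^esub> y"
  proof -
    let ?x = "\<epsilon> (Dom D f) \<cdot>\<^bsub>D\<^esub> FArr L x" and ?y = "\<epsilon> (Dom D g) \<cdot>\<^bsub>D\<^esub> FArr L y"
    have "f \<cdot>\<^bsub>D\<^esub> ?x = g \<cdot>\<^bsub>D\<^esub> ?y"
      using transpose_comp[of x f] transpose_comp[of y g] xy q by simp
    then obtain h where h: "h \<in> Arr D" "Dom D h = FObj L (Dom C x)" "Cod D h = Dom D a"
      "a \<cdot>\<^bsub>D\<^esub> h = ?x" "c \<cdot>\<^bsub>D\<^esub> h = ?y"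
      using pullback_lift[OF p, of ?x ?y] xy q by auto
    have "FArr U a \<cdot>\<^bsub>C\<^esub> (FArr U h \<cdot>\<^bsub>C\<^esub> \<eta> (Dom C x)) = x"
      using U.F_comp[of h a, THEN sym, THEN L.source.reassoc, of "\<eta> (Dom C x)"] h transpose[of x "Dom D f"] xy q by simp
    moreover have "FArr U c \<cdot>\<^bsub>C\<^esub> (FArr U h \<cdot>\<^bsub>C\<^esub> \<eta> (Dom C x)) = y"
      using U.F_comp[of h c, THEN sym, THEN L.source.reassoc, of "\<eta> (Dom C x)"] h transpose[of y "Dom D g"] xy q by simp
    ultimately show ?thesis
      using h xy q by (intro exI[of _ "FArr U h \<cdot>\<^bsub>C\<^esub> \<eta> (Dom C x)"]) simp
  qed
  show "x = y" if xy: "x \<in> Arr C" "y \<in> Arr C" "Dom C y = Dom C x" "Cod C x = Dom C (FArr U a)"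
      "Cod C y = Dom C (FArr U a)" "FArr U a \<cdot>\<^bsub>C\<^esub> x = FArr U a \<cdot>\<^bsub>C\<^esub> y" "FArr U c \<cdot>\<^bsub>C\<^esub> x = FArr U c \<cdot>\<^bsub>C\<^esub> y"
  proof -
    let ?x = "\<epsilon> (Dom D a) \<cdot>\<^bsub>D\<^esub> FArr L x" and ?y = "\<epsilon> (Dom D a) \<cdot>\<^bsub>D\<^esub> FArr L y"
    have "?x = ?y"
      by (rule L.target.pullback_eqI[OF p])
        (use xy q transpose_comp[of x a] transpose_comp[of y a] transpose_comp[of x c] transpose_comp[of y c] in simp_all)
    then show ?thesis
      using transpose[of x "Dom D a"] transpose[of y "Dom D a"] xy q by simp
  qed
qed

section \<open>Slices of extensions and change of base\<close>

text \<open>Change of base along \<open>p\<close> exists on extensions for every arrow \<open>p\<close>, whereas composition with \<open>f\<close>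
preserves extensions only for an extension \<open>f\<close>. Accordingly the former is studied for arbitrary arrows.\<close>

locale extension_class = category C for C :: "('o, 'a) cat" (structure) +
  fixes E :: "'a set"
  assumes admissible: "admissible_class C E"
begin

lemma E_Arr: "f \<in> E \<Longrightarrow> f \<in> Arr C"
  using admissible by (auto simp: admissible_class_def)

lemma E_comp: "f \<in> E \<Longrightarrow> g \<in> E \<Longrightarrow> Dom C g = Cod C f \<Longrightarrow> g \<cdot> f \<in> E"
  using admissible by (auto simp: admissible_class_def)

lemma E_pullback: "is_pullback C f g a c \<Longrightarrow> f \<in> E \<Longrightarrow> c \<in> E"
  using admissible pullbackD(2,3)[of C f g a c] by (auto simp: admissible_class_def)

lemma pb_is_pullback:
  assumes "f \<in> E" "p \<in> Arr C" "Cod C p = Cod C f"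
  shows "is_pullback C f p (pb_top C p f) (pb_along C p f)"
proof -
  have "\<exists>a c. is_pullback C f p a c"
    using admissible assms by (auto simp: admissible_class_def)
  then have "\<exists>q. is_pullback C f p (fst q) (snd q)" by auto
  then show ?thesis
    unfolding pb_top_def pb_along_def pb_cone_def by (rule someI_ex)
qed

lemma pb_along_E: "f \<in> E \<Longrightarrow> p \<in> Arr C \<Longrightarrow> Cod C p = Cod C f \<Longrightarrow> pb_along C p f \<in> E"
  using E_pullback pb_is_pullback by blast

abbreviation Ext :: "'o \<Rightarrow> ('a, 'a \<times> 'a \<times> 'a) cat" where
  "Ext B \<equiv> full_subcat (slice C B) E"

lemma Ext_Obj: "x \<in> Obj (Ext B) \<longleftrightarrow> x \<in> E \<and> Cod C x = B"
  using E_Arr by (auto simp: full_subcat_def slice_def)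

lemma Ext_Arr: "(x, h, y) \<in> Arr (Ext B) \<longleftrightarrow> x \<in> E \<and> Cod C x = B \<and> y \<in> E \<and> Cod C y = B \<and>
    h \<in> Arr C \<and> Dom C h = Dom C x \<and> Cod C h = Dom C y \<and> y \<cdot> h = x"
  using E_Arr by (auto simp: full_subcat_def slice_def Hom_def)

lemma Ext_simps [simp]:
  "Dom (Ext B) (x, h, y) = x" "Cod (Ext B) (x, h, y) = y" "Ident (Ext B) x = (x, Ident C (Dom C x), x)"
  "(y', k, z) \<cdot>\<^bsub>Ext B\<^esub> (x, h, y) = (x, k \<cdot> h, z)"
  by (simp_all add: full_subcat_def slice_def)

lemma Ext_Hom: "m \<in> Hom (Ext B) x y \<longleftrightarrow> (\<exists>h. m = (x, h, y) \<and> (x, h, y) \<in> Arr (Ext B))"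
  by (cases m) (auto simp: Hom_def)

lemma Ext_category: "category (Ext B)"
proof unfold_locales
  fix f x y z g assume "f \<in> Hom (Ext B) x y" "g \<in> Hom (Ext B) y z"
  then obtain h k where hk: "f = (x, h, y)" "g = (y, k, z)" "(x, h, y) \<in> Arr (Ext B)" "(y, k, z) \<in> Arr (Ext B)"
    by (auto simp: Ext_Hom)
  have "z \<cdot> (k \<cdot> h) = x"
    using hk(3,4) E_Arr[of z] reassoc[of z k y h] by (simp add: Ext_Arr)
  then show "g \<cdot>\<^bsub>Ext B\<^esub> f \<in> Hom (Ext B) x z"
    using hk by (simp add: Ext_Hom) (simp add: Ext_Arr)
next
  fix f assume "f \<in> Arr (Ext B)" then show "Dom (Ext B) f \<in> Obj (Ext B)" "Cod (Ext B) f \<in> Obj (Ext B)"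
    by (cases f; auto simp: Ext_Arr Ext_Obj)+
next
  fix x assume "x \<in> Obj (Ext B)" then show "Ident (Ext B) x \<in> Hom (Ext B) x x"
    using E_Arr by (simp add: Ext_Hom) (simp add: Ext_Arr Ext_Obj)
next
  fix f x y assume "f \<in> Hom (Ext B) x y"
  then show "f \<cdot>\<^bsub>Ext B\<^esub> Ident (Ext B) x = f" "Ident (Ext B) y \<cdot>\<^bsub>Ext B\<^esub> f = f"
    by (auto simp: Ext_Hom) (simp_all add: Ext_Arr)
next
  fix f x y g z h w assume "f \<in> Hom (Ext B) x y" "g \<in> Hom (Ext B) y z" "h \<in> Hom (Ext B) z w"
  then show "(h \<cdot>\<^bsub>Ext B\<^esub> g) \<cdot>\<^bsub>Ext B\<^esub> f = h \<cdot>\<^bsub>Ext B\<^esub> (g \<cdot>\<^bsub>Ext B\<^esub> f)"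
    by (auto simp: Ext_Hom) (simp add: Ext_Arr)
qed

lemma Ext_iso:
  assumes "(x, h, y) \<in> Arr (Ext B)"
  shows "is_iso (Ext B) (x, h, y) \<longleftrightarrow> is_iso C h"
proof
  assume "is_iso (Ext B) (x, h, y)"
  then obtain g where g: "g \<in> Hom (Ext B) y x" "g \<cdot>\<^bsub>Ext B\<^esub> (x, h, y) = Ident (Ext B) x"
    "(x, h, y) \<cdot>\<^bsub>Ext B\<^esub> g = Ident (Ext B) y"
    by (auto simp: is_iso_def)
  then obtain k where "g = (y, k, x)" "(y, k, x) \<in> Arr (Ext B)" by (auto simp: Ext_Hom)
  then show "is_iso C h"
    using g assms is_isoI[of h k] by (simp add: Ext_Arr)
next
  interpret SB: category "Ext B" by (rule Ext_category)
  assume h: "is_iso C h"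
  define k where "k = inverse_arr h"
  note a = assms[unfolded Ext_Arr]
  have k: "k \<in> Arr C" "Dom C k = Dom C y" "Cod C k = Dom C x" "k \<cdot> h = Ident C (Dom C x)" "h \<cdot> k = Ident C (Dom C y)"
    using inverse_arr[OF h] a by (simp_all add: k_def)
  have "y \<cdot> (h \<cdot> k) = x \<cdot> k"
    using reassoc[of y h x k] a k(1-3) E_Arr[of y] by simp
  then have "x \<cdot> k = y" using k(5) a E_Arr[of y] by simp
  then have "(y, k, x) \<in> Arr (Ext B)" using a k by (simp add: Ext_Arr)
  then show "is_iso (Ext B) (x, h, y)"
    using assms a k by (intro SB.is_isoI[of _ "(y, k, x)"]) simp_all
qed

lemma change_of_base_Obj [simp]: "FObj (change_of_base C p) x = pb_along C p x"
  by (simp add: change_of_base_def)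

text \<open>Unfolds the description of the action on arrows by a unique existence property.\<close>

lemma change_of_base_Arr:
  assumes "(x, h, y) \<in> Arr (Ext (Cod C p))" "p \<in> Arr C"
  obtains k where "FArr (change_of_base C p) (x, h, y) = (pb_along C p x, k, pb_along C p y)"
    "(pb_along C p x, k, pb_along C p y) \<in> Arr (Ext (Dom C p))"
    "pb_top C p y \<cdot> k = h \<cdot> pb_top C p x"
proof -
  note a = assms(1)[unfolded Ext_Arr]
  have px: "is_pullback C x p (pb_top C p x) (pb_along C p x)"
    and py: "is_pullback C y p (pb_top C p y) (pb_along C p y)"
    using a assms(2) by (simp_all add: pb_is_pullback)
  note dx = pullbackD[OF px] and dy = pullbackD[OF py]
  have comm: "y \<cdot> (h \<cdot> pb_top C p x) = p \<cdot> pb_along C p x"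
    using reassoc[of y h x "pb_top C p x"] a dx dy by simp
  have type: "h \<cdot> pb_top C p x \<in> Arr C" "Dom C (h \<cdot> pb_top C p x) = Dom C (pb_along C p x)"
    "Cod C (h \<cdot> pb_top C p x) = Dom C y"
    using a dx by simp_all
  obtain k where k: "k \<in> Arr C" "Dom C k = Dom C (h \<cdot> pb_top C p x)" "Cod C k = Dom C (pb_top C p y)"
    "pb_top C p y \<cdot> k = h \<cdot> pb_top C p x" "pb_along C p y \<cdot> k = pb_along C p x"
    by (rule pullback_lift[OF py type(1) dx(5) type(2,3) dx(8) comm])
  note k = k[unfolded type(2), folded dy(6)]
  have "(THE k. k \<in> Hom C (Dom C (pb_along C p x)) (Dom C (pb_along C p y)) \<and>
      pb_top C p y \<cdot> k = h \<cdot> pb_top C p x \<and> pb_along C p y \<cdot> k = pb_along C p x) = k"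
  proof (rule the_equality)
    fix l assume l: "l \<in> Hom C (Dom C (pb_along C p x)) (Dom C (pb_along C p y)) \<and>
      pb_top C p y \<cdot> l = h \<cdot> pb_top C p x \<and> pb_along C p y \<cdot> l = pb_along C p x"
    show "l = k"
      by (rule pullback_eqI[OF py]) (use l k dy in \<open>simp_all add: Hom_def\<close>)
  qed (use k in \<open>simp add: Hom_def\<close>)
  moreover have "(pb_along C p x, k, pb_along C p y) \<in> Arr (Ext (Dom C p))"
    using k a dx dy assms(2) by (simp add: Ext_Arr pb_along_E)
  ultimately show thesis
    using that[of k] k by (simp add: change_of_base_def)
qed

lemma change_of_base_functor:
  assumes p: "p \<in> Arr C"
  shows "cat_functor (Ext (Cod C p)) (Ext (Dom C p)) (change_of_base C p)"
proof -
  let ?F = "change_of_base C p"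
  interpret S1: category "Ext (Cod C p)" by (rule Ext_category)
  interpret S2: category "Ext (Dom C p)" by (rule Ext_category)
  have pb: "is_pullback C x p (pb_top C p x) (pb_along C p x)" if "x \<in> Obj (Ext (Cod C p))" for x
    using that p by (auto simp: Ext_Obj intro: pb_is_pullback)
  show ?thesis
  proof unfold_locales
    fix x assume "x \<in> Obj (Ext (Cod C p))"
    then show "FObj ?F x \<in> Obj (Ext (Dom C p))"
      using p pullbackD[OF pb[of x]] by (simp add: Ext_Obj pb_along_E)
  next
    fix f x y assume "f \<in> Hom (Ext (Cod C p)) x y"
    then obtain h where "f = (x, h, y)" "(x, h, y) \<in> Arr (Ext (Cod C p))" by (auto simp: Ext_Hom)
    then show "FArr ?F f \<in> Hom (Ext (Dom C p)) (FObj ?F x) (FObj ?F y)"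
      using p by (elim change_of_base_Arr) (auto simp: Ext_Hom)
  next
    fix x assume x: "x \<in> Obj (Ext (Cod C p))"
    have i: "(x, Ident C (Dom C x), x) \<in> Arr (Ext (Cod C p))"
      using S1.ident_arr(1)[OF x] by simp
    obtain k where k: "FArr ?F (x, Ident C (Dom C x), x) = (pb_along C p x, k, pb_along C p x)"
      "(pb_along C p x, k, pb_along C p x) \<in> Arr (Ext (Dom C p))"
      "pb_top C p x \<cdot> k = Ident C (Dom C x) \<cdot> pb_top C p x"
      by (rule change_of_base_Arr[OF i p])
    have "k = Ident C (Dom C (pb_along C p x))"
      by (rule pullback_eqI[OF pb[OF x]])
        (use k pullbackD[OF pb[OF x]] in \<open>auto simp: Ext_Arr\<close>)
    then show "FArr ?F (Ident (Ext (Cod C p)) x) = Ident (Ext (Dom C p)) (FObj ?F x)"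
      using k by simp
  next
    fix f x y g z assume "f \<in> Hom (Ext (Cod C p)) x y" "g \<in> Hom (Ext (Cod C p)) y z"
    then obtain h h' where f: "f = (x, h, y)" "(x, h, y) \<in> Arr (Ext (Cod C p))"
      and g: "g = (y, h', z)" "(y, h', z) \<in> Arr (Ext (Cod C p))" by (auto simp: Ext_Hom)
    have gf: "(x, h' \<cdot> h, z) \<in> Arr (Ext (Cod C p))"
      using S1.comp_arr(1)[OF f(2) g(2)] by simp
    obtain k where k: "FArr ?F (x, h, y) = (pb_along C p x, k, pb_along C p y)"
      "(pb_along C p x, k, pb_along C p y) \<in> Arr (Ext (Dom C p))"
      "pb_top C p y \<cdot> k = h \<cdot> pb_top C p x"
      by (rule change_of_base_Arr[OF f(2) p])
    obtain k' where k': "FArr ?F (y, h', z) = (pb_along C p y, k', pb_along C p z)"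
      "(pb_along C p y, k', pb_along C p z) \<in> Arr (Ext (Dom C p))"
      "pb_top C p z \<cdot> k' = h' \<cdot> pb_top C p y"
      by (rule change_of_base_Arr[OF g(2) p])
    obtain l where l: "FArr ?F (x, h' \<cdot> h, z) = (pb_along C p x, l, pb_along C p z)"
      "(pb_along C p x, l, pb_along C p z) \<in> Arr (Ext (Dom C p))"
      "pb_top C p z \<cdot> l = (h' \<cdot> h) \<cdot> pb_top C p x"
      by (rule change_of_base_Arr[OF gf p])
    have o: "x \<in> Obj (Ext (Cod C p))" "y \<in> Obj (Ext (Cod C p))" "z \<in> Obj (Ext (Cod C p))"
      using f g by (auto simp: Ext_Arr Ext_Obj)
    note d = pullbackD[OF pb[OF o(1)]] pullbackD[OF pb[OF o(2)]] pullbackD[OF pb[OF o(3)]]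
    note k2 = k(2)[unfolded Ext_Arr] k'(2)[unfolded Ext_Arr] l(2)[unfolded Ext_Arr] f(2)[unfolded Ext_Arr] g(2)[unfolded Ext_Arr]
    have top: "pb_top C p z \<cdot> (k' \<cdot> k) = (h' \<cdot> h) \<cdot> pb_top C p x"
    proof -
      have "pb_top C p z \<cdot> (k' \<cdot> k) = (h' \<cdot> pb_top C p y) \<cdot> k"
        by (rule reassoc[OF k'(3)]) (use k2 d in simp_all)
      also have "\<dots> = h' \<cdot> (pb_top C p y \<cdot> k)" by (rule assoc) (use k2 d in simp_all)
      also have "\<dots> = (h' \<cdot> h) \<cdot> pb_top C p x" unfolding k(3) by (rule assoc[symmetric]) (use k2 d in simp_all)
      finally show ?thesis .
    qed
    have along: "pb_along C p z \<cdot> (k' \<cdot> k) = pb_along C p x"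
    proof -
      have "pb_along C p z \<cdot> (k' \<cdot> k) = pb_along C p y \<cdot> k"
        by (rule reassoc) (use k2 d in simp_all)
      then show ?thesis using k2 by simp
    qed
    have "l = k' \<cdot> k"
      by (rule pullback_eqI[OF pb[OF o(3)]]) (use k2 d along top l(3) in simp_all)
    then show "FArr ?F (g \<cdot>\<^bsub>Ext (Cod C p)\<^esub> f) = FArr ?F g \<cdot>\<^bsub>Ext (Dom C p)\<^esub> FArr ?F f"
      using f g k k' l by simp
  qed
qed

text \<open>The functor \<open>f\<^sub>!\<close> of composition with \<open>f\<close>, left adjoint to \<open>f\<^sup>*\<close> when \<open>f\<close> is an extension.\<close>

definition pushforward :: "'a \<Rightarrow> ('a, 'a \<times> 'a \<times> 'a, 'a, 'a \<times> 'a \<times> 'a) funct" where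
  "pushforward f = \<lparr>FObj = (\<lambda>x. f \<cdot> x), FArr = (\<lambda>(x, h, y). (f \<cdot> x, h, f \<cdot> y))\<rparr>"

lemma pushforward_simps [simp]:
  "FObj (pushforward f) x = f \<cdot> x" "FArr (pushforward f) (x, h, y) = (f \<cdot> x, h, f \<cdot> y)"
  by (simp_all add: pushforward_def)

lemma pushforward_Arr:
  assumes "f \<in> E" "(x, h, y) \<in> Arr (Ext (Dom C f))"
  shows "(f \<cdot> x, h, f \<cdot> y) \<in> Arr (Ext (Cod C f))"
  using assms E_Arr[of f] E_Arr[of x] E_Arr[of y] by (auto simp: Ext_Arr E_comp)

lemma pushforward_functor:
  assumes f: "f \<in> E"
  shows "cat_functor (Ext (Dom C f)) (Ext (Cod C f)) (pushforward f)"
proof -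
  interpret S1: category "Ext (Cod C f)" by (rule Ext_category)
  interpret S2: category "Ext (Dom C f)" by (rule Ext_category)
  show ?thesis
    by unfold_locales
      (use f E_Arr in \<open>auto simp: Ext_Hom Ext_Obj E_comp pushforward_Arr\<close>)
qed

text \<open>The counit at \<open>y\<close> is the pullback projection to the domain of \<open>y\<close>; the unit at \<open>x\<close> is the graph of
\<open>x\<close>, the arrow into the pullback of \<open>f \<cdot> x\<close> along \<open>f\<close> with components the identity and \<open>x\<close>.\<close>

lemma change_of_base_adjunction:
  assumes f: "f \<in> E"
  obtains \<eta> \<epsilon> where "adjunction (Ext (Dom C f)) (Ext (Cod C f)) (pushforward f) (change_of_base C f) \<eta> \<epsilon>"
proof -
  let ?A = "Ext (Dom C f)" and ?B = "Ext (Cod C f)" and ?L = "pushforward f" and ?U = "change_of_base C f"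
  interpret L: cat_functor ?A ?B ?L using f by (rule pushforward_functor)
  interpret U: cat_functor ?B ?A ?U using E_Arr[OF f] by (rule change_of_base_functor)
  have fA: "f \<in> Arr C" using f by (rule E_Arr)
  have pb: "is_pullback C y f (pb_top C f y) (pb_along C f y)" if "y \<in> Obj ?B" for y
    using that fA by (auto simp: Ext_Obj intro: pb_is_pullback)
  have "\<exists>e. \<forall>x\<in>Obj ?A. e x \<in> Arr C \<and> Dom C (e x) = Dom C x \<and> Cod C (e x) = Dom C (pb_along C f (f \<cdot> x)) \<and>
      pb_top C f (f \<cdot> x) \<cdot> e x = Ident C (Dom C x) \<and> pb_along C f (f \<cdot> x) \<cdot> e x = x"
  proof (rule bchoice, rule ballI)
    fix x assume x: "x \<in> Obj ?A"
    have x': "x \<in> Arr C" "Cod C x = Dom C f" using x E_Arr by (auto simp: Ext_Obj)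
    have P: "is_pullback C (f \<cdot> x) f (pb_top C f (f \<cdot> x)) (pb_along C f (f \<cdot> x))"
      using pb[of "f \<cdot> x"] L.FObj_Obj[OF x] by simp
    note d = pullbackD[OF P]
    have prem: "Ident C (Dom C x) \<in> Arr C" "Dom C (Ident C (Dom C x)) = Dom C x"
      "Cod C (Ident C (Dom C x)) = Dom C (f \<cdot> x)" "(f \<cdot> x) \<cdot> Ident C (Dom C x) = f \<cdot> x"
      using x' fA by simp_all
    obtain e where "e \<in> Arr C" "Dom C e = Dom C (Ident C (Dom C x))" "Cod C e = Dom C (pb_top C f (f \<cdot> x))"
      "pb_top C f (f \<cdot> x) \<cdot> e = Ident C (Dom C x)" "pb_along C f (f \<cdot> x) \<cdot> e = x"
      by (rule pullback_lift[OF P prem(1) x'(1) prem(2,3) x'(2) prem(4)])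
    then show "\<exists>e. e \<in> Arr C \<and> Dom C e = Dom C x \<and> Cod C e = Dom C (pb_along C f (f \<cdot> x)) \<and>
      pb_top C f (f \<cdot> x) \<cdot> e = Ident C (Dom C x) \<and> pb_along C f (f \<cdot> x) \<cdot> e = x"
      using prem d by (intro exI[of _ e]) simp
  qed
  then obtain e where "\<forall>x\<in>Obj ?A. e x \<in> Arr C \<and> Dom C (e x) = Dom C x \<and> Cod C (e x) = Dom C (pb_along C f (f \<cdot> x)) \<and>
      pb_top C f (f \<cdot> x) \<cdot> e x = Ident C (Dom C x) \<and> pb_along C f (f \<cdot> x) \<cdot> e x = x" ..
  then have e: "\<And>x. x \<in> Obj ?A \<Longrightarrow> e x \<in> Arr C" "\<And>x. x \<in> Obj ?A \<Longrightarrow> Dom C (e x) = Dom C x"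
    "\<And>x. x \<in> Obj ?A \<Longrightarrow> Cod C (e x) = Dom C (pb_along C f (f \<cdot> x))"
    "\<And>x. x \<in> Obj ?A \<Longrightarrow> pb_top C f (f \<cdot> x) \<cdot> e x = Ident C (Dom C x)"
    "\<And>x. x \<in> Obj ?A \<Longrightarrow> pb_along C f (f \<cdot> x) \<cdot> e x = x" by simp_all
  define \<eta> where "\<eta> = (\<lambda>x. (x, e x, pb_along C f (f \<cdot> x)))"
  define \<epsilon> where "\<epsilon> = (\<lambda>y. (f \<cdot> pb_along C f y, pb_top C f y, y))"
  have \<eta>_Arr: "\<eta> x \<in> Arr ?A" if x: "x \<in> Obj ?A" for x
    using x e[OF x] U.FObj_Obj[OF L.FObj_Obj[OF x]] by (simp add: \<eta>_def Ext_Arr Ext_Obj)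
  have \<epsilon>_Arr: "\<epsilon> y \<in> Arr ?B" if y: "y \<in> Obj ?B" for y
    using y pullbackD[OF pb[OF y]] L.FObj_Obj[OF U.FObj_Obj[OF y]]
    by (simp add: \<epsilon>_def Ext_Arr Ext_Obj)
  have "adjunction ?A ?B ?L ?U \<eta> \<epsilon>"
    unfolding adjunction_def
  proof (intro conjI ballI)
    show "nat_trans ?A ?A id_funct (?U \<circ>\<^sub>F ?L) \<eta>"
    proof (rule nat_transI)
      fix m assume m: "m \<in> Arr ?A"
      obtain x h y where xhy: "m = (x, h, y)" by (cases m)
      have m': "(x, h, y) \<in> Arr ?A" and o: "x \<in> Obj ?A" "y \<in> Obj ?A" using m by (auto simp: xhy Ext_Arr Ext_Obj)
      obtain k where k: "FArr ?U (f \<cdot> x, h, f \<cdot> y) = (pb_along C f (f \<cdot> x), k, pb_along C f (f \<cdot> y))"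
        "(pb_along C f (f \<cdot> x), k, pb_along C f (f \<cdot> y)) \<in> Arr ?A"
        "pb_top C f (f \<cdot> y) \<cdot> k = h \<cdot> pb_top C f (f \<cdot> x)"
        using change_of_base_Arr[OF pushforward_Arr[OF f m'] fA] by blast
      have Px: "is_pullback C (f \<cdot> x) f (pb_top C f (f \<cdot> x)) (pb_along C f (f \<cdot> x))"
        using pb[of "f \<cdot> x"] L.FObj_Obj[OF o(1)] by simp
      have Py: "is_pullback C (f \<cdot> y) f (pb_top C f (f \<cdot> y)) (pb_along C f (f \<cdot> y))"
        using pb[of "f \<cdot> y"] L.FObj_Obj[OF o(2)] by simp
      have a: "x \<in> Arr C" "y \<in> Arr C" "h \<in> Arr C" "Dom C h = Dom C x" "Cod C h = Dom C y" "y \<cdot> h = x"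
        "Cod C x = Dom C f" "Cod C y = Dom C f"
        using m' E_Arr by (auto simp: Ext_Arr)
      note b = pullbackD(4-8)[OF Px] pullbackD(4-8)[OF Py] e(1-3)[OF o(1)] e(1-3)[OF o(2)]
      have kA: "k \<in> Arr C" "Dom C k = Dom C (pb_along C f (f \<cdot> x))" "Cod C k = Dom C (pb_along C f (f \<cdot> y))"
        "pb_along C f (f \<cdot> y) \<cdot> k = pb_along C f (f \<cdot> x)"
        using k(2) by (auto simp: Ext_Arr)
      have "k \<cdot> e x = e y \<cdot> h"
      proof (rule pullback_eqI[OF Py])
        show "pb_top C f (f \<cdot> y) \<cdot> (k \<cdot> e x) = pb_top C f (f \<cdot> y) \<cdot> (e y \<cdot> h)"
          using k(3)[THEN reassoc, of "e x"] e(4)[OF o(2), THEN reassoc, of h] e(4)[OF o(1)] a b kA fA by simp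
        show "pb_along C f (f \<cdot> y) \<cdot> (k \<cdot> e x) = pb_along C f (f \<cdot> y) \<cdot> (e y \<cdot> h)"
          using kA(4)[THEN reassoc, of "e x"] e(5)[OF o(2), THEN reassoc, of h] e(5)[OF o(1)] a b kA fA by simp
      qed (use a b kA in simp_all)
      then show "FArr (?U \<circ>\<^sub>F ?L) m \<cdot>\<^bsub>?A\<^esub> \<eta> (Dom ?A m) = \<eta> (Cod ?A m) \<cdot>\<^bsub>?A\<^esub> FArr id_funct m"
        using k by (simp add: xhy \<eta>_def)
    qed (use \<eta>_Arr cat_functor_id[OF Ext_category] cat_functor_comp[OF L.cat_functor_axioms U.cat_functor_axioms]
        in \<open>auto simp: Hom_def \<eta>_def\<close>)
    show "nat_trans ?B ?B (?L \<circ>\<^sub>F ?U) id_funct \<epsilon>"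
    proof (rule nat_transI)
      fix m assume m: "m \<in> Arr ?B"
      obtain x h y where xhy: "m = (x, h, y)" by (cases m)
      have m': "(x, h, y) \<in> Arr ?B" using m by (simp add: xhy)
      obtain k where k: "FArr ?U (x, h, y) = (pb_along C f x, k, pb_along C f y)"
        "pb_top C f y \<cdot> k = h \<cdot> pb_top C f x"
        using change_of_base_Arr[OF m' fA] by blast
      then show "FArr id_funct m \<cdot>\<^bsub>?B\<^esub> \<epsilon> (Dom ?B m) = \<epsilon> (Cod ?B m) \<cdot>\<^bsub>?B\<^esub> FArr (?L \<circ>\<^sub>F ?U) m"
        by (simp add: xhy \<epsilon>_def)
    qed (use \<epsilon>_Arr cat_functor_id[OF Ext_category] cat_functor_comp[OF U.cat_functor_axioms L.cat_functor_axioms]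
        in \<open>auto simp: Hom_def \<epsilon>_def\<close>)
    fix x assume x: "x \<in> Obj ?A"
    show "\<epsilon> (FObj ?L x) \<cdot>\<^bsub>?B\<^esub> FArr ?L (\<eta> x) = Ident ?B (FObj ?L x)"
      using e[OF x] fA x E_Arr by (simp add: \<epsilon>_def \<eta>_def Ext_Obj)
  next
    fix y assume y: "y \<in> Obj ?B"
    let ?c = "pb_along C f y"
    have c: "?c \<in> Obj ?A" using U.FObj_Obj[OF y] by simp
    have m: "(f \<cdot> ?c, pb_top C f y, y) \<in> Arr ?B" using \<epsilon>_Arr[OF y] by (simp add: \<epsilon>_def)
    obtain k where k: "FArr ?U (f \<cdot> ?c, pb_top C f y, y) = (pb_along C f (f \<cdot> ?c), k, ?c)"
      "(pb_along C f (f \<cdot> ?c), k, ?c) \<in> Arr ?A"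
      "pb_top C f y \<cdot> k = pb_top C f y \<cdot> pb_top C f (f \<cdot> ?c)"
      using change_of_base_Arr[OF m fA] by blast
    have kA: "k \<in> Arr C" "Dom C k = Dom C (pb_along C f (f \<cdot> ?c))" "Cod C k = Dom C ?c" "?c \<cdot> k = pb_along C f (f \<cdot> ?c)"
      using k(2) by (auto simp: Ext_Arr)
    have P: "is_pullback C (f \<cdot> ?c) f (pb_top C f (f \<cdot> ?c)) (pb_along C f (f \<cdot> ?c))"
      using pb[of "f \<cdot> ?c"] L.FObj_Obj[OF c] by simp
    note b = pullbackD(4-8)[OF P] pullbackD(4-8)[OF pb[OF y]] e(1-3)[OF c]
    have "k \<cdot> e ?c = Ident C (Dom C ?c)"
    proof (rule pullback_eqI[OF pb[OF y]])
      show "pb_top C f y \<cdot> (k \<cdot> e ?c) = pb_top C f y \<cdot> Ident C (Dom C ?c)"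
        using k(3)[THEN reassoc, of "e ?c"] e(4)[OF c] b kA fA by simp
      show "?c \<cdot> (k \<cdot> e ?c) = ?c \<cdot> Ident C (Dom C ?c)"
        using kA(4)[THEN reassoc, of "e ?c"] e(5)[OF c] b kA fA by simp
    qed (use b kA in simp_all)
    then show "FArr ?U (\<epsilon> y) \<cdot>\<^bsub>?A\<^esub> \<eta> (FObj ?U y) = Ident ?A (FObj ?U y)"
      using k by (simp add: \<epsilon>_def \<eta>_def)
  qed (use L.cat_functor_axioms U.cat_functor_axioms in auto)
  then show thesis by (rule that)
qed

end

section \<open>Extensions through which a monadic extension factors\<close>

context extension_class
begin

abbreviation mid :: "'a \<times> 'a \<times> 'a \<Rightarrow> 'a" where
  "mid m \<equiv> fst (snd m)"

lemma functor_into_Ext: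
  assumes "cat_functor D (Ext B) F" "h \<in> Arr D"
  shows "FArr F h = (FObj F (Dom D h), mid (FArr F h), FObj F (Cod D h))"
    "mid (FArr F h) \<in> Arr C" "Dom C (mid (FArr F h)) = Dom C (FObj F (Dom D h))"
    "Cod C (mid (FArr F h)) = Dom C (FObj F (Cod D h))"
    "FObj F (Cod D h) \<cdot> mid (FArr F h) = FObj F (Dom D h)"
proof -
  interpret F: cat_functor D "Ext B" F by fact
  obtain x k y where m: "FArr F h = (x, k, y)" by (cases "FArr F h")
  have xy: "x = FObj F (Dom D h)" "y = FObj F (Cod D h)"
    using F.F_arr(2,3)[OF assms(2)] by (simp_all add: m)
  show "FArr F h = (FObj F (Dom D h), mid (FArr F h), FObj F (Cod D h))"
    "mid (FArr F h) \<in> Arr C" "Dom C (mid (FArr F h)) = Dom C (FObj F (Dom D h))"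
    "Cod C (mid (FArr F h)) = Dom C (FObj F (Cod D h))"
    "FObj F (Cod D h) \<cdot> mid (FArr F h) = FObj F (Dom D h)"
    using F.F_arr(1)[OF assms(2)] by (simp_all add: m Ext_Arr flip: xy)
qed

text \<open>The functor \<open>V\<close> is a pullback of \<open>M\<close> along \<open>p\<close>, exhibited by a natural family of pullback squares with
top edges \<open>\<tau>\<close>. Since pullback squares are unique up to isomorphism, so is \<open>V\<close>. Identities between
composites of change of base functors are obtained from this uniqueness, without computing with the
chosen pullbacks.\<close>

definition cartesian_over ::
  "('p, 'b) cat \<Rightarrow> 'a \<Rightarrow> ('p, 'b, 'a, 'a \<times> 'a \<times> 'a) funct \<Rightarrow> ('p, 'b, 'a, 'a \<times> 'a \<times> 'a) funct \<Rightarrow>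
   ('p \<Rightarrow> 'a) \<Rightarrow> bool" where
  "cartesian_over D p M V \<tau> \<longleftrightarrow>
     cat_functor D (Ext (Cod C p)) M \<and> cat_functor D (Ext (Dom C p)) V \<and>
     (\<forall>d \<in> Obj D. is_pullback C (FObj M d) p (\<tau> d) (FObj V d)) \<and>
     (\<forall>h \<in> Arr D. mid (FArr M h) \<cdot> \<tau> (Dom D h) = \<tau> (Cod D h) \<cdot> mid (FArr V h))"

lemma cartesian_over_unique:
  assumes V: "cartesian_over D p M V \<tau>" and W: "cartesian_over D p M W \<rho>"
  obtains \<sigma> where "nat_iso D (Ext (Dom C p)) V W \<sigma>"
proof -
  have M: "cat_functor D (Ext (Cod C p)) M" and VF: "cat_functor D (Ext (Dom C p)) V"
    and WF: "cat_functor D (Ext (Dom C p)) W"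
    using V W by (simp_all add: cartesian_over_def)
  interpret M: cat_functor D "Ext (Cod C p)" M by (rule M)
  interpret V: cat_functor D "Ext (Dom C p)" V by (rule VF)
  interpret W: cat_functor D "Ext (Dom C p)" W by (rule WF)
  have pbV: "is_pullback C (FObj M d) p (\<tau> d) (FObj V d)"
    and pbW: "is_pullback C (FObj M d) p (\<rho> d) (FObj W d)" if "d \<in> Obj D" for d
    using V W that by (auto simp: cartesian_over_def)
  have natV: "mid (FArr M h) \<cdot> \<tau> (Dom D h) = \<tau> (Cod D h) \<cdot> mid (FArr V h)"
    and natW: "mid (FArr M h) \<cdot> \<rho> (Dom D h) = \<rho> (Cod D h) \<cdot> mid (FArr W h)" if "h \<in> Arr D" for h
    using V W that by (auto simp: cartesian_over_def)
  have "\<exists>s. \<forall>d\<in>Obj D. s d \<in> Arr C \<and> Dom C (s d) = Dom C (\<tau> d) \<and> Cod C (s d) = Dom C (\<rho> d) \<and>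
      \<rho> d \<cdot> s d = \<tau> d \<and> FObj W d \<cdot> s d = FObj V d"
  proof (rule bchoice, rule ballI)
    fix d assume d: "d \<in> Obj D"
    note v = pullbackD[OF pbV[OF d]]
    obtain s where "s \<in> Arr C" "Dom C s = Dom C (\<tau> d)" "Cod C s = Dom C (\<rho> d)"
      "\<rho> d \<cdot> s = \<tau> d" "FObj W d \<cdot> s = FObj V d"
      by (rule pullback_lift[OF pbW[OF d] v(4,5) v(6)[symmetric] v(7,8,9)])
    then show "\<exists>s. s \<in> Arr C \<and> Dom C s = Dom C (\<tau> d) \<and> Cod C s = Dom C (\<rho> d) \<and>
      \<rho> d \<cdot> s = \<tau> d \<and> FObj W d \<cdot> s = FObj V d"
      by (intro exI[of _ s]) simp
  qed
  then obtain s where "\<forall>d\<in>Obj D. s d \<in> Arr C \<and> Dom C (s d) = Dom C (\<tau> d) \<and> Cod C (s d) = Dom C (\<rho> d) \<and>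
      \<rho> d \<cdot> s d = \<tau> d \<and> FObj W d \<cdot> s d = FObj V d" ..
  then have s: "\<And>d. d \<in> Obj D \<Longrightarrow> s d \<in> Arr C" "\<And>d. d \<in> Obj D \<Longrightarrow> Dom C (s d) = Dom C (\<tau> d)"
    "\<And>d. d \<in> Obj D \<Longrightarrow> Cod C (s d) = Dom C (\<rho> d)" "\<And>d. d \<in> Obj D \<Longrightarrow> \<rho> d \<cdot> s d = \<tau> d"
    "\<And>d. d \<in> Obj D \<Longrightarrow> FObj W d \<cdot> s d = FObj V d"
    by simp_all
  define \<sigma> where "\<sigma> = (\<lambda>d. (FObj V d, s d, FObj W d))"
  have \<sigma>_Arr: "(FObj V d, s d, FObj W d) \<in> Arr (Ext (Dom C p))" if d: "d \<in> Obj D" for d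
    using s[OF d] V.FObj_Obj[OF d] W.FObj_Obj[OF d] pullbackD(6)[OF pbV[OF d]] pullbackD(6)[OF pbW[OF d]]
    by (simp add: Ext_Arr Ext_Obj)
  have "nat_iso D (Ext (Dom C p)) V W \<sigma>"
    unfolding nat_iso_def
  proof (intro conjI ballI nat_transI)
    fix h assume h: "h \<in> Arr D"
    define d d' where "d = Dom D h" and "d' = Cod D h"
    have d: "d \<in> Obj D" "d' \<in> Obj D" using h by (simp_all add: d_def d'_def)
    note Mh = functor_into_Ext[OF M h, folded d_def d'_def]
      and Vh = functor_into_Ext[OF VF h, folded d_def d'_def]
      and Wh = functor_into_Ext[OF WF h, folded d_def d'_def]
    note a = pullbackD(4-8)[OF pbV[OF d(1)]] pullbackD(4-8)[OF pbV[OF d(2)]]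
      pullbackD(4-8)[OF pbW[OF d(1)]] pullbackD(4-8)[OF pbW[OF d(2)]]
    have eq: "mid (FArr W h) \<cdot> s d = s d' \<cdot> mid (FArr V h)"
    proof (rule pullback_eqI[OF pbW[OF d(2)]])
      have "\<rho> d' \<cdot> (mid (FArr W h) \<cdot> s d) = mid (FArr M h) \<cdot> (\<rho> d \<cdot> s d)"
        using reassoc[OF natW[OF h, folded d_def d'_def, symmetric], of "s d"] Mh(2-4) Wh(2-4) a s[OF d(1)]
        by simp
      also have "\<dots> = \<rho> d' \<cdot> (s d' \<cdot> mid (FArr V h))"
        using reassoc[OF s(4)[OF d(2)], of "mid (FArr V h)"] natV[OF h, folded d_def d'_def]
          Vh(2-4) a s(1-3)[OF d(2)] s(4)[OF d(1)] by simp
      finally show "\<rho> d' \<cdot> (mid (FArr W h) \<cdot> s d) = \<rho> d' \<cdot> (s d' \<cdot> mid (FArr V h))" .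
      have "FObj W d' \<cdot> (mid (FArr W h) \<cdot> s d) = FObj V d"
        using reassoc[OF Wh(5), of "s d"] Wh(2-4) a s[OF d(1)] by simp
      moreover have "FObj W d' \<cdot> (s d' \<cdot> mid (FArr V h)) = FObj V d"
        using reassoc[OF s(5)[OF d(2)], of "mid (FArr V h)"] Vh(2-5) a s(1-3)[OF d(2)] by simp
      ultimately show "FObj W d' \<cdot> (mid (FArr W h) \<cdot> s d) = FObj W d' \<cdot> (s d' \<cdot> mid (FArr V h))"
        by simp
    qed (use a Vh(2-4) Wh(2-4) s(1-3)[OF d(1)] s(1-3)[OF d(2)] in simp_all)
    have "(FObj W d, mid (FArr W h), FObj W d') \<cdot>\<^bsub>Ext (Dom C p)\<^esub> \<sigma> d =
        \<sigma> d' \<cdot>\<^bsub>Ext (Dom C p)\<^esub> (FObj V d, mid (FArr V h), FObj V d')"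
      using eq by (simp add: \<sigma>_def)
    then show "FArr W h \<cdot>\<^bsub>Ext (Dom C p)\<^esub> \<sigma> (Dom D h) = \<sigma> (Cod D h) \<cdot>\<^bsub>Ext (Dom C p)\<^esub> FArr V h"
      by (fold d_def d'_def Wh(1) Vh(1))
  next
    fix d assume d: "d \<in> Obj D"
    show "\<sigma> d \<in> Hom (Ext (Dom C p)) (FObj V d) (FObj W d)"
      using \<sigma>_Arr[OF d] by (simp add: \<sigma>_def Hom_def)
    have "is_iso C (s d)"
      by (rule pullback_comparison_iso[OF pbV[OF d] pbW[OF d] s[OF d]])
    then show "is_iso (Ext (Dom C p)) (\<sigma> d)"
      using Ext_iso[OF \<sigma>_Arr[OF d]] by (simp add: \<sigma>_def)
  qed (use VF WF in auto)
  then show thesis by (rule that)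
qed

lemma cartesian_over_change_of_base:
  assumes p: "p \<in> Arr C"
  shows "cartesian_over (Ext (Cod C p)) p id_funct (change_of_base C p) (pb_top C p)"
  unfolding cartesian_over_def
proof (intro conjI ballI)
  show "is_pullback C (FObj id_funct d) p (pb_top C p d) (FObj (change_of_base C p) d)"
    if "d \<in> Obj (Ext (Cod C p))" for d
    using that p by (simp add: Ext_Obj pb_is_pullback)
  fix m assume m: "m \<in> Arr (Ext (Cod C p))"
  obtain x h y where xhy: "m = (x, h, y)" by (cases m)
  show "mid (FArr id_funct m) \<cdot> pb_top C p (Dom (Ext (Cod C p)) m) =
      pb_top C p (Cod (Ext (Cod C p)) m) \<cdot> mid (FArr (change_of_base C p) m)"
    by (rule change_of_base_Arr[OF m[unfolded xhy] p]) (simp add: xhy)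
qed (use p change_of_base_functor cat_functor_id[OF Ext_category] in auto)

lemma cartesian_over_precomp:
  assumes "cartesian_over D p M V \<tau>" "cat_functor D' D F"
  shows "cartesian_over D' p (M \<circ>\<^sub>F F) (V \<circ>\<^sub>F F) (\<lambda>d. \<tau> (FObj F d))"
proof -
  interpret F: cat_functor D' D F by fact
  have M: "cat_functor D (Ext (Cod C p)) M" and V: "cat_functor D (Ext (Dom C p)) V"
    and pb: "\<And>d. d \<in> Obj D \<Longrightarrow> is_pullback C (FObj M d) p (\<tau> d) (FObj V d)"
    and nat: "\<And>h. h \<in> Arr D \<Longrightarrow> mid (FArr M h) \<cdot> \<tau> (Dom D h) = \<tau> (Cod D h) \<cdot> mid (FArr V h)"
    using assms(1) by (simp_all add: cartesian_over_def)
  show ?thesis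
    unfolding cartesian_over_def
  proof (intro conjI ballI)
    show "cat_functor D' (Ext (Cod C p)) (M \<circ>\<^sub>F F)" "cat_functor D' (Ext (Dom C p)) (V \<circ>\<^sub>F F)"
      by (rule cat_functor_comp[OF assms(2)], rule M V)+
    show "mid (FArr (M \<circ>\<^sub>F F) h) \<cdot> \<tau> (FObj F (Dom D' h)) = \<tau> (FObj F (Cod D' h)) \<cdot> mid (FArr (V \<circ>\<^sub>F F) h)"
      if h: "h \<in> Arr D'" for h
      using nat[OF F.F_arr(1)[OF h]] F.F_arr(2,3)[OF h] by simp
  qed (simp add: pb)
qed

lemma cartesian_over_paste:
  assumes V: "cartesian_over D f M V \<tau>" and W: "cartesian_over D t V W \<rho>"
    and f: "f \<in> Arr C" and t: "t \<in> Arr C" "Cod C t = Dom C f"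
  shows "cartesian_over D (f \<cdot> t) M W (\<lambda>d. \<tau> d \<cdot> \<rho> d)"
  unfolding cartesian_over_def
proof (intro conjI ballI)
  have M': "cat_functor D (Ext (Cod C f)) M" and V': "cat_functor D (Ext (Dom C f)) V"
    and W': "cat_functor D (Ext (Dom C t)) W"
    using V W t by (simp_all add: cartesian_over_def)
  then show "cat_functor D (Ext (Cod C (f \<cdot> t))) M" "cat_functor D (Ext (Dom C (f \<cdot> t))) W"
    using f t by simp_all
  interpret M: cat_functor D "Ext (Cod C f)" M by (rule M')
  have pbV: "is_pullback C (FObj M d) f (\<tau> d) (FObj V d)"
    and pbW: "is_pullback C (FObj V d) t (\<rho> d) (FObj W d)" if "d \<in> Obj D" for d
    using V W that by (auto simp: cartesian_over_def)
  show "is_pullback C (FObj M d) (f \<cdot> t) (\<tau> d \<cdot> \<rho> d) (FObj W d)" if "d \<in> Obj D" for d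
    by (rule pullback_paste[OF pbV[OF that] pbW[OF that]])
  fix h assume h: "h \<in> Arr D"
  define d d' where "d = Dom D h" and "d' = Cod D h"
  have d: "d \<in> Obj D" "d' \<in> Obj D" using h by (simp_all add: d_def d'_def)
  note Mh = functor_into_Ext[OF M' h, folded d_def d'_def]
    and Vh = functor_into_Ext[OF V' h, folded d_def d'_def]
    and Wh = functor_into_Ext[OF W' h, folded d_def d'_def]
  note a = pullbackD(4-8)[OF pbV[OF d(1)]] pullbackD(4-8)[OF pbV[OF d(2)]]
    pullbackD(4-8)[OF pbW[OF d(1)]] pullbackD(4-8)[OF pbW[OF d(2)]]
  have natV: "mid (FArr M h) \<cdot> \<tau> d = \<tau> d' \<cdot> mid (FArr V h)"
    and natW: "mid (FArr V h) \<cdot> \<rho> d = \<rho> d' \<cdot> mid (FArr W h)"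
    using V W h by (simp_all add: cartesian_over_def d_def d'_def)
  show "mid (FArr M h) \<cdot> (\<tau> (Dom D h) \<cdot> \<rho> (Dom D h)) =
      (\<tau> (Cod D h) \<cdot> \<rho> (Cod D h)) \<cdot> mid (FArr W h)"
    unfolding d_def[symmetric] d'_def[symmetric]
    using reassoc[OF natV, of "\<rho> d"] natW Mh(2-4) Vh(2-4) Wh(2-4) a by simp
qed

lemma comp_funct_id: "id_funct \<circ>\<^sub>F F = F"
  by (cases F) (simp add: comp_funct_def id_funct_def)

lemma comp_funct_assoc: "(G \<circ>\<^sub>F F) \<circ>\<^sub>F K = G \<circ>\<^sub>F (F \<circ>\<^sub>F K)"
  by (simp add: comp_funct_def)

lemma change_of_base_comp:
  assumes f: "f \<in> Arr C" and t: "t \<in> Arr C" "Cod C t = Dom C f"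
  obtains \<sigma> where "nat_iso (Ext (Cod C f)) (Ext (Dom C t)) (change_of_base C (f \<cdot> t))
    (change_of_base C t \<circ>\<^sub>F change_of_base C f) \<sigma>"
proof -
  have "cartesian_over (Ext (Cod C f)) t (change_of_base C f) (change_of_base C t \<circ>\<^sub>F change_of_base C f)
      (\<lambda>d. pb_top C t (FObj (change_of_base C f) d))"
    using cartesian_over_precomp[OF cartesian_over_change_of_base[OF t(1)], of "Ext (Cod C f)" "change_of_base C f"]
      change_of_base_functor[OF f] t by (simp add: comp_funct_id)
  from cartesian_over_paste[OF cartesian_over_change_of_base[OF f] this f t]
  have comp: "cartesian_over (Ext (Cod C f)) (f \<cdot> t) id_funct (change_of_base C t \<circ>\<^sub>F change_of_base C f)
     (\<lambda>d. pb_top C f d \<cdot> pb_top C t (FObj (change_of_base C f) d))" .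
  have direct: "cartesian_over (Ext (Cod C f)) (f \<cdot> t) id_funct (change_of_base C (f \<cdot> t)) (pb_top C (f \<cdot> t))"
    using cartesian_over_change_of_base[of "f \<cdot> t"] f t by simp
  obtain \<sigma> where "nat_iso (Ext (Cod C f)) (Ext (Dom C (f \<cdot> t))) (change_of_base C (f \<cdot> t))
      (change_of_base C t \<circ>\<^sub>F change_of_base C f) \<sigma>"
    by (rule cartesian_over_unique[OF direct comp])
  then show thesis using that f t by simp
qed

text \<open>With \<open>c = p\<^sup>*(f)\<close> this reads \<open>c\<^sub>! c\<^sup>* p\<^sup>* \<cong> p\<^sup>* f\<^sub>! f\<^sup>*\<close>. Since \<open>f\<^sub>! f\<^sup>*\<close> is the product with \<open>f\<close> in the slice
category, it says that \<open>p\<^sup>*\<close> preserves products with \<open>f\<close>. Both functors are pullbacks of \<open>f\<^sub>! f\<^sup>*\<close> along \<open>p\<close>.\<close>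

lemma change_of_base_product:
  assumes f: "f \<in> E" and p: "p \<in> Arr C" and P: "is_pullback C f p b c"
  obtains \<sigma> where "nat_iso (Ext (Cod C f)) (Ext (Dom C p))
    ((pushforward c \<circ>\<^sub>F change_of_base C c) \<circ>\<^sub>F change_of_base C p)
    (change_of_base C p \<circ>\<^sub>F (pushforward f \<circ>\<^sub>F change_of_base C f)) \<sigma>"
proof -
  note Pd = pullbackD[OF P]
  have fA: "f \<in> Arr C" and cE: "c \<in> E" using f E_Arr E_pullback[OF P] by auto
  let ?B = "Ext (Cod C f)" and ?A = "Ext (Dom C f)" and ?E = "Ext (Dom C p)"
  let ?M = "pushforward f \<circ>\<^sub>F change_of_base C f"
  let ?N = "(pushforward c \<circ>\<^sub>F change_of_base C c) \<circ>\<^sub>F change_of_base C p"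
  interpret fs: cat_functor ?B ?A "change_of_base C f" using fA by (rule change_of_base_functor)
  interpret ps: cat_functor ?B ?E "change_of_base C p" using change_of_base_functor[OF p] Pd by simp
  interpret cs: cat_functor ?E "Ext (Dom C c)" "change_of_base C c" using change_of_base_functor[OF Pd(5)] Pd by simp
  have M: "cat_functor ?B ?B ?M"
    by (rule cat_functor_comp[OF fs.cat_functor_axioms pushforward_functor[OF f]])
  have N: "cat_functor ?B ?E ?N"
    using cat_functor_comp[OF ps.cat_functor_axioms cat_functor_comp[OF cs.cat_functor_axioms]]
      pushforward_functor[OF cE] Pd by simp
  have pbf: "is_pullback C y f (pb_top C f y) (pb_along C f y)"
    and pbp: "is_pullback C y p (pb_top C p y) (pb_along C p y)"
    and pbc: "is_pullback C (pb_along C p y) c (pb_top C c (pb_along C p y)) (pb_along C c (pb_along C p y))"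
    if y: "y \<in> Obj ?B" for y
    using y fA p Pd ps.FObj_Obj[OF y] by (simp_all add: Ext_Obj pb_is_pullback)
  \<comment> \<open>At \<open>y\<close>, the left functor has the value \<open>c \<cdot> n y\<close>, and \<open>l y\<close> is the projection of its domain to that of \<open>y\<close>.\<close>
  define n where "n = (\<lambda>y. pb_along C c (pb_along C p y))"
  have n_eq: "pb_along C c (pb_along C p y) = n y" for y by (simp add: n_def)
  define l where "l = (\<lambda>y. pb_top C p y \<cdot> pb_top C c (pb_along C p y))"
  have total: "is_pullback C y (f \<cdot> b) (l y) (n y)" if y: "y \<in> Obj ?B" for y
    using pullback_paste[OF pbp[OF y] pbc[OF y]] Pd by (simp add: n_def l_def)
  \<comment> \<open>The top edge at \<open>y\<close> has the components \<open>l y\<close> and \<open>b \<cdot> n y\<close> in the product of \<open>y\<close> and \<open>f\<close>.\<close>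
  have "\<exists>r. \<forall>y\<in>Obj ?B. r y \<in> Arr C \<and> Dom C (r y) = Dom C (n y) \<and> Cod C (r y) = Dom C (pb_along C f y) \<and>
      pb_top C f y \<cdot> r y = l y \<and> pb_along C f y \<cdot> r y = b \<cdot> n y"
  proof (rule bchoice, rule ballI)
    fix y assume y: "y \<in> Obj ?B"
    note t = pullbackD[OF total[OF y]] and d = pullbackD[OF pbf[OF y]]
    have prem: "b \<cdot> n y \<in> Arr C" "Dom C (l y) = Dom C (b \<cdot> n y)" "Cod C (b \<cdot> n y) = Dom C f"
      "y \<cdot> l y = f \<cdot> (b \<cdot> n y)"
      using t Pd reassoc[OF Pd(9), of "n y"] by simp_all
    obtain r where "r \<in> Arr C" "Dom C r = Dom C (l y)" "Cod C r = Dom C (pb_top C f y)"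
      "pb_top C f y \<cdot> r = l y" "pb_along C f y \<cdot> r = b \<cdot> n y"
      by (rule pullback_lift[OF pbf[OF y] t(4) prem(1,2) t(7) prem(3,4)])
    then show "\<exists>r. r \<in> Arr C \<and> Dom C r = Dom C (n y) \<and> Cod C r = Dom C (pb_along C f y) \<and>
      pb_top C f y \<cdot> r = l y \<and> pb_along C f y \<cdot> r = b \<cdot> n y"
      using t(6) d(6) by (intro exI[of _ r]) simp
  qed
  then obtain r where "\<forall>y\<in>Obj ?B. r y \<in> Arr C \<and> Dom C (r y) = Dom C (n y) \<and> Cod C (r y) = Dom C (pb_along C f y) \<and>
      pb_top C f y \<cdot> r y = l y \<and> pb_along C f y \<cdot> r y = b \<cdot> n y" ..
  then have r: "\<And>y. y \<in> Obj ?B \<Longrightarrow> r y \<in> Arr C" "\<And>y. y \<in> Obj ?B \<Longrightarrow> Dom C (r y) = Dom C (n y)"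
    "\<And>y. y \<in> Obj ?B \<Longrightarrow> Cod C (r y) = Dom C (pb_along C f y)"
    "\<And>y. y \<in> Obj ?B \<Longrightarrow> pb_top C f y \<cdot> r y = l y"
    "\<And>y. y \<in> Obj ?B \<Longrightarrow> pb_along C f y \<cdot> r y = b \<cdot> n y"
    by simp_all
  have cart: "is_pullback C (f \<cdot> pb_along C f y) p (r y) (c \<cdot> n y)" if y: "y \<in> Obj ?B" for y
  proof -
    note d = pullbackD[OF pbf[OF y]]
    have X: "is_pullback C (pb_along C f y) b (r y) (n y)"
      by (rule pullback_cancel[OF total[OF y, folded r(4)[OF y]] pbf[OF y]])
        (use r[OF y] d Pd in simp_all)
    show ?thesis
      by (rule pullback_sym[OF pullback_paste[OF pullback_sym[OF P] pullback_sym[OF X]]])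
  qed
  have "cartesian_over ?B p ?M ?N r"
    unfolding cartesian_over_def
  proof (intro conjI ballI)
    show "is_pullback C (FObj ?M y) p (r y) (FObj ?N y)" if "y \<in> Obj ?B" for y
      using cart[OF that] by (simp add: n_def)
    fix m assume m: "m \<in> Arr ?B"
    obtain x h y where xhy: "m = (x, h, y)" by (cases m)
    have m': "(x, h, y) \<in> Arr ?B" and o: "x \<in> Obj ?B" "y \<in> Obj ?B"
      using m by (auto simp: xhy Ext_Arr Ext_Obj)
    obtain k where k: "FArr (change_of_base C f) (x, h, y) = (pb_along C f x, k, pb_along C f y)"
      "(pb_along C f x, k, pb_along C f y) \<in> Arr ?A" "pb_top C f y \<cdot> k = h \<cdot> pb_top C f x"
      by (rule change_of_base_Arr[OF m' fA])
    obtain k1 where k1: "FArr (change_of_base C p) (x, h, y) = (pb_along C p x, k1, pb_along C p y)"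
      "(pb_along C p x, k1, pb_along C p y) \<in> Arr (Ext (Cod C c))" "pb_top C p y \<cdot> k1 = h \<cdot> pb_top C p x"
      using change_of_base_Arr[of x h y p] m' p Pd(3,8) by metis
    obtain k2 where k2: "FArr (change_of_base C c) (pb_along C p x, k1, pb_along C p y) = (n x, k2, n y)"
      "(n x, k2, n y) \<in> Arr (Ext (Dom C c))"
      "pb_top C c (pb_along C p y) \<cdot> k2 = k1 \<cdot> pb_top C c (pb_along C p x)"
      unfolding n_def by (rule change_of_base_Arr[OF k1(2) Pd(5)])
    note a = m'[unfolded Ext_Arr] k(2)[unfolded Ext_Arr] k1(2)[unfolded Ext_Arr] k2(2)[unfolded Ext_Arr]
    note t = pullbackD(4-8)[OF pbf[OF o(1)]] pullbackD(4-8)[OF pbf[OF o(2)]]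
      pullbackD(4-8)[OF pbp[OF o(1)]] pullbackD(4-8)[OF pbp[OF o(2)]]
      pullbackD(4-8)[OF pbc[OF o(1)], unfolded n_eq] pullbackD(4-8)[OF pbc[OF o(2)], unfolded n_eq]
      r(1-3)[OF o(1)] r(1-3)[OF o(2)]
    have "k \<cdot> r x = r y \<cdot> k2"
    proof (rule pullback_eqI[OF pbf[OF o(2)]])
      have "pb_top C f y \<cdot> (k \<cdot> r x) = h \<cdot> l x"
        using reassoc[OF k(3), of "r x"] r(4)[OF o(1)] a t by simp
      also have "\<dots> = (pb_top C p y \<cdot> k1) \<cdot> pb_top C c (pb_along C p x)"
        unfolding k1(3) l_def using a t by simp
      also have "\<dots> = l y \<cdot> k2"
        using k2(3) a t by (simp add: l_def)
      also have "\<dots> = pb_top C f y \<cdot> (r y \<cdot> k2)"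
        using reassoc[OF r(4)[OF o(2)], of k2] a t by simp
      finally show "pb_top C f y \<cdot> (k \<cdot> r x) = pb_top C f y \<cdot> (r y \<cdot> k2)" .
      have "pb_along C f y \<cdot> (k \<cdot> r x) = b \<cdot> n x"
        using reassoc[of "pb_along C f y" k "pb_along C f x" "r x"] r(5)[OF o(1)] a t by simp
      also have "\<dots> = (b \<cdot> n y) \<cdot> k2" using a t Pd by simp
      also have "\<dots> = pb_along C f y \<cdot> (r y \<cdot> k2)"
        using reassoc[OF r(5)[OF o(2)], of k2] a t by simp
      finally show "pb_along C f y \<cdot> (k \<cdot> r x) = pb_along C f y \<cdot> (r y \<cdot> k2)" .
    qed (use a t in simp_all)
    then show "mid (FArr ?M m) \<cdot> r (Dom ?B m) = r (Cod ?B m) \<cdot> mid (FArr ?N m)"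
      using k(1) k1(1) k2(1) by (simp add: xhy)
  qed (use M N Pd in simp_all)
  moreover have "cartesian_over ?B p ?M (change_of_base C p \<circ>\<^sub>F ?M) (\<lambda>d. pb_top C p (FObj ?M d))"
    using cartesian_over_precomp[OF cartesian_over_change_of_base[OF p], of ?B ?M] M Pd
    by (simp add: comp_funct_id)
  ultimately show thesis
    by (rule cartesian_over_unique) (rule that)
qed

text \<open>By Beck's theorem. The delicate point is that \<open>f\<^sup>*\<close> preserves the coequalizer \<open>e\<close> of an \<open>f\<^sup>*\<close>-split pair
with splitting \<open>q\<close>. The comparison \<open>k\<close> from \<open>q\<close> to \<open>f\<^sup>*(e)\<close> is an isomorphism once \<open>p\<^sup>*(f\<^sub>!(k))\<close> is one,
because \<open>p\<^sup>*\<close> reflects isomorphisms. Both \<open>p\<^sup>* f\<^sub>!(q)\<close> and \<open>p\<^sup>* f\<^sub>! f\<^sup>*(e)\<close> are coequalizers of the same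
pair: the former as the image of a split fork, the latter because it corresponds under
\<open>change_of_base_product\<close> to the image of the split coequalizer \<open>p\<^sup>*(e)\<close>.\<close>

theorem monadic_change_of_base_factor:
  assumes f: "f \<in> E" and t: "t \<in> Arr C" "Cod C t = Dom C f" and p: "p = f \<cdot> t"
    and monadic: "monadic (Ext (Cod C p)) (Ext (Dom C p)) (change_of_base C p)"
  shows "monadic (Ext (Cod C f)) (Ext (Dom C f)) (change_of_base C f)"
proof -
  have fA: "f \<in> Arr C" using f by (rule E_Arr)
  have pA: "p \<in> Arr C" "Dom C p = Dom C t" "Cod C p = Cod C f" using p fA t by simp_all
  let ?B = "Ext (Cod C f)" and ?A = "Ext (Dom C f)" and ?E = "Ext (Dom C p)"
  let ?f = "change_of_base C f" and ?p = "change_of_base C p" and ?t = "change_of_base C t"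
  let ?W = "?p \<circ>\<^sub>F pushforward f"
  interpret f: cat_functor ?B ?A ?f using fA by (rule change_of_base_functor)
  interpret p: cat_functor ?B ?E ?p using change_of_base_functor[OF pA(1)] pA by simp
  interpret t: cat_functor ?A ?E ?t using change_of_base_functor[OF t(1)] t pA by simp
  interpret push: cat_functor ?A ?B "pushforward f" using f by (rule pushforward_functor)
  interpret W: cat_functor ?A ?E ?W
    by (rule cat_functor_comp[OF push.cat_functor_axioms p.cat_functor_axioms])
  have P: "is_pullback C f p (pb_top C p f) (pb_along C p f)"
    using f pA by (simp add: pb_is_pullback)
  define c where "c = pb_along C p f"
  note Pd = pullbackD[OF P, folded c_def]
  have cE: "c \<in> E" using E_pullback[OF P f] by (simp add: c_def)
  let ?N = "pushforward c \<circ>\<^sub>F change_of_base C c"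
  interpret N: cat_functor ?E ?E ?N
    using cat_functor_comp[OF change_of_base_functor[OF Pd(5)] pushforward_functor[OF cE]] Pd by simp
  obtain \<sigma>0 where \<sigma>0: "nat_iso ?B ?E ?p (?t \<circ>\<^sub>F ?f) \<sigma>0"
    using change_of_base_comp[OF fA t] by (simp add: p pA)
      (metis pA(2) p)
  obtain \<sigma> where \<sigma>: "nat_iso ?B ?E (?t \<circ>\<^sub>F ?f) ?p \<sigma>"
    using nat_iso_inverse[OF \<sigma>0] by blast
  obtain \<tau> where \<tau>: "nat_iso ?B ?E (?N \<circ>\<^sub>F ?p) (?W \<circ>\<^sub>F ?f) \<tau>"
    using change_of_base_product[OF f pA(1) P] unfolding c_def comp_funct_assoc by blast
  have beck: "beck_condition ?B ?E ?p"
    using beck_necessary[OF monadic] pA by simp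
  have conservative: "is_iso ?B h" if "h \<in> Arr ?B" "is_iso ?E (FArr ?p h)" for h
    using beck that by (simp add: beck_condition_def)
  have "beck_condition ?B ?A ?f"
    unfolding beck_condition_def
  proof (intro conjI ballI allI impI; (elim conjE)?)
    fix h assume h: "h \<in> Arr ?B" "is_iso ?A (FArr ?f h)"
    then have "is_iso ?E (FArr (?t \<circ>\<^sub>F ?f) h)" by (simp add: t.F_iso)
    then show "is_iso ?B h"
      using nat_iso_transports_iso[OF \<sigma> h(1)] conservative h(1) by simp
  next
    fix u v q s r
    assume u: "u \<in> Arr ?B" and v: "v \<in> Arr ?B" "Dom ?B v = Dom ?B u" "Cod ?B v = Cod ?B u"
      and split: "split_fork ?A (FArr ?f u) (FArr ?f v) q s r"
    have "split_fork ?E (FArr (?t \<circ>\<^sub>F ?f) u) (FArr (?t \<circ>\<^sub>F ?f) v) (FArr ?t q) (FArr ?t s) (FArr ?t r)"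
      using t.F_split_fork[OF split] by simp
    then obtain q1 s1 r1 where split_p: "split_fork ?E (FArr ?p u) (FArr ?p v) q1 s1 r1"
      by (rule nat_iso_split_fork[OF \<sigma> u v(1) v(2,3)[symmetric]])
    have "\<exists>e. is_coequalizer ?B u v e \<and> is_coequalizer ?E (FArr ?p u) (FArr ?p v) (FArr ?p e)"
      using beck u v split_p unfolding beck_condition_def by blast
    then obtain e where e: "is_coequalizer ?B u v e" "is_coequalizer ?E (FArr ?p u) (FArr ?p v) (FArr ?p e)"
      by blast
    \<comment> \<open>Being preserved by \<open>p\<^sup>*\<close>, the coequalizer \<open>e\<close> becomes split under \<open>p\<^sup>*\<close>.\<close>
    note eD = is_coequalizerD[OF e(1)] and qD = split_forkD[OF split]
    obtain s2 where "split_fork ?E (FArr ?p u) (FArr ?p v) (FArr ?p e) s2 r1"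
      by (rule p.target.coequalizer_of_split_fork[OF split_p e(2)])
    from N.F_split_fork[OF this]
    have "split_fork ?E (FArr (?N \<circ>\<^sub>F ?p) u) (FArr (?N \<circ>\<^sub>F ?p) v) (FArr (?N \<circ>\<^sub>F ?p) e) (FArr ?N s2) (FArr ?N r1)"
      by simp
    then obtain q3 s3 r3 where
      split3: "split_fork ?E (FArr (?W \<circ>\<^sub>F ?f) u) (FArr (?W \<circ>\<^sub>F ?f) v) q3 s3 r3"
      and q3: "q3 \<cdot>\<^bsub>?E\<^esub> \<tau> (Cod ?B u) = FArr (?N \<circ>\<^sub>F ?p) e"
      by (rule nat_iso_split_fork[OF \<tau> u v(1) v(2,3)[symmetric]])
    \<comment> \<open>The transported coequalizer \<open>q3\<close> agrees with the image of \<open>e\<close> up to a component of \<open>\<tau>\<close>.\<close>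
    have We: "is_coequalizer ?E (FArr ?W (FArr ?f u)) (FArr ?W (FArr ?f v)) (FArr ?W (FArr ?f e))"
    proof -
      have nt: "nat_trans ?B ?E (?N \<circ>\<^sub>F ?p) (?W \<circ>\<^sub>F ?f) \<tau>"
        and iso: "\<And>y. y \<in> Obj ?B \<Longrightarrow> is_iso ?E (\<tau> y)"
        using \<tau> by (simp_all add: nat_iso_def)
      define Y Q where "Y = Cod ?B u" and "Q = Cod ?B e"
      have YQ: "Y \<in> Obj ?B" "Q \<in> Obj ?B" "Dom ?B e = Y" "Cod ?B e = Q" "Cod ?B u = Y"
        using eD by (auto simp: Y_def Q_def)
      note \<tau>D = nat_transD[OF nt]
      have q3D: "q3 \<in> Arr ?E" "Dom ?E q3 = FObj (?W \<circ>\<^sub>F ?f) Y"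
        using split_forkD(5,6)[OF split3] u YQ by simp_all
      have "Cod ?E (q3 \<cdot>\<^bsub>?E\<^esub> \<tau> Y) = FObj (?N \<circ>\<^sub>F ?p) Q"
        using cat_functor.F_arr(3)[OF cat_functor_comp[OF p.cat_functor_axioms N.cat_functor_axioms] eD(5)] q3 YQ
        by simp
      then have q3c: "Cod ?E q3 = FObj (?N \<circ>\<^sub>F ?p) Q"
        using q3D \<tau>D(1-3)[OF YQ(1)] by simp
      have "FArr (?W \<circ>\<^sub>F ?f) e \<cdot>\<^bsub>?E\<^esub> \<tau> Y = \<tau> Q \<cdot>\<^bsub>?E\<^esub> (q3 \<cdot>\<^bsub>?E\<^esub> \<tau> Y)"
        using \<tau>D(4)[OF eD(5)] q3 YQ by simp
      also have "\<dots> = (\<tau> Q \<cdot>\<^bsub>?E\<^esub> q3) \<cdot>\<^bsub>?E\<^esub> \<tau> Y"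
        by (rule p.target.assoc[symmetric]) (use q3D q3c \<tau>D(1-3) YQ in simp_all)
      finally have "FArr (?W \<circ>\<^sub>F ?f) e = \<tau> Q \<cdot>\<^bsub>?E\<^esub> q3"
        by (rule p.target.iso_cancel_right[OF iso[OF YQ(1)], rotated -1])
          (use q3D q3c \<tau>D(1-3) YQ eD in simp_all)
      moreover have "is_coequalizer ?E (FArr (?W \<circ>\<^sub>F ?f) u) (FArr (?W \<circ>\<^sub>F ?f) v) (\<tau> Q \<cdot>\<^bsub>?E\<^esub> q3)"
        by (rule p.target.coequalizer_comp_iso[OF p.target.split_fork_coequalizer[OF split3] iso[OF YQ(2)]])
          (use q3c \<tau>D(2) YQ in simp)
      ultimately show ?thesis by simp
    qed
    have Wq: "is_coequalizer ?E (FArr ?W (FArr ?f u)) (FArr ?W (FArr ?f v)) (FArr ?W q)"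
      by (rule p.target.split_fork_coequalizer[OF W.F_split_fork[OF split]])
    have "FArr ?f e \<cdot>\<^bsub>?A\<^esub> FArr ?f u = FArr ?f e \<cdot>\<^bsub>?A\<^esub> FArr ?f v"
      using eD by (simp flip: f.F_comp)
    then obtain k where k: "k \<in> Arr ?A" "Dom ?A k = Cod ?A q" "Cod ?A k = Cod ?A (FArr ?f e)"
      "k \<cdot>\<^bsub>?A\<^esub> q = FArr ?f e"
      using coequalizer_factor[OF f.target.split_fork_coequalizer[OF split], of "FArr ?f e"] eD by auto
    have "FArr ?W k \<cdot>\<^bsub>?E\<^esub> FArr ?W q = FArr ?W (FArr ?f e)"
      unfolding k(4)[symmetric] by (rule W.F_comp[symmetric]) (use k qD in simp_all)
    then have "is_iso ?E (FArr ?W k)"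
      by (rule p.target.coequalizer_comparison_iso[OF Wq We, rotated -1]) (use k qD in simp_all)
    then have "is_iso ?B (FArr (pushforward f) k)"
      using conservative[of "FArr (pushforward f) k"] k by simp
    then have "is_iso ?A k"
      using k(1) pushforward_Arr[OF f] by (cases k) (auto simp: Ext_iso)
    then have "is_coequalizer ?A (FArr ?f u) (FArr ?f v) (FArr ?f e)"
      using f.target.coequalizer_comp_iso[OF f.target.split_fork_coequalizer[OF split], of k] k by simp
    then show "\<exists>e. is_coequalizer ?B u v e \<and> is_coequalizer ?A (FArr ?f u) (FArr ?f v) (FArr ?f e)"
      using e(1) by blast
  qed
  moreover obtain \<eta> \<epsilon> where "adjunction ?A ?B (pushforward f) ?f \<eta> \<epsilon>"
    by (rule change_of_base_adjunction[OF f])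
  ultimately show ?thesis
    by (intro adjoint_functors.beck_sufficient) (rule adjoint_functors.intro)
qed

text \<open>The monadic functor \<open>p\<^sup>*\<close> reflects isomorphisms. Comparison isomorphisms carry this over from the chosen
pullbacks to arbitrary ones, such as those that arise by pasting.\<close>

lemma pullback_reflects_iso:
  assumes p: "p \<in> Arr C" and monadic: "monadic (Ext (Cod C p)) (Ext (Dom C p)) (change_of_base C p)"
    and w: "w \<in> E" and w': "w' \<in> E"
    and m: "m \<in> Arr C" "Cod C m = Dom C w'" "w' \<cdot> m = w"
    and pb: "is_pullback C w p a b" and pb': "is_pullback C w' p a' b'"
    and m': "is_iso C m'" "Dom C m' = Dom C a" "Cod C m' = Dom C a'" "a' \<cdot> m' = m \<cdot> a" "b' \<cdot> m' = b"
  shows "is_iso C m"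
proof -
  note d = pullbackD[OF pb] and d' = pullbackD[OF pb']
  have m'A: "m' \<in> Arr C" using m'(1) by (rule iso_arr)
  have wm: "Dom C m = Dom C w" using comp_arr(2)[OF m(1) _ m(2)] d' m(3) by simp
  have arr: "(w, m, w') \<in> Arr (Ext (Cod C p))"
    using w w' m wm d d' by (simp add: Ext_Arr)
  have T: "is_pullback C w p (pb_top C p w) (pb_along C p w)"
    and T': "is_pullback C w' p (pb_top C p w') (pb_along C p w')"
    using w w' p d d' by (simp_all add: pb_is_pullback)
  note t = pullbackD[OF T] and t' = pullbackD[OF T']
  obtain k where k: "FArr (change_of_base C p) (w, m, w') = (pb_along C p w, k, pb_along C p w')"
    "(pb_along C p w, k, pb_along C p w') \<in> Arr (Ext (Dom C p))"
    "pb_top C p w' \<cdot> k = m \<cdot> pb_top C p w"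
    by (rule change_of_base_Arr[OF arr p])
  have kA: "k \<in> Arr C" "Dom C k = Dom C (pb_along C p w)" "Cod C k = Dom C (pb_along C p w')"
    "pb_along C p w' \<cdot> k = pb_along C p w"
    using k(2) by (simp_all add: Ext_Arr)
  obtain i where i: "i \<in> Arr C" "Dom C i = Dom C a" "Cod C i = Dom C (pb_top C p w)"
    "pb_top C p w \<cdot> i = a" "pb_along C p w \<cdot> i = b"
    by (rule pullback_lift[OF T d(4,5) d(6)[symmetric] d(7,8,9)])
  obtain i' where i': "i' \<in> Arr C" "Dom C i' = Dom C a'" "Cod C i' = Dom C (pb_top C p w')"
    "pb_top C p w' \<cdot> i' = a'" "pb_along C p w' \<cdot> i' = b'"
    by (rule pullback_lift[OF T' d'(4,5) d'(6)[symmetric] d'(7,8,9)])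
  have iso: "is_iso C i" "is_iso C i'"
    using pullback_comparison_iso[OF pb T i] pullback_comparison_iso[OF pb' T' i'] by simp_all
  have "k \<cdot> i = i' \<cdot> m'"
  proof (rule pullback_eqI[OF T'])
    show "pb_top C p w' \<cdot> (k \<cdot> i) = pb_top C p w' \<cdot> (i' \<cdot> m')"
      using reassoc[OF k(3), of i] reassoc[OF i'(4), of m'] i(1-4) i'(1-3) kA t t' m m' m'A wm by simp
    show "pb_along C p w' \<cdot> (k \<cdot> i) = pb_along C p w' \<cdot> (i' \<cdot> m')"
      using reassoc[OF kA(4), of i] reassoc[OF i'(5), of m'] i i'(1-3) kA t t' m' m'A by simp
  qed (use i i' kA t t' m' m'A in simp_all)
  then have "is_iso C (k \<cdot> i)"
    using iso_comp[OF m'(1) iso(2)] i' m' by simp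
  then have "is_iso C k"
    by (rule iso_comp_cancel[OF iso(1)]) (use kA i t in simp_all)
  then have "is_iso (Ext (Dom C p)) (FArr (change_of_base C p) (w, m, w'))"
    using k Ext_iso by simp
  then have "is_iso (Ext (Cod C p)) (w, m, w')"
    using beck_necessary[OF monadic] arr by (simp add: beck_condition_def)
  then show ?thesis using Ext_iso[OF arr] by simp
qed

end

section \<open>Trivial and normal extensions\<close>

locale galois_context =
  fixes \<Gamma> :: "('oc, 'ac, 'ox, 'ax) galois"
  assumes galois: "galois_structure \<Gamma>"
begin

abbreviation "C \<equiv> gal_C \<Gamma>"
abbreviation "X \<equiv> gal_X \<Gamma>"
abbreviation "I \<equiv> gal_I \<Gamma>"
abbreviation "H \<equiv> gal_H \<Gamma>"
abbreviation "\<eta> \<equiv> gal_eta \<Gamma>"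
abbreviation "E \<equiv> gal_E \<Gamma>"
abbreviation "HI f \<equiv> FArr H (FArr I f)"

sublocale adjoint_functors C X I H \<eta> "gal_eps \<Gamma>"
  using galois by unfold_locales (simp add: galois_structure_def)

sublocale extension_class C E
  by (rule extension_class.intro[OF L.source.category_axioms])
    (use galois in \<open>simp add: extension_class_axioms_def galois_structure_def\<close>)

lemma HI_E: "f \<in> E \<Longrightarrow> HI f \<in> E"
  using galois by (auto simp: galois_structure_def)

lemma trivial_extension_iff:
  "trivial_extension \<Gamma> f \<longleftrightarrow>
     f \<in> E \<and> is_pullback C (HI f) (\<eta> (Cod C f)) (\<eta> (Dom C f)) f"
  by (simp add: trivial_extension_def)

lemma monadic_extension_iff:
  "monadic_extension \<Gamma> f \<longleftrightarrow>
     f \<in> E \<and> monadic (Ext (Cod C f)) (Ext (Dom C f)) (change_of_base C f)"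
  by (simp add: monadic_extension_def ext_slice_def)

text \<open>As a right adjoint, \<open>H\<close> preserves the pullback square that \<open>I\<close> is assumed to preserve. Pasting \<open>sq\<close> with
the naturality square of \<open>f\<close> gives the same outer square as pasting the naturality square of \<open>c\<close> with
the image of \<open>sq\<close> under \<open>H I\<close>, so the naturality square of \<open>c\<close> is a pullback by cancellation.\<close>

lemma trivial_extension_pullback:
  assumes trivial: "trivial_extension \<Gamma> f" and sq: "is_pullback C f g a c"
    and I_sq: "is_pullback X (FArr I f) (FArr I g) (FArr I a) (FArr I c)"
  shows "trivial_extension \<Gamma> c"
proof -
  note d = pullbackD[OF sq]
  have HI_sq: "is_pullback C (HI f) (HI g) (HI a) (HI c)"
    by (rule right_adjoint_pullback[OF I_sq])
  have f: "f \<in> E" "is_pullback C (HI f) (\<eta> (Cod C f)) (\<eta> (Dom C f)) f"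
    using trivial by (simp_all add: trivial_extension_iff)
  have "is_pullback C (HI f) (HI g \<cdot>\<^bsub>C\<^esub> \<eta> (Dom C g)) (HI a \<cdot>\<^bsub>C\<^esub> \<eta> (Dom C a)) c"
    using L.source.pullback_paste[OF f(2) sq] unit_natural[of g] unit_natural[of a] d by simp
  then have "is_pullback C (HI c) (\<eta> (Dom C g)) (\<eta> (Dom C a)) c"
    by (rule L.source.pullback_cancel[OF _ HI_sq]) (use d unit_natural[of c] in simp_all)
  then show ?thesis
    using d E_pullback[OF sq f(1)] by (simp add: trivial_extension_iff)
qed

text \<open>Let \<open>r\<close> be the pullback of \<open>H I (k)\<close> along the unit and \<open>m\<close> the comparison from \<open>k\<close> to \<open>r\<close>; triviality of
\<open>k\<close> means that \<open>m\<close> is an isomorphism. The pullback of \<open>r\<close> along \<open>g\<close> is the pullback of \<open>H I (k)\<close> along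
\<open>\<eta> \<cdot> g = H I (g) \<cdot> \<eta>\<close>, which is \<open>c\<close> because \<open>c\<close> is trivial and \<open>H I\<close> preserves \<open>sq\<close>. So \<open>m\<close> becomes
invertible after pullback along \<open>g\<close>. As \<open>g\<close> is itself the pullback of \<open>p\<close> along \<open>f\<close>, this is the same as
pulling back \<open>m\<close>, viewed over the codomain of \<open>f\<close>, along \<open>p\<close>, and \<open>pullback_reflects_iso\<close> applies.\<close>

lemma trivial_extension_descends:
  assumes p: "monadic_extension \<Gamma> p" and f: "f \<in> E" and P: "is_pullback C f p g b"
    and k: "k \<in> E" and sq: "is_pullback C k g a c"
    and I_sq: "is_pullback X (FArr I k) (FArr I g) (FArr I a) (FArr I c)"
    and trivial: "trivial_extension \<Gamma> c"
  shows "trivial_extension \<Gamma> k"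
proof -
  note Pd = pullbackD[OF P] and d = pullbackD[OF sq]
  have pE: "p \<in> E" and p_monadic: "monadic (Ext (Cod C p)) (Ext (Dom C p)) (change_of_base C p)"
    using p by (simp_all add: monadic_extension_iff)
  have fA: "f \<in> Arr C" and kA: "k \<in> Arr C" using f k by (simp_all add: E_Arr)
  define r r' where "r = pb_along C (\<eta> (Cod C k)) (HI k)" and "r' = pb_top C (\<eta> (Cod C k)) (HI k)"
  have R: "is_pullback C (HI k) (\<eta> (Cod C k)) r' r"
    unfolding r_def r'_def by (rule pb_is_pullback[OF HI_E[OF k]]) (use kA in simp_all)
  note Rd = pullbackD[OF R]
  have rE: "r \<in> E" by (rule E_pullback[OF R HI_E[OF k]])
  have prem: "\<eta> (Dom C k) \<in> Arr C" "Dom C (\<eta> (Dom C k)) = Dom C k"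
    "Cod C (\<eta> (Dom C k)) = Dom C (HI k)" "Cod C k = Dom C (\<eta> (Cod C k))"
    "HI k \<cdot>\<^bsub>C\<^esub> \<eta> (Dom C k) = \<eta> (Cod C k) \<cdot>\<^bsub>C\<^esub> k"
    using kA unit_natural[of k] by simp_all
  obtain m where m: "m \<in> Arr C" "Dom C m = Dom C (\<eta> (Dom C k))" "Cod C m = Dom C r'"
    "r' \<cdot>\<^bsub>C\<^esub> m = \<eta> (Dom C k)" "r \<cdot>\<^bsub>C\<^esub> m = k"
    by (rule pullback_lift[OF R prem(1) kA prem(2-5)])
  note m = m[unfolded prem(2)]
  define a' c' where "a' = pb_top C g r" and "c' = pb_along C g r"
  have sq': "is_pullback C r g a' c'"
    unfolding a'_def c'_def by (rule pb_is_pullback[OF rE]) (use d Rd kA in simp_all)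
  note d' = pullbackD[OF sq']
  have rma: "r \<cdot>\<^bsub>C\<^esub> (m \<cdot>\<^bsub>C\<^esub> a) = g \<cdot>\<^bsub>C\<^esub> c"
    using L.source.reassoc[OF m(5), of a] m d Rd by simp
  have ma: "m \<cdot>\<^bsub>C\<^esub> a \<in> Arr C" "Dom C (m \<cdot>\<^bsub>C\<^esub> a) = Dom C a" "Cod C (m \<cdot>\<^bsub>C\<^esub> a) = Dom C r"
    using m d Rd by simp_all
  obtain m' where m': "m' \<in> Arr C" "Dom C m' = Dom C (m \<cdot>\<^bsub>C\<^esub> a)" "Cod C m' = Dom C a'"
    "a' \<cdot>\<^bsub>C\<^esub> m' = m \<cdot>\<^bsub>C\<^esub> a" "c' \<cdot>\<^bsub>C\<^esub> m' = c"
    by (rule pullback_lift[OF sq' ma(1) d(5) _ ma(3) d(8) rma]) (use ma d in simp)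
  note m' = m'[unfolded ma(2)]
  have "is_pullback C (HI k) (HI g \<cdot>\<^bsub>C\<^esub> \<eta> (Dom C g)) (HI a \<cdot>\<^bsub>C\<^esub> \<eta> (Dom C a)) c"
    using L.source.pullback_paste[OF right_adjoint_pullback[OF I_sq], of "\<eta> (Dom C g)" "\<eta> (Dom C a)" c] trivial d
    by (simp add: trivial_extension_iff)
  then have outer: "is_pullback C (HI k) (\<eta> (Cod C k) \<cdot>\<^bsub>C\<^esub> g) (\<eta> (Dom C k) \<cdot>\<^bsub>C\<^esub> a) c"
    using unit_natural[of g] unit_natural[of a] d by simp
  have "(r' \<cdot>\<^bsub>C\<^esub> a') \<cdot>\<^bsub>C\<^esub> m' = \<eta> (Dom C k) \<cdot>\<^bsub>C\<^esub> a"
    using L.source.reassoc[OF m(4), of a] m m' d d' Rd by simp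
  then have m'_iso: "is_iso C m'"
    by (intro L.source.pullback_comparison_iso[OF outer L.source.pullback_paste[OF R sq']]) (use m' d d' Rd kA in simp_all)
  have m_iso: "is_iso C m"
  proof (rule pullback_reflects_iso[OF E_Arr[OF pE] p_monadic])
    show "f \<cdot>\<^bsub>C\<^esub> k \<in> E" "f \<cdot>\<^bsub>C\<^esub> r \<in> E"
      by (rule E_comp; use f k rE Pd d Rd in simp)+
    show "is_pullback C (f \<cdot>\<^bsub>C\<^esub> k) p a (b \<cdot>\<^bsub>C\<^esub> c)" "is_pullback C (f \<cdot>\<^bsub>C\<^esub> r) p a' (b \<cdot>\<^bsub>C\<^esub> c')"
      by (rule L.source.pullback_sym[OF L.source.pullback_paste[OF L.source.pullback_sym[OF P] L.source.pullback_sym[OF sq]]]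
        L.source.pullback_sym[OF L.source.pullback_paste[OF L.source.pullback_sym[OF P] L.source.pullback_sym[OF sq']]])+
    show "(f \<cdot>\<^bsub>C\<^esub> r) \<cdot>\<^bsub>C\<^esub> m = f \<cdot>\<^bsub>C\<^esub> k"
      using m(1-3,5) Rd d Pd by simp
    show "(b \<cdot>\<^bsub>C\<^esub> c') \<cdot>\<^bsub>C\<^esub> m' = b \<cdot>\<^bsub>C\<^esub> c"
      using m' d' d Pd by simp
  qed (use m m' m'_iso Rd d Pd in simp_all)
  have "is_pullback C (HI k) (\<eta> (Cod C k)) (r' \<cdot>\<^bsub>C\<^esub> m) (r \<cdot>\<^bsub>C\<^esub> m)"
    by (rule L.source.pullback_comp_iso[OF R m_iso m(3)])
  then show ?thesis using m k by (simp add: trivial_extension_iff)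
qed

text \<open>The diagonal is a section.\<close>

lemma kernel_pair_split_epi:
  assumes "f \<in> E"
  shows "split_epi C (pb_along C f f)"
proof -
  have f: "f \<in> Arr C" using assms by (rule E_Arr)
  have K: "is_pullback C f f (pb_top C f f) (pb_along C f f)"
    by (rule pb_is_pullback[OF assms f]) simp
  note d = pullbackD[OF K]
  have id: "Ident C (Dom C f) \<in> Arr C" "Dom C (Ident C (Dom C f)) = Dom C f" "Cod C (Ident C (Dom C f)) = Dom C f"
    using f by simp_all
  obtain s where "s \<in> Arr C" "Dom C s = Dom C (Ident C (Dom C f))" "Cod C s = Dom C (pb_top C f f)"
    "pb_along C f f \<cdot>\<^bsub>C\<^esub> s = Ident C (Dom C f)"
    by (rule pullback_lift[OF K id(1) id(1) refl id(3) id(3) refl])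
  then show ?thesis
    using d id by (auto simp: split_epi_def Hom_def)
qed

end

theorem proposition2p4:
  fixes \<Gamma> :: "('oc, 'ac, 'ox, 'ax) galois"
  assumes "galois_structure \<Gamma>"
    and I_pullback: "\<And>f g a c. \<lbrakk>is_pullback (gal_C \<Gamma>) f g a c; split_epi (gal_C \<Gamma>) f;
           f \<in> gal_E \<Gamma>; g \<in> gal_E \<Gamma>\<rbrakk> \<Longrightarrow>
         is_pullback (gal_X \<Gamma>) (FArr (gal_I \<Gamma>) f) (FArr (gal_I \<Gamma>) g)
           (FArr (gal_I \<Gamma>) a) (FArr (gal_I \<Gamma>) c)"
    and "f \<in> gal_E \<Gamma>"
  shows "normal_extension \<Gamma> f \<longleftrightarrow>
    (\<exists>p. monadic_extension \<Gamma> p \<and> Cod (gal_C \<Gamma>) p = Cod (gal_C \<Gamma>) f \<and>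
         trivial_extension \<Gamma> (pb_along (gal_C \<Gamma>) p f) \<and>
         split_epi (gal_C \<Gamma>) (pb_along (gal_C \<Gamma>) p f))"
proof -
  interpret galois_context \<Gamma> by unfold_locales (rule assms(1))
  have f: "f \<in> E" "f \<in> Arr C" using assms(3) E_Arr by simp_all
  show ?thesis
  proof
    assume "normal_extension \<Gamma> f"
    then show "\<exists>p. monadic_extension \<Gamma> p \<and> Cod C p = Cod C f \<and>
         trivial_extension \<Gamma> (pb_along C p f) \<and> split_epi C (pb_along C p f)"
      using kernel_pair_split_epi[OF f(1)] by (intro exI[of _ f]) (simp add: normal_extension_def)
  next
    assume "\<exists>p. monadic_extension \<Gamma> p \<and> Cod C p = Cod C f \<and>
         trivial_extension \<Gamma> (pb_along C p f) \<and> split_epi C (pb_along C p f)"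
    then obtain p where p: "monadic_extension \<Gamma> p" and cod: "Cod C p = Cod C f"
      and trivial: "trivial_extension \<Gamma> (pb_along C p f)" and split: "split_epi C (pb_along C p f)"
      by (elim exE conjE)
    have pE: "p \<in> E" and p_monadic: "monadic (Ext (Cod C p)) (Ext (Dom C p)) (change_of_base C p)"
      using p by (simp_all add: monadic_extension_iff)
    have pA: "p \<in> Arr C" by (rule E_Arr[OF pE])
    define b g where "b = pb_along C p f" and "g = pb_top C p f"
    have P: "is_pullback C f p g b"
      unfolding b_def g_def by (rule pb_is_pullback[OF f(1) pA cod])
    note Pd = pullbackD[OF P]
    have bE: "b \<in> E" by (rule E_pullback[OF P f(1)])
    have gE: "g \<in> E" by (rule E_pullback[OF L.source.pullback_sym[OF P] pE])
    obtain s where s: "s \<in> Arr C" "Dom C s = Dom C p" "Cod C s = Dom C g"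
      "b \<cdot>\<^bsub>C\<^esub> s = Ident C (Dom C p)"
      using split Pd by (auto simp: split_epi_def Hom_def b_def[symmetric])
    \<comment> \<open>The section \<open>s\<close> makes \<open>p\<close> factor through \<open>f\<close>.\<close>
    have "f \<cdot>\<^bsub>C\<^esub> (g \<cdot>\<^bsub>C\<^esub> s) = p"
      using L.source.reassoc[OF Pd(9), of s] s Pd by simp
    then have "monadic (Ext (Cod C f)) (Ext (Dom C f)) (change_of_base C f)"
      by (intro monadic_change_of_base_factor[OF f(1), of "g \<cdot>\<^bsub>C\<^esub> s" p]) (use s Pd p_monadic in simp_all)
    then have f_monadic: "monadic_extension \<Gamma> f"
      using f by (simp add: monadic_extension_iff)
    define k l where "k = pb_along C f f" and "l = pb_top C f f"
    have K: "is_pullback C f f l k"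
      unfolding k_def l_def by (rule pb_is_pullback[OF f refl])
    note Kd = pullbackD[OF K]
    have kE: "k \<in> E" by (rule E_pullback[OF K f(1)])
    have k_split: "split_epi C k" unfolding k_def by (rule kernel_pair_split_epi[OF f(1)])
    define a c where "a = pb_top C g k" and "c = pb_along C g k"
    have sq: "is_pullback C k g a c"
      unfolding a_def c_def by (rule pb_is_pullback[OF kE]) (use Pd Kd in simp_all)
    note d = pullbackD[OF sq]
    \<comment> \<open>The pullback of \<open>k\<close> along \<open>g\<close> is recognized as a pullback of \<open>b\<close> along \<open>b\<close>.\<close>
    have total: "is_pullback C f (p \<cdot>\<^bsub>C\<^esub> b) (l \<cdot>\<^bsub>C\<^esub> a) c"
      using L.source.pullback_paste[OF K sq] Pd(9) by simp
    have la: "l \<cdot>\<^bsub>C\<^esub> a \<in> Arr C" "b \<cdot>\<^bsub>C\<^esub> c \<in> Arr C" "Dom C (l \<cdot>\<^bsub>C\<^esub> a) = Dom C (b \<cdot>\<^bsub>C\<^esub> c)"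
      "Cod C (l \<cdot>\<^bsub>C\<^esub> a) = Dom C f" "Cod C (b \<cdot>\<^bsub>C\<^esub> c) = Dom C p"
      "f \<cdot>\<^bsub>C\<^esub> (l \<cdot>\<^bsub>C\<^esub> a) = p \<cdot>\<^bsub>C\<^esub> (b \<cdot>\<^bsub>C\<^esub> c)"
      using pullbackD(9)[OF total] Kd Pd d by simp_all
    obtain e where e: "e \<in> Arr C" "Dom C e = Dom C (l \<cdot>\<^bsub>C\<^esub> a)" "Cod C e = Dom C g"
      "g \<cdot>\<^bsub>C\<^esub> e = l \<cdot>\<^bsub>C\<^esub> a" "b \<cdot>\<^bsub>C\<^esub> e = b \<cdot>\<^bsub>C\<^esub> c"
      by (rule pullback_lift[OF P la])
    have sq_b: "is_pullback C b b e c"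
      by (rule L.source.pullback_cancel[OF total[folded e(4)] P]) (use e Pd in simp_all)
    have "trivial_extension \<Gamma> c"
      by (rule trivial_extension_pullback[OF trivial[folded b_def] sq_b])
        (rule I_pullback[OF sq_b split[folded b_def] bE bE])
    then have "trivial_extension \<Gamma> k"
      by (rule trivial_extension_descends[OF p f(1) P kE sq I_pullback[OF sq k_split kE gE]])
    then show "normal_extension \<Gamma> f"
      using f_monadic by (simp add: normal_extension_def k_def)
  qed
qed

end
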